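(* Let $\mathcal{P}\rtimes G$ be a transporter category and $x$ an object, with stabilizer $G_x=\operatorname{Stab}_G(x)$. Let $H\subset G_x$ be a $p$-subgroup, and let $K$ be a subgroup of $G_x$ with $K\supset N_{G_x}(H)$. Let $G\cdot x\subset\mathcal{P}$ be the $G$-orbit of $x$. Then there is a one-to-one correspondence between the set of isomorphism classes of indecomposable $k(\mathcal{P}\rtimes G)$-modules with vertex $\{x\}\times H$ and support $(G\cdot x)\rtimes G$, and the set of isomorphism classes of indecomposable $k(\{x\}\times K)$-modules with vertex $\{x\}\times H$ (and support $\{x\}\times K$).
   Context: $G$ is a finite group, $\mathcal{P}$ a finite poset, $k$ an (algebraically closed) field of characteristic $p$ dividing $|G|$; modules are finite-dimensional. A poset is a category with a unique morphism $x\to y$ iff $x\le y$; subposets carry the induced order. A $G$-poset is a poset with a homomorphism $G\to\operatorname{Aut}(\mathcal{P})$; write ${}^gx,{}^g\alpha$ for the action. The transporter category $\mathcal{P}\rtimes G$ of a $G$-poset $\mathcal{P}$ has objects $\operatorname{Ob}\mathcal{P}$ and $\operatorname{Hom}(x,y)=\{\alpha g\mid g\in G,\ \alpha\in\operatorname{Hom}_{\mathcal{P}}({}^gx,y)\}$ (with $\alpha g=\alpha'g'$ iff $\alpha=\alpha'$, $g=g'$), composition $(\alpha g)(\beta h)=(\alpha\,{}^g\beta)(gh)$. If $H\subset G$ is a subgroup and $\mathcal{Q}\subset\mathcal{P}$ an $H$-stable subposet, $\mathcal{Q}\rtimes H$ is a transporter subcategory (written $\mathcal{Q}\times H$ if $H$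 acts trivially on $\mathcal{Q}$); it is weakly convex if $\mathcal{Q}$ is convex in $\mathcal{P}$. For a category $\mathcal{C}$ with finitely many morphisms, $k\mathcal{C}$-modules are identified with functors from $\mathcal{C}$ to finite-dimensional $k$-vector spaces. For $\mathcal{D}\subset\mathcal{C}$, $\downarrow^{\mathcal{C}}_{\mathcal{D}}$ is restriction and $\uparrow^{\mathcal{C}}_{\mathcal{D}}$ its left adjoint (left Kan extension). The support of a module $M$ is the full subcategory on the objects $x$ with $M(x)\neq 0$; the convex support $\operatorname{supp}^cM$ is the smallest convex (full) subcategory containing the support; for a $k(\mathcal{P}\rtimes G)$-module it has the form $\mathcal{P}^c_M\rtimes G$ for a unique convex $G$-subposet $\mathcal{P}^c_M$. For $\mathcal{D}\subset\operatorname{supp}^cM$, $M$ is projective relative to $\mathcal{D}$ if the counit $(M\downarrow_{\operatorname{supp}^cM})\downarrow^{\operatorname{supp}^cM}_{\mathcal{D}}\uparrow^{\operatorname{supp}^cM}_{\mathcal{D}}\to M\downarrow_{\operatorname{supp}^cM}$ is a split surjection. A vertex of an indecomposable $k(\mathcal{P}\rtimes G)$-module $M$ is a minimal (with respect to inclusion) weakly convex transporter subcategory $\mathcal{V}\rtimes H\subset\mathcal{P}^c_M\rtimes G$ relative to which $M$ is projective. The same definitions apply to $\{x\}\times K$ in place of $\mathcal{P}\rtimes G$. *)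

theory Defs
  imports
    Complex_Main
    "HOL-Algebra.Group_Action"
    "HOL-Computational_Algebra.Primes"
    "HOL-Library.Function_Algebras"
begin

section \<open>Small categories\<close>

record ('o, 'a) cat =
  Obj :: "'o set"
  Arr :: "'a set"
  Dom :: "'a \<Rightarrow> 'o"
  Cod :: "'a \<Rightarrow> 'o"
  Ide :: "'o \<Rightarrow> 'a"
  Cmp :: "'a \<Rightarrow> 'a \<Rightarrow> 'a"

text \<open>\<open>Cmp C a b\<close> is the composite "\<open>a\<close> after \<open>b\<close>", meaningful when \<open>Dom C a = Cod C b\<close>.\<close>

definition subcat :: "('o, 'a) cat \<Rightarrow> ('o, 'a) cat \<Rightarrow> bool" where
  "subcat D C \<longleftrightarrow> Obj D \<subseteq> Obj C \<and> Arr D \<subseteq> Arr C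
     \<and> Dom D = Dom C \<and> Cod D = Cod C \<and> Ide D = Ide C \<and> Cmp D = Cmp C"

definition full_subcat :: "('o, 'a) cat \<Rightarrow> 'o set \<Rightarrow> ('o, 'a) cat" where
  "full_subcat C X =
     C\<lparr>Obj := X, Arr := {a \<in> Arr C. Dom C a \<in> X \<and> Cod C a \<in> X}\<rparr>"

definition convex_obs :: "('o, 'a) cat \<Rightarrow> 'o set \<Rightarrow> bool" where
  "convex_obs C X \<longleftrightarrow> X \<subseteq> Obj C \<and>
     (\<forall>a\<in>Arr C. \<forall>b\<in>Arr C. Dom C a = Cod C b \<and> Dom C b \<in> X \<and> Cod C a \<in> X
        \<longrightarrow> Dom C a \<in> X)"


section \<open>Transporter categories\<close>

text \<open>A poset is given by its carrier \<open>P\<close> and its order relation \<open>r\<close>, where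
  \<open>(x, y) \<in> r\<close> means \<open>x \<le> y\<close>. That each \<open>\<phi> g\<close> is a bijection of \<open>P\<close> and \<open>\<phi>\<close> a
  homomorphism is part of \<^locale>\<open>group_action\<close>; as the inverse of \<open>\<phi> g\<close> is \<open>\<phi> (inv g)\<close>,
  monotonicity makes \<open>\<phi> g\<close> an automorphism of the poset.\<close>

definition gposet ::
  "('g, 'm) monoid_scheme \<Rightarrow> 'x set \<Rightarrow> ('x \<times> 'x) set \<Rightarrow> ('g \<Rightarrow> 'x \<Rightarrow> 'x) \<Rightarrow> bool" where
  "gposet G P r \<phi> \<longleftrightarrow> partial_order_on P r \<and> group_action G P \<phi> \<and>
     (\<forall>g\<in>carrier G. \<forall>x y. (x, y) \<in> r \<longrightarrow> (\<phi> g x, \<phi> g y) \<in> r)"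

text \<open>The transporter category of the subgroup \<open>H\<close> of \<open>G\<close> acting on the \<open>H\<close>-stable
  subposet \<open>Q\<close>. The triple \<open>(x, g, y)\<close> encodes the morphism \<open>\<alpha> g : x \<rightarrow> y\<close>, where \<open>\<alpha>\<close> is
  the unique poset morphism \<open>\<phi> g x \<le> y\<close>. Since \<open>\<alpha> (g \<cdot> \<beta>)\<close> is again the unique poset
  morphism between its end points, the composite \<open>(\<alpha> g)(\<beta> h)\<close> only has to record \<open>g h\<close>.\<close>

definition transporter ::
  "('g, 'm) monoid_scheme \<Rightarrow> ('x \<times> 'x) set \<Rightarrow> ('g \<Rightarrow> 'x \<Rightarrow> 'x) \<Rightarrow> 'x set \<Rightarrow> 'g set
     \<Rightarrow> ('x, 'x \<times> 'g \<times> 'x) cat" where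
  "transporter G r \<phi> Q H =
     \<lparr>Obj = Q,
      Arr = {(x, g, y). x \<in> Q \<and> g \<in> H \<and> y \<in> Q \<and> (\<phi> g x, y) \<in> r},
      Dom = (\<lambda>(x, g, y). x),
      Cod = (\<lambda>(x, g, y). y),
      Ide = (\<lambda>x. (x, \<one>\<^bsub>G\<^esub>, x)),
      Cmp = (\<lambda>(y', g, z) (x, h, y). (x, g \<otimes>\<^bsub>G\<^esub> h, z))\<rparr>"

definition convex_subposet :: "'x set \<Rightarrow> ('x \<times> 'x) set \<Rightarrow> 'x set \<Rightarrow> bool" where
  "convex_subposet P r Q \<longleftrightarrow> Q \<subseteq> P \<and>
     (\<forall>a\<in>Q. \<forall>b\<in>P. \<forall>c\<in>Q. (a, b) \<in> r \<and> (b, c) \<in> r \<longrightarrow> b \<in> Q)"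

text \<open>\<open>D\<close> is a weakly convex transporter subcategory of the transporter category of the
  subgroup \<open>L\<close> of \<open>G\<close> acting on the poset \<open>Q\<close>.\<close>

definition weakly_convex_tsub ::
  "('g, 'm) monoid_scheme \<Rightarrow> ('x \<times> 'x) set \<Rightarrow> ('g \<Rightarrow> 'x \<Rightarrow> 'x) \<Rightarrow> 'x set \<Rightarrow> 'g set
     \<Rightarrow> ('x, 'x \<times> 'g \<times> 'x) cat \<Rightarrow> bool" where
  "weakly_convex_tsub G r \<phi> Q L D \<longleftrightarrow>
     (\<exists>V H. D = transporter G r \<phi> V H \<and> subgroup H G \<and> H \<subseteq> L \<and>
        convex_subposet Q r V \<and> (\<forall>h\<in>H. \<forall>v\<in>V. \<phi> h v \<in> V))"


section \<open>Finite-dimensional vector spaces\<close>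

text \<open>Finite-dimensional vector spaces over \<open>'k\<close> are taken to be the finite-dimensional
  subspaces of the fixed infinite-dimensional space of all sequences \<open>nat \<Rightarrow> 'k\<close>. Every
  finite-dimensional vector space is isomorphic to one of these, so that the isomorphism classes
  of functors into them are those of all functors to finite-dimensional vector spaces.\<close>

definition seq_scale :: "'k::field \<Rightarrow> (nat \<Rightarrow> 'k) \<Rightarrow> (nat \<Rightarrow> 'k)" where
  "seq_scale c v = (\<lambda>i. c * v i)"

global_interpretation seqs: vector_space "seq_scale :: 'k::field \<Rightarrow> _"
  by unfold_locales (auto simp: seq_scale_def fun_eq_iff algebra_simps)

definition fd_space :: "(nat \<Rightarrow> 'k::field) set \<Rightarrow> bool" where
  "fd_space V \<longleftrightarrow> (\<exists>B. finite B \<and> seqs.span B = V)"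

definition lin_map ::
  "(nat \<Rightarrow> 'k::field) set \<Rightarrow> (nat \<Rightarrow> 'k) set \<Rightarrow> ((nat \<Rightarrow> 'k) \<Rightarrow> (nat \<Rightarrow> 'k)) \<Rightarrow> bool" where
  "lin_map V W f \<longleftrightarrow> (\<forall>v\<in>V. f v \<in> W) \<and> (\<forall>u\<in>V. \<forall>v\<in>V. f (u + v) = f u + f v)
     \<and> (\<forall>c. \<forall>v\<in>V. f (seq_scale c v) = seq_scale c (f v))"


section \<open>Modules as functors\<close>

text \<open>The values of \<open>Spc\<close> and \<open>Map\<close> outside the category under consideration, and the values
  of a map outside its source space, are irrelevant. Hence the restriction of a module to a
  subcategory \<open>D\<close> is represented by the same record, regarded over \<open>D\<close>.\<close>

record ('o, 'a, 'k) kmod =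
  Spc :: "'o \<Rightarrow> (nat \<Rightarrow> 'k) set"
  Map :: "'a \<Rightarrow> (nat \<Rightarrow> 'k) \<Rightarrow> (nat \<Rightarrow> 'k)"

definition is_module :: "('o, 'a) cat \<Rightarrow> ('o, 'a, 'k::field) kmod \<Rightarrow> bool" where
  "is_module C M \<longleftrightarrow>
     (\<forall>x\<in>Obj C. fd_space (Spc M x)) \<and>
     (\<forall>a\<in>Arr C. lin_map (Spc M (Dom C a)) (Spc M (Cod C a)) (Map M a)) \<and>
     (\<forall>x\<in>Obj C. \<forall>v\<in>Spc M x. Map M (Ide C x) v = v) \<and>
     (\<forall>a\<in>Arr C. \<forall>b\<in>Arr C. Dom C a = Cod C b \<longrightarrow>
        (\<forall>v\<in>Spc M (Dom C b). Map M (Cmp C a b) v = Map M a (Map M b v)))"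

definition mod_hom ::
  "('o, 'a) cat \<Rightarrow> ('o, 'a, 'k::field) kmod \<Rightarrow> ('o, 'a, 'k) kmod
     \<Rightarrow> ('o \<Rightarrow> (nat \<Rightarrow> 'k) \<Rightarrow> (nat \<Rightarrow> 'k)) \<Rightarrow> bool" where
  "mod_hom C M N \<theta> \<longleftrightarrow>
     (\<forall>x\<in>Obj C. lin_map (Spc M x) (Spc N x) (\<theta> x)) \<and>
     (\<forall>a\<in>Arr C. \<forall>v\<in>Spc M (Dom C a).
        \<theta> (Cod C a) (Map M a v) = Map N a (\<theta> (Dom C a) v))"

definition mod_iso :: "('o, 'a) cat \<Rightarrow> ('o, 'a, 'k::field) kmod \<Rightarrow> ('o, 'a, 'k) kmod \<Rightarrow> bool" where
  "mod_iso C M N \<longleftrightarrow> (\<exists>\<theta> \<psi>. mod_hom C M N \<theta> \<and> mod_hom C N M \<psi> \<and>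
     (\<forall>x\<in>Obj C. (\<forall>v\<in>Spc M x. \<psi> x (\<theta> x v) = v) \<and> (\<forall>w\<in>Spc N x. \<theta> x (\<psi> x w) = w)))"

definition mod_iso_rel ::
  "('o, 'a) cat \<Rightarrow> (('o, 'a, 'k::field) kmod \<times> ('o, 'a, 'k) kmod) set" where
  "mod_iso_rel C = {(M, N). is_module C M \<and> is_module C N \<and> mod_iso C M N}"

definition is_submodule ::
  "('o, 'a) cat \<Rightarrow> ('o, 'a, 'k::field) kmod \<Rightarrow> ('o \<Rightarrow> (nat \<Rightarrow> 'k) set) \<Rightarrow> bool" where
  "is_submodule C M U \<longleftrightarrow>
     (\<forall>x\<in>Obj C. seqs.subspace (U x) \<and> U x \<subseteq> Spc M x) \<and>
     (\<forall>a\<in>Arr C. \<forall>u\<in>U (Dom C a). Map M a u \<in> U (Cod C a))"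

definition indecomposable :: "('o, 'a) cat \<Rightarrow> ('o, 'a, 'k::field) kmod \<Rightarrow> bool" where
  "indecomposable C M \<longleftrightarrow>
     is_module C M \<and> (\<exists>x\<in>Obj C. Spc M x \<noteq> {0}) \<and>
     (\<forall>U W. is_submodule C M U \<and> is_submodule C M W \<and>
        (\<forall>x\<in>Obj C. Spc M x = {u + w | u w. u \<in> U x \<and> w \<in> W x} \<and> U x \<inter> W x = {0})
        \<longrightarrow> (\<forall>x\<in>Obj C. U x = {0}) \<or> (\<forall>x\<in>Obj C. W x = {0}))"

definition supp_obs :: "('o, 'a) cat \<Rightarrow> ('o, 'a, 'k::field) kmod \<Rightarrow> 'o set" where
  "supp_obs C M = {x \<in> Obj C. Spc M x \<noteq> {0}}"

definition supp :: "('o, 'a) cat \<Rightarrow> ('o, 'a, 'k::field) kmod \<Rightarrow> ('o, 'a) cat" where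
  "supp C M = full_subcat C (supp_obs C M)"

definition convex_supp :: "('o, 'a) cat \<Rightarrow> ('o, 'a, 'k::field) kmod \<Rightarrow> ('o, 'a) cat" where
  "convex_supp C M = full_subcat C (\<Inter>{X. convex_obs C X \<and> supp_obs C M \<subseteq> X})"


section \<open>Relative projectivity and vertices\<close>

text \<open>\<open>(N, \<eta>)\<close> is a left Kan extension of the \<open>D\<close>-module \<open>F\<close> along the inclusion of \<open>D\<close> into
  \<open>C\<close>, that is, \<open>N\<close> is the value at \<open>F\<close> of the left adjoint of restriction and \<open>\<eta>\<close> is the
  unit of the adjunction at \<open>F\<close>.\<close>

definition left_kan_ext ::
  "('o, 'a) cat \<Rightarrow> ('o, 'a) cat \<Rightarrow> ('o, 'a, 'k::field) kmod \<Rightarrow> ('o, 'a, 'k) kmod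
     \<Rightarrow> ('o \<Rightarrow> (nat \<Rightarrow> 'k) \<Rightarrow> (nat \<Rightarrow> 'k)) \<Rightarrow> bool" where
  "left_kan_ext C D F N \<eta> \<longleftrightarrow>
     is_module C N \<and> mod_hom D F N \<eta> \<and>
     (\<forall>X \<theta>. is_module C X \<and> mod_hom D F X \<theta> \<longrightarrow>
        (\<exists>\<xi>. mod_hom C N X \<xi> \<and> (\<forall>x\<in>Obj D. \<forall>v\<in>Spc F x. \<xi> x (\<eta> x v) = \<theta> x v) \<and>
          (\<forall>\<xi>'. mod_hom C N X \<xi>' \<and> (\<forall>x\<in>Obj D. \<forall>v\<in>Spc F x. \<xi>' x (\<eta> x v) = \<theta> x v)
             \<longrightarrow> (\<forall>x\<in>Obj C. \<forall>v\<in>Spc N x. \<xi>' x v = \<xi> x v))))"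

text \<open>The counit at \<open>M\<close> is the homomorphism \<open>\<epsilon>\<close> from the left Kan extension of \<open>M\<close>
  restricted to \<open>D\<close> to \<open>M\<close> that corresponds to the identity under the adjunction.\<close>

definition is_counit ::
  "('o, 'a) cat \<Rightarrow> ('o, 'a) cat \<Rightarrow> ('o, 'a, 'k::field) kmod \<Rightarrow> ('o, 'a, 'k) kmod
     \<Rightarrow> ('o \<Rightarrow> (nat \<Rightarrow> 'k) \<Rightarrow> (nat \<Rightarrow> 'k)) \<Rightarrow> bool" where
  "is_counit C D M N \<epsilon> \<longleftrightarrow> (\<exists>\<eta>. left_kan_ext C D M N \<eta> \<and> mod_hom C N M \<epsilon> \<and>
     (\<forall>x\<in>Obj D. \<forall>v\<in>Spc M x. \<epsilon> x (\<eta> x v) = v))"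

definition split_surj ::
  "('o, 'a) cat \<Rightarrow> ('o, 'a, 'k::field) kmod \<Rightarrow> ('o, 'a, 'k) kmod
     \<Rightarrow> ('o \<Rightarrow> (nat \<Rightarrow> 'k) \<Rightarrow> (nat \<Rightarrow> 'k)) \<Rightarrow> bool" where
  "split_surj C N M \<epsilon> \<longleftrightarrow>
     (\<exists>\<sigma>. mod_hom C M N \<sigma> \<and> (\<forall>x\<in>Obj C. \<forall>v\<in>Spc M x. \<epsilon> x (\<sigma> x v) = v))"

definition rel_projective ::
  "('o, 'a) cat \<Rightarrow> ('o, 'a, 'k::field) kmod \<Rightarrow> ('o, 'a) cat \<Rightarrow> bool" where
  "rel_projective C M D \<longleftrightarrow> subcat D (convex_supp C M) \<and>
     (\<exists>N \<epsilon>. is_counit (convex_supp C M) D M N \<epsilon> \<and> split_surj (convex_supp C M) N M \<epsilon>)"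

text \<open>\<open>D\<close> is a vertex of the module \<open>M\<close> over the transporter category of \<open>L\<close> acting on \<open>Q\<close>.\<close>

definition is_vertex ::
  "('g, 'm) monoid_scheme \<Rightarrow> ('x \<times> 'x) set \<Rightarrow> ('g \<Rightarrow> 'x \<Rightarrow> 'x) \<Rightarrow> 'x set \<Rightarrow> 'g set
     \<Rightarrow> ('x, 'x \<times> 'g \<times> 'x, 'k::field) kmod \<Rightarrow> ('x, 'x \<times> 'g \<times> 'x) cat \<Rightarrow> bool" where
  "is_vertex G r \<phi> Q L M D \<longleftrightarrow>
     weakly_convex_tsub G r \<phi> Q L D \<and> rel_projective (transporter G r \<phi> Q L) M D \<and>
     (\<forall>D'. weakly_convex_tsub G r \<phi> Q L D' \<and> rel_projective (transporter G r \<phi> Q L) M D'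
        \<and> subcat D' D \<longrightarrow> D' = D)"

text \<open>The indecomposable modules over the transporter category of \<open>L\<close> acting on \<open>Q\<close> that have
  \<open>D\<close> as a vertex and \<open>S\<close> as support.\<close>

definition indec_mods ::
  "('g, 'm) monoid_scheme \<Rightarrow> ('x \<times> 'x) set \<Rightarrow> ('g \<Rightarrow> 'x \<Rightarrow> 'x) \<Rightarrow> 'x set \<Rightarrow> 'g set
     \<Rightarrow> ('x, 'x \<times> 'g \<times> 'x) cat \<Rightarrow> ('x, 'x \<times> 'g \<times> 'x) cat
     \<Rightarrow> ('x, 'x \<times> 'g \<times> 'x, 'k::field) kmod set" where
  "indec_mods G r \<phi> Q L D S =
     {M. indecomposable (transporter G r \<phi> Q L) M \<and> is_vertex G r \<phi> Q L M D \<and>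
         supp (transporter G r \<phi> Q L) M = S}"

definition indec_classes ::
  "('g, 'm) monoid_scheme \<Rightarrow> ('x \<times> 'x) set \<Rightarrow> ('g \<Rightarrow> 'x \<Rightarrow> 'x) \<Rightarrow> 'x set \<Rightarrow> 'g set
     \<Rightarrow> ('x, 'x \<times> 'g \<times> 'x) cat \<Rightarrow> ('x, 'x \<times> 'g \<times> 'x) cat
     \<Rightarrow> ('x, 'x \<times> 'g \<times> 'x, 'k::field) kmod set set" where
  "indec_classes G r \<phi> Q L D S =
     indec_mods G r \<phi> Q L D S // mod_iso_rel (transporter G r \<phi> Q L)"

end

theory Submission
  imports Defs "HOL-Algebra.Multiplicative_Group" "HOL-Library.Nat_Bijection"
begin

text \<open>
A module over a transporter category whose support is a single orbit is determined by its value
at \<open>x\<close> with the action of the stabilizer \<open>L\<close> of \<open>x\<close>: the orbit is an antichain, because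
\<open>w \<le> h w\<close> forces \<open>w \<le> h w \<le> h\<^sup>2 w \<le> \<dots> \<le> w\<close> in a finite group, so every morphism between points
of the orbit is invertible. The orbit is also convex, hence it is the whole convex support. What
remains is the Green correspondence between \<open>L\<close> and \<open>K\<close>, together with the translation of
relative projectivity, which is phrased by Kan extensions, into the language of groups.

The translation is Higman's criterion (\<open>higman\<close>): \<open>M\<close> is projective relative to \<open>{x} \<times> Q\<close> iff the
identity of \<open>M(x)\<close> is a relative trace from \<open>Q\<close> to the stabilizer. Its proof constructs the left
Kan extension explicitly as a space of equivariant functions (\<open>induced_left_kan_ext\<close>). The criterion
also shows that minimality among weakly convex transporter subcategories is minimality among
subgroups (\<open>is_vertex_iff\<close>).

The Green correspondence is obtained by comparing endomorphisms. Representations are functions \<open>\<rho>\<close>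
from the group to a ring, with \<open>\<rho> \<one>\<close> an idempotent playing the role of the identity, so that all
homomorphism spaces lie in one ring.
The relation is \<open>R M N\<close>: the representation \<open>N\<close> of \<open>K\<close> is a direct summand of \<open>M(x)\<close> restricted
to \<open>K\<close>. The single input is Mackey's formula, by which a trace from \<open>H\<close> to \<open>L\<close> differs from the trace
from \<open>H\<close> to \<open>K\<close> by an element of the ideal \<open>J\<close> generated by traces from the groups \<open>K \<inter> gHg\<inverse>\<close> with
\<open>g \<in> L - K\<close>. As \<open>K\<close> contains the normalizer of \<open>H\<close>, a representation with vertex \<open>H\<close> and local endomorphism
ring never has its identity in \<open>J\<close> (\<open>has_vertex_not_in_outer_meets\<close>).
If \<open>N\<close> has vertex \<open>H\<close> and \<open>i\<close>, \<open>p\<close> exhibit \<open>N\<close> as a summand of \<open>M\<close>, write the identity of \<open>N\<close> as the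
trace of some \<open>a\<close>; then the trace of \<open>i a p\<close> to \<open>L\<close> is \<open>i p + y\<close> with \<open>y \<in> J\<close>. It is not nilpotent,
hence invertible since the endomorphism ring of \<open>M\<close> is local. This one observation gives both
uniqueness statements: \<open>M\<close> determines \<open>N\<close> (\<open>restriction_summand_unique\<close>) and \<open>N\<close> determines \<open>M\<close>
(\<open>induction_summand_unique\<close>).

Existence in both directions is by minimality of dimension (\<open>exists_indecomposable\<close>). Starting from
\<open>M\<close>, take the smallest summand \<open>N\<close> of the restriction through which a unit of the endomorphism ring
of \<open>M\<close> can still be obtained as a trace; starting from \<open>N\<close>, take the smallest \<open>H\<close>-projective
module having \<open>N\<close> as a summand at \<open>x\<close>, where the induced module shows that there is one.
\<close>

section \<open>Sums over left cosets\<close>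

locale finite_group = group +
  assumes finite_carrier [simp]: "finite (carrier G)"
begin

abbreviation lcos :: "'a \<Rightarrow> 'a set \<Rightarrow> 'a set" (infixl "\<odot>" 60) where
  "g \<odot> Q \<equiv> l_coset G g Q"

text \<open>
Representatives are selected by the choice operator. The summands of interest are invariant under
\<open>Q\<close> on the right, and \<open>T\<close> is a union of cosets, so that the choice is immaterial.
\<close>

definition coset_sum :: "'a set \<Rightarrow> 'a set \<Rightarrow> ('a \<Rightarrow> 'c::comm_monoid_add) \<Rightarrow> 'c" where
  "coset_sum T Q F = (\<Sum>C\<in>(\<lambda>g. g \<odot> Q) ` T. F (SOME g. g \<in> C))"

definition coset_closed :: "'a set \<Rightarrow> 'a set \<Rightarrow> bool" where
  "coset_closed T Q \<longleftrightarrow> subgroup Q G \<and> T \<subseteq> carrier G \<and> (\<forall>g\<in>T. \<forall>q\<in>Q. g \<otimes> q \<in> T)"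

definition conj_subgroup :: "'a \<Rightarrow> 'a set \<Rightarrow> 'a set" where
  "conj_subgroup a Q = (\<lambda>q. a \<otimes> q \<otimes> inv a) ` Q"

lemma inv_mult_cancel [simp]:
  assumes "g \<in> carrier G" "h \<in> carrier G"
  shows "inv g \<otimes> (g \<otimes> h) = h" "g \<otimes> (inv g \<otimes> h) = h"
    "h \<otimes> g \<otimes> inv g = h" "h \<otimes> inv g \<otimes> g = h"
proof -
  show "inv g \<otimes> (g \<otimes> h) = h" "g \<otimes> (inv g \<otimes> h) = h"
    using assms by (metis inv_closed l_inv l_one m_assoc, metis inv_closed r_inv l_one m_assoc)
  show "h \<otimes> g \<otimes> inv g = h" "h \<otimes> inv g \<otimes> g = h"
    using assms by (simp_all add: m_assoc)
qed

lemma coset_closed_subgroup: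
  "subgroup A G \<Longrightarrow> subgroup Q G \<Longrightarrow> Q \<subseteq> A \<Longrightarrow> coset_closed A Q"
  unfolding coset_closed_def by (auto dest: subgroup.subset subgroup.m_closed)

lemma coset_closed_mono:
  "coset_closed T K \<Longrightarrow> subgroup Q G \<Longrightarrow> Q \<subseteq> K \<Longrightarrow> coset_closed T Q"
  unfolding coset_closed_def by blast

lemma coset_closed_finite: "coset_closed T Q \<Longrightarrow> finite T"
  unfolding coset_closed_def by (meson finite_carrier finite_subset)

lemma coset_eq_iff:
  assumes "subgroup Q G" "g \<in> carrier G" "h \<in> carrier G"
  shows "g \<odot> Q = h \<odot> Q \<longleftrightarrow> inv g \<otimes> h \<in> Q"
proof
  assume "g \<odot> Q = h \<odot> Q"
  moreover have "h \<in> h \<odot> Q"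
    using assms subgroup.one_closed[OF assms(1)] by (force simp: l_coset_def)
  ultimately obtain q where "q \<in> Q" "h = g \<otimes> q" by (auto simp: l_coset_def)
  then show "inv g \<otimes> h \<in> Q" using assms subgroup.mem_carrier by fastforce
next
  assume a: "inv g \<otimes> h \<in> Q"
  then have "inv (inv g \<otimes> h) \<in> Q" by (rule subgroup.m_inv_closed[OF assms(1)])
  then have b: "inv h \<otimes> g \<in> Q" using assms by (simp add: inv_mult_group)
  have "g \<otimes> q \<in> h \<odot> Q" if "q \<in> Q" for q
  proof -
    have "g \<otimes> q = h \<otimes> ((inv h \<otimes> g) \<otimes> q)"
      using that assms subgroup.mem_carrier[OF assms(1)] by (simp add: m_assoc)
    moreover have "(inv h \<otimes> g) \<otimes> q \<in> Q" using that b subgroup.m_closed[OF assms(1)] by blast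
    ultimately show ?thesis by (auto simp: l_coset_def)
  qed
  moreover have "h \<otimes> q \<in> g \<odot> Q" if "q \<in> Q" for q
  proof -
    have "h \<otimes> q = g \<otimes> ((inv g \<otimes> h) \<otimes> q)"
      using that assms subgroup.mem_carrier[OF assms(1)] by (simp add: m_assoc)
    moreover have "(inv g \<otimes> h) \<otimes> q \<in> Q" using that a subgroup.m_closed[OF assms(1)] by blast
    ultimately show ?thesis by (auto simp: l_coset_def)
  qed
  ultimately show "g \<odot> Q = h \<odot> Q" by (force simp: l_coset_def)
qed

lemma some_in_coset:
  assumes "subgroup Q G" "g \<in> carrier G"
  obtains q where "q \<in> Q" "(SOME h. h \<in> g \<odot> Q) = g \<otimes> q"
proof -
  have "g \<in> g \<odot> Q"
    using assms subgroup.one_closed[OF assms(1)] by (force simp: l_coset_def)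
  then have "(SOME h. h \<in> g \<odot> Q) \<in> g \<odot> Q" by (rule someI)
  then show ?thesis using that by (auto simp: l_coset_def)
qed

lemma inv_mult_in_iff:
  assumes "subgroup Q G" "g \<in> carrier G" "h \<in> carrier G" "q \<in> Q" "q' \<in> Q"
  shows "inv (g \<otimes> q) \<otimes> (h \<otimes> q') \<in> Q \<longleftrightarrow> inv g \<otimes> h \<in> Q"
proof -
  have [simp]: "q \<in> carrier G" "q' \<in> carrier G" using assms subgroup.mem_carrier[OF assms(1)] by auto
  have "(g \<otimes> q) \<odot> Q = g \<odot> Q" "(h \<otimes> q') \<odot> Q = h \<odot> Q"
    using assms by (simp_all add: coset_eq_iff inv_mult_group m_assoc
        subgroup.m_inv_closed subgroup.mem_carrier)
  then show ?thesis using assms by (metis coset_eq_iff m_closed subgroup.mem_carrier)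
qed

text \<open>
The basic device for all reindexing below: a transitive parametrization of \<open>S\<close> by \<open>T\<close> whose fibres
are the cosets of \<open>Q\<close> turns a sum over \<open>S\<close> into a coset sum. With \<open>S\<close> an orbit and \<open>Q\<close> a stabilizer it is
the orbit-stabilizer theorem.
\<close>

lemma coset_sum_fibres:
  assumes T: "coset_closed T Q" and S: "m ` T = S"
    and eq: "\<And>g h. g \<in> T \<Longrightarrow> h \<in> T \<Longrightarrow> m g = m h \<longleftrightarrow> inv g \<otimes> h \<in> Q"
  shows "coset_sum T Q (\<lambda>g. F (m g)) = sum F S"
proof -
  have Q: "subgroup Q G" and TG: "\<And>g. g \<in> T \<Longrightarrow> g \<in> carrier G"
    using T by (auto simp: coset_closed_def)
  have some: "(SOME h. h \<in> g \<odot> Q) \<in> T \<and> m (SOME h. h \<in> g \<odot> Q) = m g" if gT: "g \<in> T" for g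
  proof -
    obtain q where q: "q \<in> Q" "(SOME h. h \<in> g \<odot> Q) = g \<otimes> q"
      by (rule some_in_coset[OF Q TG[OF gT]])
    have "g \<otimes> q \<in> T" using T that q by (auto simp: coset_closed_def)
    moreover have "inv (g \<otimes> q) \<otimes> g \<in> Q"
      using inv_mult_in_iff[OF Q TG[OF that] TG[OF that] q(1) subgroup.one_closed[OF Q]] TG[OF that]
        subgroup.one_closed[OF Q] by simp
    ultimately show ?thesis using q eq that by metis
  qed
  have "bij_betw (\<lambda>C. m (SOME h. h \<in> C)) ((\<lambda>g. g \<odot> Q) ` T) S"
  proof (rule bij_betw_imageI)
    show "inj_on (\<lambda>C. m (SOME h. h \<in> C)) ((\<lambda>g. g \<odot> Q) ` T)"
    proof (rule inj_onI)
      fix C D assume CD: "C \<in> (\<lambda>g. g \<odot> Q) ` T" "D \<in> (\<lambda>g. g \<odot> Q) ` T"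
        "m (SOME h. h \<in> C) = m (SOME h. h \<in> D)"
      then obtain g h where gh: "g \<in> T" "h \<in> T" "C = g \<odot> Q" "D = h \<odot> Q" by blast
      then have "m g = m h" using CD some by metis
      then show "C = D" using gh eq coset_eq_iff[OF Q TG TG] by simp
    qed
    show "(\<lambda>C. m (SOME h. h \<in> C)) ` (\<lambda>g. g \<odot> Q) ` T = S"
      using some S by (force simp: image_image)
  qed
  then show ?thesis
    unfolding coset_sum_def by (rule sum.reindex_bij_betw)
qed

lemma value_at_coset_representative:
  assumes T: "coset_closed T Q" and F: "\<And>g q. g \<in> T \<Longrightarrow> q \<in> Q \<Longrightarrow> F (g \<otimes> q) = F g"
    and g: "g \<in> T"
  shows "F (SOME h. h \<in> g \<odot> Q) = F g"
proof -
  have "subgroup Q G" "g \<in> carrier G" using T g by (auto simp: coset_closed_def)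
  then obtain q where "q \<in> Q" "(SOME h. h \<in> g \<odot> Q) = g \<otimes> q" by (rule some_in_coset)
  then show ?thesis using F g by simp
qed

lemma some_coset_mem:
  assumes T: "coset_closed T Q" and g: "g \<in> T"
  shows "(SOME h. h \<in> g \<odot> Q) \<in> T"
proof -
  have "subgroup Q G" "g \<in> carrier G" using T g by (auto simp: coset_closed_def)
  then obtain q where "q \<in> Q" "(SOME h. h \<in> g \<odot> Q) = g \<otimes> q" by (rule some_in_coset)
  then show ?thesis using T g by (simp add: coset_closed_def)
qed

lemma coset_sum_cong:
  assumes T: "coset_closed T Q" and "\<And>g. g \<in> T \<Longrightarrow> F g = F' g"
  shows "coset_sum T Q F = coset_sum T Q F'"
proof -
  have "(SOME h. h \<in> g \<odot> Q) \<in> T" if "g \<in> T" for g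
    using T that by (rule some_coset_mem)
  then show ?thesis unfolding coset_sum_def using assms(2) by (intro sum.cong) auto
qed

lemma coset_sum_additive:
  assumes "h 0 = 0" "\<And>u v. h (u + v) = h u + h v"
  shows "h (coset_sum T Q F) = coset_sum T Q (\<lambda>g. h (F g))"
proof -
  have "h (sum f I) = (\<Sum>i\<in>I. h (f i))" for f and I :: "'a set set"
    using assms by (induction I rule: infinite_finite_induct) auto
  then show ?thesis unfolding coset_sum_def by blast
qed

lemma coset_sum_mem:
  assumes T: "coset_closed T Q" and "0 \<in> V" "\<And>u v. u \<in> V \<Longrightarrow> v \<in> V \<Longrightarrow> u + v \<in> V"
    and "\<And>g. g \<in> T \<Longrightarrow> F g \<in> V"
  shows "coset_sum T Q F \<in> V"
proof -
  have "(SOME h. h \<in> g \<odot> Q) \<in> T" if "g \<in> T" for g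
    using T that by (rule some_coset_mem)
  then have "\<forall>C\<in>(\<lambda>g. g \<odot> Q) ` T. F (SOME g. g \<in> C) \<in> V" using assms by auto
  moreover have "sum f I \<in> V" if "finite I" "\<forall>i\<in>I. f i \<in> V" for f and I :: "'a set set"
    using that assms(2,3) by (induction I rule: finite_induct) auto
  ultimately show ?thesis unfolding coset_sum_def
    using coset_closed_finite[OF T] by (metis (lifting) finite_imageI)
qed

text \<open>
Maps that are additive only on a subspace occur for modules, whose structure maps are unspecified
outside the value spaces.
\<close>

lemma coset_sum_additive_on:
  assumes T: "coset_closed T Q" and V: "0 \<in> V" "\<And>u v. u \<in> V \<Longrightarrow> v \<in> V \<Longrightarrow> u + v \<in> V"
    and "\<And>g. g \<in> T \<Longrightarrow> F g \<in> V"
    and h: "h 0 = 0" "\<And>u v. u \<in> V \<Longrightarrow> v \<in> V \<Longrightarrow> h (u + v) = h u + h v"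
  shows "h (coset_sum T Q F) = coset_sum T Q (\<lambda>g. h (F g))"
proof -
  have "(SOME h. h \<in> g \<odot> Q) \<in> T" if "g \<in> T" for g
    using T that by (rule some_coset_mem)
  then have *: "\<forall>C\<in>(\<lambda>g. g \<odot> Q) ` T. F (SOME g. g \<in> C) \<in> V" using assms by auto
  have "sum f I \<in> V \<and> h (sum f I) = (\<Sum>i\<in>I. h (f i))" if "finite I" "\<forall>i\<in>I. f i \<in> V" for f and I :: "'a set set"
    using that V h by (induction I rule: finite_induct) auto
  from this[OF finite_imageI[OF coset_closed_finite[OF T]] *] show ?thesis unfolding coset_sum_def ..
qed

lemma coset_sum_add: "coset_sum T Q (\<lambda>g. F g + F' g) = coset_sum T Q F + coset_sum T Q F'"
  unfolding coset_sum_def by (rule sum.distrib)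

lemma coset_sum_zero: "coset_sum T Q (\<lambda>g. 0) = 0"
  unfolding coset_sum_def by simp

lemma coset_sum_single:
  assumes T: "coset_closed T Q" and g: "g \<in> T" and F: "\<And>q. q \<in> Q \<Longrightarrow> F (g \<otimes> q) = F g"
    and z: "\<And>h. h \<in> T \<Longrightarrow> inv g \<otimes> h \<notin> Q \<Longrightarrow> F h = 0"
  shows "coset_sum T Q F = F g"
proof -
  have Q: "subgroup Q G" and TG: "\<And>g. g \<in> T \<Longrightarrow> g \<in> carrier G"
    using T by (auto simp: coset_closed_def)
  have "F (SOME h. h \<in> C) = (if C = g \<odot> Q then F g else 0)" if "C \<in> (\<lambda>g. g \<odot> Q) ` T" for C
  proof -
    obtain k where k: "k \<in> T" "C = k \<odot> Q" using \<open>C \<in> _\<close> by blast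
    obtain q where q: "q \<in> Q" "(SOME h. h \<in> C) = k \<otimes> q"
      unfolding k(2) by (rule some_in_coset[OF Q TG[OF k(1)]])
    show ?thesis
    proof (cases "C = g \<odot> Q")
      case True
      then show ?thesis using F some_in_coset[OF Q TG[OF g]] by metis
    next
      case False
      then have "inv g \<otimes> k \<notin> Q" using k g TG Q coset_eq_iff by metis
      then have "inv g \<otimes> (k \<otimes> q) \<notin> Q"
        using inv_mult_in_iff[OF Q TG[OF g] TG[OF k(1)] subgroup.one_closed[OF Q] q(1)] TG g k by simp
      moreover have "k \<otimes> q \<in> T" using T k q by (auto simp: coset_closed_def)
      ultimately show ?thesis using False q z by simp
    qed
  qed
  then have "coset_sum T Q F = (\<Sum>C\<in>(\<lambda>g. g \<odot> Q) ` T. if C = g \<odot> Q then F g else 0)"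
    unfolding coset_sum_def by (intro sum.cong) auto
  also have "\<dots> = F g"
    using g coset_closed_finite[OF T] by (subst sum.delta) auto
  finally show ?thesis .
qed

lemma coset_sum_translate:
  assumes T: "coset_closed T Q" and a: "a \<in> carrier G"
    and F: "\<And>g q. g \<in> T \<Longrightarrow> q \<in> Q \<Longrightarrow> F (a \<otimes> (g \<otimes> q)) = F (a \<otimes> g)"
  shows "coset_sum ((\<lambda>g. a \<otimes> g) ` T) Q F = coset_sum T Q (\<lambda>g. F (a \<otimes> g))"
proof -
  have Q: "subgroup Q G" and TG: "\<And>g. g \<in> T \<Longrightarrow> g \<in> carrier G"
    and QG: "\<And>g. g \<in> Q \<Longrightarrow> g \<in> carrier G"
    using T by (auto simp: coset_closed_def subgroup.mem_carrier)
  have aT: "coset_closed ((\<lambda>g. a \<otimes> g) ` T) Q"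
    unfolding coset_closed_def
  proof (intro conjI ballI)
    fix g q assume "g \<in> (\<lambda>g. a \<otimes> g) ` T" "q \<in> Q"
    then obtain h where "h \<in> T" "g = a \<otimes> h" by blast
    then have "g \<otimes> q = a \<otimes> (h \<otimes> q)" "h \<otimes> q \<in> T"
      using T a TG QG \<open>q \<in> Q\<close> by (auto simp: m_assoc coset_closed_def)
    then show "g \<otimes> q \<in> (\<lambda>g. a \<otimes> g) ` T" by blast
  qed (use Q TG a in auto)
  have "coset_sum T Q (\<lambda>g. F (a \<otimes> g)) = coset_sum T Q (\<lambda>g. F (SOME h. h \<in> (a \<otimes> g) \<odot> Q))"
  proof (rule coset_sum_cong[OF T])
    fix g assume g: "g \<in> T"
    show "F (a \<otimes> g) = F (SOME h. h \<in> (a \<otimes> g) \<odot> Q)"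
      by (rule value_at_coset_representative[OF aT, symmetric])
        (use F g a TG QG in \<open>auto simp: m_assoc\<close>)
  qed
  also have "\<dots> = (\<Sum>C\<in>(\<lambda>g. (a \<otimes> g) \<odot> Q) ` T. F (SOME h. h \<in> C))"
    by (rule coset_sum_fibres[OF T refl]) (use a TG Q in \<open>simp add: coset_eq_iff inv_mult_group m_assoc\<close>)
  finally show ?thesis unfolding coset_sum_def by (simp add: image_image)
qed

text \<open>
The cosets of \<open>Q\<close> are grouped by the coset of \<open>K\<close> that contains them.
\<close>

lemma coset_sum_trans:
  assumes T: "coset_closed T K" and Q: "subgroup Q G" and QK: "Q \<subseteq> K"
    and F: "\<And>g q. g \<in> T \<Longrightarrow> q \<in> Q \<Longrightarrow> F (g \<otimes> q) = F g"
  shows "coset_sum T K (\<lambda>g. coset_sum K Q (\<lambda>k. F (g \<otimes> k))) = coset_sum T Q F"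
proof -
  have K: "subgroup K G" and TG: "\<And>g. g \<in> T \<Longrightarrow> g \<in> carrier G" and KG: "\<And>g. g \<in> K \<Longrightarrow> g \<in> carrier G"
    and TK: "\<And>g k. g \<in> T \<Longrightarrow> k \<in> K \<Longrightarrow> g \<otimes> k \<in> T"
    using T by (auto simp: coset_closed_def subgroup.mem_carrier)
  have KQ: "coset_closed K Q" using K Q QK by (rule coset_closed_subgroup)
  have TQ: "coset_closed T Q" using T Q QK by (rule coset_closed_mono)
  define f where "f C = F (SOME h. h \<in> C)" for C
  define p where "p C = (SOME h. h \<in> C) \<odot> K" for C
  have p: "p (g \<odot> Q) = g \<odot> K" if gT: "g \<in> T" for g
  proof -
    obtain q where "q \<in> Q" "(SOME h. h \<in> g \<odot> Q) = g \<otimes> q"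
      by (rule some_in_coset[OF Q TG[OF gT]])
    then show ?thesis unfolding p_def using gT TG KG QK K
      by (simp add: coset_eq_iff inv_mult_group m_assoc subgroup.m_inv_closed subset_iff)
  qed
  have "coset_sum T Q F = (\<Sum>C\<in>(\<lambda>g. g \<odot> Q) ` T. f C)" unfolding coset_sum_def f_def ..
  also have "\<dots> = (\<Sum>D\<in>(\<lambda>g. g \<odot> K) ` T. sum f {C \<in> (\<lambda>g. g \<odot> Q) ` T. p C = D})"
    by (rule sum.group[symmetric]) (use p coset_closed_finite[OF T] in auto)
  also have "\<dots> = (\<Sum>D\<in>(\<lambda>g. g \<odot> K) ` T. coset_sum K Q (\<lambda>k. F ((SOME h. h \<in> D) \<otimes> k)))"
  proof (rule sum.cong[OF refl])
    fix D assume "D \<in> (\<lambda>g. g \<odot> K) ` T"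
    then obtain t where t: "t \<in> T" "D = t \<odot> K" by blast
    define d where "d = (SOME h. h \<in> D)"
    obtain k0 where k0: "k0 \<in> K" "d = t \<otimes> k0"
      unfolding d_def t(2) by (rule some_in_coset[OF K TG[OF t(1)]])
    have d: "d \<in> T" using k0 TK t by simp
    have D: "D = d \<odot> K" unfolding t k0 using t TG KG K k0
      by (simp add: coset_eq_iff inv_mult_group m_assoc subset_iff)
    have "coset_sum K Q (\<lambda>k. F (d \<otimes> k)) = coset_sum K Q (\<lambda>k. f ((d \<otimes> k) \<odot> Q))"
      by (rule coset_sum_cong[OF KQ]) (use value_at_coset_representative[OF TQ F] TK d in \<open>auto simp: f_def\<close>)
    also have "\<dots> = sum f {C \<in> (\<lambda>g. g \<odot> Q) ` T. p C = D}"
    proof (rule coset_sum_fibres[OF KQ])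
      show "(\<lambda>k. (d \<otimes> k) \<odot> Q) ` K = {C \<in> (\<lambda>g. g \<odot> Q) ` T. p C = D}"
      proof (intro equalityI subsetI)
        fix C assume "C \<in> (\<lambda>k. (d \<otimes> k) \<odot> Q) ` K"
        then obtain k where k: "k \<in> K" "C = (d \<otimes> k) \<odot> Q" by blast
        then have "p C = (d \<otimes> k) \<odot> K" using p d TK by simp
        also have "\<dots> = D" unfolding D using k d TG KG K
          by (simp add: coset_eq_iff inv_mult_group m_assoc subgroup.m_inv_closed)
        finally show "C \<in> {C \<in> (\<lambda>g. g \<odot> Q) ` T. p C = D}" using k d TK by auto
      next
        fix C assume "C \<in> {C \<in> (\<lambda>g. g \<odot> Q) ` T. p C = D}"
        then obtain g where g: "g \<in> T" "C = g \<odot> Q" "p C = D" by blast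
        then have "g \<odot> K = d \<odot> K" using p D by simp
        then have "inv d \<otimes> g \<in> K" using coset_eq_iff K TG d g by metis
        moreover have "C = (d \<otimes> (inv d \<otimes> g)) \<odot> Q" using g d TG by simp
        ultimately show "C \<in> (\<lambda>k. (d \<otimes> k) \<odot> Q) ` K" by blast
      qed
    qed (use d TG KG Q in \<open>simp add: coset_eq_iff inv_mult_group m_assoc\<close>)
    finally show "sum f {C \<in> (\<lambda>g. g \<odot> Q) ` T. p C = D}
      = coset_sum K Q (\<lambda>k. F ((SOME h. h \<in> D) \<otimes> k))" unfolding d_def by simp
  qed
  finally show ?thesis unfolding coset_sum_def[of T K] by simp
qed

lemma subgroup_conj_subgroup:
  assumes "subgroup Q G" "a \<in> carrier G" shows "subgroup (conj_subgroup a Q) G"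
proof (rule subgroupI)
  have QG: "\<And>g. g \<in> Q \<Longrightarrow> g \<in> carrier G" using subgroup.mem_carrier[OF assms(1)] .
  show "conj_subgroup a Q \<subseteq> carrier G" unfolding conj_subgroup_def using QG assms by auto
  show "conj_subgroup a Q \<noteq> {}" unfolding conj_subgroup_def using subgroup.one_closed[OF assms(1)] by auto
  show "inv g \<in> conj_subgroup a Q" if "g \<in> conj_subgroup a Q" for g
  proof -
    obtain q where q: "q \<in> Q" "g = a \<otimes> q \<otimes> inv a" using \<open>g \<in> _\<close> by (auto simp: conj_subgroup_def)
    then have "inv g = a \<otimes> inv q \<otimes> inv a" using QG assms by (simp add: inv_mult_group m_assoc)
    then show ?thesis unfolding conj_subgroup_def using q subgroup.m_inv_closed[OF assms(1)] by blast
  qed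
  show "g \<otimes> h \<in> conj_subgroup a Q" if "g \<in> conj_subgroup a Q" "h \<in> conj_subgroup a Q" for g h
  proof -
    obtain q q' where q: "q \<in> Q" "g = a \<otimes> q \<otimes> inv a" "q' \<in> Q" "h = a \<otimes> q' \<otimes> inv a"
      using \<open>g \<in> _\<close> \<open>h \<in> _\<close> by (auto simp: conj_subgroup_def)
    then have "g \<otimes> h = a \<otimes> (q \<otimes> q') \<otimes> inv a" using QG assms by (simp add: m_assoc)
    then show ?thesis unfolding conj_subgroup_def using q subgroup.m_closed[OF assms(1)] by blast
  qed
qed

lemma mem_conj_subgroup_iff:
  assumes "subgroup Q G" "a \<in> carrier G" "g \<in> carrier G"
  shows "g \<in> conj_subgroup a Q \<longleftrightarrow> inv a \<otimes> g \<otimes> a \<in> Q"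
proof
  assume "g \<in> conj_subgroup a Q"
  then show "inv a \<otimes> g \<otimes> a \<in> Q" unfolding conj_subgroup_def
    using assms subgroup.mem_carrier[OF assms(1)] by (auto simp: m_assoc)
next
  assume "inv a \<otimes> g \<otimes> a \<in> Q"
  moreover have "g = a \<otimes> (inv a \<otimes> g \<otimes> a) \<otimes> inv a" using assms by (simp add: m_assoc)
  ultimately show "g \<in> conj_subgroup a Q" unfolding conj_subgroup_def by blast
qed

lemma card_conj_subgroup:
  assumes "Q \<subseteq> carrier G" "a \<in> carrier G" shows "card (conj_subgroup a Q) = card Q"
  unfolding conj_subgroup_def
  by (rule card_image, rule inj_onI) (use assms in \<open>auto simp: subset_iff\<close>)

lemma conj_subgroup_conj_subgroup:
  assumes "Q \<subseteq> carrier G" "a \<in> carrier G" "b \<in> carrier G"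
  shows "conj_subgroup a (conj_subgroup b Q) = conj_subgroup (a \<otimes> b) Q"
  unfolding conj_subgroup_def image_image
  by (rule image_cong) (use assms in \<open>auto simp: m_assoc inv_mult_group subset_iff\<close>)

lemma conj_subgroup_one: "Q \<subseteq> carrier G \<Longrightarrow> conj_subgroup \<one> Q = Q"
  unfolding conj_subgroup_def by (force simp: subset_iff)

text \<open>
Right multiplication by \<open>a\<inverse>\<close> carries the cosets of \<open>Q\<close> to those of \<open>aQa\<inverse>\<close>.
\<close>

lemma coset_sum_conj:
  assumes A: "subgroup A G" and Q: "subgroup Q G" and QA: "Q \<subseteq> A" and a: "a \<in> A"
    and F: "\<And>g q. g \<in> A \<Longrightarrow> q \<in> Q \<Longrightarrow> F (g \<otimes> q) = F g"
  shows "coset_sum A (conj_subgroup a Q) (\<lambda>g. F (g \<otimes> a)) = coset_sum A Q F"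
proof -
  have AG: "\<And>g. g \<in> A \<Longrightarrow> g \<in> carrier G" and QG: "\<And>g. g \<in> Q \<Longrightarrow> g \<in> carrier G"
    using subgroup.mem_carrier[OF A] subgroup.mem_carrier[OF Q] by blast+
  have sub: "subgroup (conj_subgroup a Q) G" using subgroup_conj_subgroup Q a AG by simp
  have "conj_subgroup a Q \<subseteq> A" unfolding conj_subgroup_def
    using a QA A by (auto intro!: subgroup.m_closed subgroup.m_inv_closed)
  then have AaQ: "coset_closed A (conj_subgroup a Q)" using A sub coset_closed_subgroup by blast
  have AQ: "coset_closed A Q" using A Q QA coset_closed_subgroup by blast
  have Aa: "g \<otimes> a \<in> A" if "g \<in> A" for g using that a A subgroup.m_closed by metis
  have surj: "(\<lambda>g. (g \<otimes> a) \<odot> Q) ` A = (\<lambda>g. g \<odot> Q) ` A"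
  proof (intro equalityI subsetI)
    fix C assume "C \<in> (\<lambda>g. g \<odot> Q) ` A"
    then obtain g where g: "g \<in> A" "C = g \<odot> Q" by blast
    then have "g \<otimes> inv a \<in> A" "g = (g \<otimes> inv a) \<otimes> a"
      using a AG subgroup.m_closed[OF A] subgroup.m_inv_closed[OF A] by auto
    then show "C \<in> (\<lambda>g. (g \<otimes> a) \<odot> Q) ` A" using g(2) by (auto intro: image_eqI[of _ _ "g \<otimes> inv a"])
  qed (use Aa in auto)
  have "coset_sum A (conj_subgroup a Q) (\<lambda>g. F (g \<otimes> a))
    = coset_sum A (conj_subgroup a Q) (\<lambda>g. F (SOME h. h \<in> (g \<otimes> a) \<odot> Q))"
    by (rule coset_sum_cong[OF AaQ]) (use value_at_coset_representative[OF AQ F] Aa in auto)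
  also have "\<dots> = (\<Sum>C\<in>(\<lambda>g. g \<odot> Q) ` A. F (SOME h. h \<in> C))"
    by (rule coset_sum_fibres[OF AaQ surj])
      (use AG a Q in \<open>simp add: coset_eq_iff mem_conj_subgroup_iff inv_mult_group m_assoc\<close>)
  finally show ?thesis unfolding coset_sum_def[of A Q] .
qed

lemma coset_sum_Un:
  assumes T: "coset_closed T Q" "coset_closed U Q" and disj: "T \<inter> U = {}"
  shows "coset_sum (T \<union> U) Q F = coset_sum T Q F + coset_sum U Q F"
proof -
  have Q: "subgroup Q G" using T by (simp add: coset_closed_def)
  have "(\<lambda>g. g \<odot> Q) ` T \<inter> (\<lambda>g. g \<odot> Q) ` U = {}"
  proof (rule ccontr)
    assume "\<not> ?thesis"
    then obtain g h where gh: "g \<in> T" "h \<in> U" "g \<odot> Q = h \<odot> Q" by blast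
    then have *: "g \<in> carrier G" "h \<in> carrier G" using T by (auto simp: coset_closed_def)
    then have "inv g \<otimes> h \<in> Q" using gh coset_eq_iff Q by metis
    then have "g \<otimes> (inv g \<otimes> h) \<in> T" using T gh by (auto simp: coset_closed_def)
    then show False using * gh disj by auto
  qed
  then show ?thesis unfolding coset_sum_def image_Un
    using coset_closed_finite[OF T(1)] coset_closed_finite[OF T(2)]
    by (simp add: sum.union_disjoint)
qed

section \<open>Relative traces and the Mackey formula\<close>

text \<open>
The element \<open>\<rho> \<one>\<close> is an idempotent, the identity of the represented object instead of the ambient
ring. Thus all objects of interest live in the same ring.
\<close>

definition rep :: "'a set \<Rightarrow> ('a \<Rightarrow> 'c::ring_1) \<Rightarrow> bool" where
  "rep A \<rho> \<longleftrightarrow> subgroup A G \<and> (\<forall>g\<in>A. \<forall>h\<in>A. \<rho> (g \<otimes> h) = \<rho> g * \<rho> h)"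

definition Hom :: "'a set \<Rightarrow> ('a \<Rightarrow> 'c::ring_1) \<Rightarrow> ('a \<Rightarrow> 'c) \<Rightarrow> 'c set" where
  "Hom A \<rho> \<sigma> = {f. \<sigma> \<one> * f = f \<and> f * \<rho> \<one> = f \<and> (\<forall>g\<in>A. \<sigma> g * f = f * \<rho> g)}"

text \<open>
For \<open>Q\<close>-equivariant \<open>f\<close> this is the relative trace \<open>\<Sum> g f g\<inverse>\<close> over representatives \<open>g\<close> of \<open>A/Q\<close>.
\<close>

definition rel_trace ::
  "'a set \<Rightarrow> 'a set \<Rightarrow> ('a \<Rightarrow> 'c::ring_1) \<Rightarrow> ('a \<Rightarrow> 'c) \<Rightarrow> 'c \<Rightarrow> 'c" where
  "rel_trace A Q \<rho> \<sigma> f = coset_sum A Q (\<lambda>g. \<sigma> g * f * \<rho> (inv g))"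

lemma rep_mono: "rep A \<rho> \<Longrightarrow> subgroup B G \<Longrightarrow> B \<subseteq> A \<Longrightarrow> rep B \<rho>"
  unfolding rep_def by blast

lemma rep_one:
  assumes "rep A \<rho>" "g \<in> A"
  shows "\<rho> \<one> * \<rho> g = \<rho> g" "\<rho> g * \<rho> \<one> = \<rho> g"
    "\<rho> (inv g) * \<rho> g = \<rho> \<one>" "\<rho> g * \<rho> (inv g) = \<rho> \<one>"
proof -
  have A: "subgroup A G" and m: "\<And>g h. g \<in> A \<Longrightarrow> h \<in> A \<Longrightarrow> \<rho> g * \<rho> h = \<rho> (g \<otimes> h)"
    using assms by (auto simp: rep_def)
  have "\<one> \<in> A" "inv g \<in> A" "g \<in> carrier G"
    using A assms subgroup.one_closed[OF A] subgroup.m_inv_closed[OF A]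
      subgroup.mem_carrier[OF A] by auto
  then show "\<rho> \<one> * \<rho> g = \<rho> g" "\<rho> g * \<rho> \<one> = \<rho> g"
    "\<rho> (inv g) * \<rho> g = \<rho> \<one>" "\<rho> g * \<rho> (inv g) = \<rho> \<one>"
    using assms(2) by (simp_all add: m)
qed

lemma Hom_mono: "f \<in> Hom A \<rho> \<sigma> \<Longrightarrow> B \<subseteq> A \<Longrightarrow> f \<in> Hom B \<rho> \<sigma>"
  unfolding Hom_def by blast

lemma Hom_zero: "0 \<in> Hom A \<rho> \<sigma>"
  unfolding Hom_def by simp

lemma Hom_add: "f \<in> Hom A \<rho> \<sigma> \<Longrightarrow> g \<in> Hom A \<rho> \<sigma> \<Longrightarrow> f + g \<in> Hom A \<rho> \<sigma>"
  unfolding Hom_def by (simp add: distrib_left distrib_right)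

lemma Hom_diff: "f \<in> Hom A \<rho> \<sigma> \<Longrightarrow> g \<in> Hom A \<rho> \<sigma> \<Longrightarrow> f - g \<in> Hom A \<rho> \<sigma>"
  unfolding Hom_def by (simp add: left_diff_distrib right_diff_distrib)

lemma Hom_mult: "g \<in> Hom A \<sigma> \<tau> \<Longrightarrow> f \<in> Hom A \<rho> \<sigma> \<Longrightarrow> g * f \<in> Hom A \<rho> \<tau>"
proof -
  assume g: "g \<in> Hom A \<sigma> \<tau>" and f: "f \<in> Hom A \<rho> \<sigma>"
  have "\<tau> a * (g * f) = g * f * \<rho> a" if "a \<in> A" for a
  proof -
    have "\<tau> a * (g * f) = (g * \<sigma> a) * f" using g that by (simp add: Hom_def flip: mult.assoc)
    also have "\<dots> = g * f * \<rho> a" using f that by (simp add: Hom_def mult.assoc)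
    finally show ?thesis .
  qed
  moreover have "\<tau> \<one> * (g * f) = g * f"
    using g by (simp add: Hom_def flip: mult.assoc)
  moreover have "g * f * \<rho> \<one> = g * f"
    using f by (simp add: Hom_def mult.assoc)
  ultimately show ?thesis unfolding Hom_def by blast
qed

lemma Hom_id: "rep A \<rho> \<Longrightarrow> \<rho> \<one> \<in> Hom A \<rho> \<rho>"
  using rep_one[of A \<rho>] rep_one(1)[of A \<rho> \<one>] unfolding Hom_def
  by (simp add: rep_def subgroup.one_closed)

lemma Hom_idl: "f \<in> Hom A \<rho> \<sigma> \<Longrightarrow> \<sigma> \<one> * f = f"
  and Hom_idr: "f \<in> Hom A \<rho> \<sigma> \<Longrightarrow> f * \<rho> \<one> = f"
  unfolding Hom_def by auto

lemma rel_trace_summand_invariant: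
  assumes "rep A \<rho>" "rep A \<sigma>" "subgroup Q G" "Q \<subseteq> A" "f \<in> Hom Q \<rho> \<sigma>" "g \<in> A" "q \<in> Q"
  shows "\<sigma> (g \<otimes> q) * f * \<rho> (inv (g \<otimes> q)) = \<sigma> g * f * \<rho> (inv g)"
proof -
  have A: "subgroup A G" using assms by (simp add: rep_def)
  have [simp]: "g \<in> carrier G" "q \<in> carrier G" "q \<in> A" "inv q \<in> A" "inv g \<in> A"
    using assms subgroup.mem_carrier[OF A] subgroup.m_inv_closed[OF A] by auto
  have "\<sigma> (g \<otimes> q) * f * \<rho> (inv (g \<otimes> q)) = \<sigma> g * (\<sigma> q * f) * \<rho> (inv q) * \<rho> (inv g)"
    using assms by (simp add: rep_def inv_mult_group mult.assoc)
  also have "\<dots> = \<sigma> g * f * (\<rho> q * \<rho> (inv q)) * \<rho> (inv g)"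
    using assms by (simp add: Hom_def mult.assoc)
  also have "\<dots> = \<sigma> g * f * \<rho> (inv g)"
    using assms by (simp add: rep_one mult.assoc)
  finally show ?thesis .
qed

text \<open>
Left translation by an element of \<open>A\<close> permutes the cosets, so the trace is \<open>A\<close>-equivariant.
\<close>

lemma rel_trace_in_Hom:
  assumes \<rho>: "rep A \<rho>" and \<sigma>: "rep A \<sigma>" and Q: "subgroup Q G" "Q \<subseteq> A" and f: "f \<in> Hom Q \<rho> \<sigma>"
  shows "rel_trace A Q \<rho> \<sigma> f \<in> Hom A \<rho> \<sigma>"
proof -
  have A: "subgroup A G" using \<rho> by (simp add: rep_def)
  have AG: "\<And>g. g \<in> A \<Longrightarrow> g \<in> carrier G" and Ai: "\<And>g. g \<in> A \<Longrightarrow> inv g \<in> A"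
    using subgroup.mem_carrier[OF A] subgroup.m_inv_closed[OF A] by auto
  have AQ: "coset_closed A Q" using A Q by (rule coset_closed_subgroup)
  define F where "F g = \<sigma> g * f * \<rho> (inv g)" for g
  have l: "b * coset_sum A Q F = coset_sum A Q (\<lambda>g. b * F g)" for b
    by (rule coset_sum_additive) (simp_all add: distrib_left)
  have r: "coset_sum A Q F * b = coset_sum A Q (\<lambda>g. F g * b)" for b
    using coset_sum_additive[of "\<lambda>u. u * b"] by (simp add: distrib_right)
  have 1: "\<sigma> \<one> * coset_sum A Q F = coset_sum A Q F"
    unfolding l by (rule coset_sum_cong[OF AQ]) (simp add: F_def rep_one[OF \<sigma>] flip: mult.assoc)
  have 2: "coset_sum A Q F * \<rho> \<one> = coset_sum A Q F"
    unfolding r by (rule coset_sum_cong[OF AQ]) (simp add: F_def rep_one[OF \<rho>] Ai mult.assoc)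
  have 3: "\<sigma> a * coset_sum A Q F = coset_sum A Q F * \<rho> a" if a: "a \<in> A" for a
  proof -
    have img: "(\<lambda>g. a \<otimes> g) ` A = A"
    proof (intro equalityI subsetI)
      fix g assume "g \<in> A"
      then have "inv a \<otimes> g \<in> A" "g = a \<otimes> (inv a \<otimes> g)"
        using a A AG Ai subgroup.m_closed[OF A] by auto
      then show "g \<in> (\<lambda>g. a \<otimes> g) ` A" by blast
    qed (use a subgroup.m_closed[OF A] in auto)
    have "coset_sum ((\<lambda>g. a \<otimes> g) ` A) Q F = coset_sum A Q (\<lambda>g. F (a \<otimes> g))"
    proof (rule coset_sum_translate[OF AQ AG[OF a]])
      fix g q assume g: "g \<in> A" "q \<in> Q"
      then have "a \<otimes> g \<in> A" using a subgroup.m_closed[OF A] by simp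
      then have "F ((a \<otimes> g) \<otimes> q) = F (a \<otimes> g)"
        unfolding F_def using g assms rel_trace_summand_invariant by blast
      then show "F (a \<otimes> (g \<otimes> q)) = F (a \<otimes> g)" using g a AG Q by (simp add: m_assoc subset_iff)
    qed
    then have "coset_sum A Q F = coset_sum A Q (\<lambda>g. F (a \<otimes> g))" using img by simp
    then have "coset_sum A Q F * \<rho> a = coset_sum A Q (\<lambda>g. F (a \<otimes> g) * \<rho> a)"
      using coset_sum_additive[of "\<lambda>u. u * \<rho> a"] by (simp add: distrib_right)
    also have "\<dots> = coset_sum A Q (\<lambda>g. \<sigma> a * F g)"
    proof (rule coset_sum_cong[OF AQ])
      fix g assume g: "g \<in> A"
      have "F (a \<otimes> g) * \<rho> a = \<sigma> a * (\<sigma> g * f * \<rho> (inv g)) * (\<rho> (inv a) * \<rho> a)"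
        using g a \<rho> \<sigma> AG Ai by (simp add: F_def inv_mult_group rep_def mult.assoc)
      also have "\<dots> = \<sigma> a * F g"
        using rep_one[OF \<rho> a] rep_one[OF \<rho> Ai[OF g]] by (simp add: F_def mult.assoc)
      finally show "F (a \<otimes> g) * \<rho> a = \<sigma> a * F g" .
    qed
    finally show ?thesis using l by simp
  qed
  show ?thesis using 1 2 3 unfolding Hom_def rel_trace_def F_def by blast
qed

lemma rel_trace_add: "rel_trace A Q \<rho> \<sigma> (f + g) = rel_trace A Q \<rho> \<sigma> f + rel_trace A Q \<rho> \<sigma> g"
  unfolding rel_trace_def by (simp add: distrib_left distrib_right coset_sum_add)

lemma rel_trace_zero: "rel_trace A Q \<rho> \<sigma> 0 = 0"
  unfolding rel_trace_def by (simp add: coset_sum_zero)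

lemma rel_trace_mult_left:
  assumes "subgroup A G" "subgroup Q G" "Q \<subseteq> A" "b \<in> Hom A \<sigma> \<tau>"
  shows "b * rel_trace A Q \<rho> \<sigma> f = rel_trace A Q \<rho> \<tau> (b * f)"
proof -
  have AQ: "coset_closed A Q" using assms coset_closed_subgroup by blast
  have "b * rel_trace A Q \<rho> \<sigma> f = coset_sum A Q (\<lambda>g. b * (\<sigma> g * f * \<rho> (inv g)))"
    unfolding rel_trace_def by (rule coset_sum_additive) (simp_all add: distrib_left)
  also have "\<dots> = rel_trace A Q \<rho> \<tau> (b * f)" unfolding rel_trace_def
    by (rule coset_sum_cong[OF AQ]) (use assms in \<open>simp add: Hom_def flip: mult.assoc\<close>)
  finally show ?thesis .
qed

lemma rel_trace_mult_right:
  assumes "subgroup A G" "subgroup Q G" "Q \<subseteq> A" "b \<in> Hom A \<pi> \<rho>"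
  shows "rel_trace A Q \<rho> \<sigma> f * b = rel_trace A Q \<pi> \<sigma> (f * b)"
proof -
  have AQ: "coset_closed A Q" using assms coset_closed_subgroup by blast
  have "rel_trace A Q \<rho> \<sigma> f * b = coset_sum A Q (\<lambda>g. (\<sigma> g * f * \<rho> (inv g)) * b)"
    unfolding rel_trace_def using coset_sum_additive[of "\<lambda>u. u * b"] by (simp add: distrib_right)
  also have "\<dots> = rel_trace A Q \<pi> \<sigma> (f * b)" unfolding rel_trace_def
    by (rule coset_sum_cong[OF AQ])
      (use assms in \<open>simp add: Hom_def mult.assoc subgroup.m_inv_closed\<close>)
  finally show ?thesis .
qed

lemma rel_trace_trans:
  assumes "rep L \<rho>" "rep L \<sigma>" "subgroup K G" "K \<subseteq> L" "subgroup Q G" "Q \<subseteq> K" "f \<in> Hom Q \<rho> \<sigma>"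
  shows "rel_trace L K \<rho> \<sigma> (rel_trace K Q \<rho> \<sigma> f) = rel_trace L Q \<rho> \<sigma> f"
proof -
  have L: "subgroup L G" using assms by (simp add: rep_def)
  have LK: "coset_closed L K" and KQ: "coset_closed K Q"
    using L assms coset_closed_subgroup by auto
  have LG: "\<And>g. g \<in> L \<Longrightarrow> g \<in> carrier G" using subgroup.mem_carrier[OF L] .
  have "rel_trace L K \<rho> \<sigma> (rel_trace K Q \<rho> \<sigma> f)
    = coset_sum L K (\<lambda>g. coset_sum K Q (\<lambda>k. \<sigma> (g \<otimes> k) * f * \<rho> (inv (g \<otimes> k))))"
    unfolding rel_trace_def[of L K]
  proof (rule coset_sum_cong[OF LK])
    fix g assume g: "g \<in> L"
    have "\<sigma> g * rel_trace K Q \<rho> \<sigma> f * \<rho> (inv g)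
      = coset_sum K Q (\<lambda>k. \<sigma> g * (\<sigma> k * f * \<rho> (inv k)) * \<rho> (inv g))"
      unfolding rel_trace_def using coset_sum_additive[of "\<lambda>u. \<sigma> g * u * \<rho> (inv g)"]
      by (simp add: distrib_right distrib_left)
    also have "\<dots> = coset_sum K Q (\<lambda>k. \<sigma> (g \<otimes> k) * f * \<rho> (inv (g \<otimes> k)))"
    proof (rule coset_sum_cong[OF KQ])
      fix k assume "k \<in> K"
      then have "k \<in> L" using assms by auto
      then show "\<sigma> g * (\<sigma> k * f * \<rho> (inv k)) * \<rho> (inv g) = \<sigma> (g \<otimes> k) * f * \<rho> (inv (g \<otimes> k))"
        using g assms LG L by (simp add: rep_def inv_mult_group mult.assoc subgroup.m_inv_closed)
    qed
    finally show "\<sigma> g * rel_trace K Q \<rho> \<sigma> f * \<rho> (inv g)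
      = coset_sum K Q (\<lambda>k. \<sigma> (g \<otimes> k) * f * \<rho> (inv (g \<otimes> k)))" .
  qed
  also have "\<dots> = rel_trace L Q \<rho> \<sigma> f" unfolding rel_trace_def
  proof (rule coset_sum_trans[OF LK])
    fix g q assume "g \<in> L" "q \<in> Q"
    then show "\<sigma> (g \<otimes> q) * f * \<rho> (inv (g \<otimes> q)) = \<sigma> g * f * \<rho> (inv g)"
      using rel_trace_summand_invariant[OF assms(1,2,5) _ assms(7)] assms(4,6) by blast
  qed (use assms in auto)
  finally show ?thesis .
qed

lemma Hom_conj:
  assumes "rep A \<rho>" "rep A \<sigma>" "subgroup Q G" "Q \<subseteq> A" "f \<in> Hom Q \<rho> \<sigma>" "a \<in> A"
  shows "\<sigma> a * f * \<rho> (inv a) \<in> Hom (conj_subgroup a Q) \<rho> \<sigma>"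
proof -
  have A: "subgroup A G" using assms by (simp add: rep_def)
  have AG: "\<And>g. g \<in> A \<Longrightarrow> g \<in> carrier G" and Ai: "\<And>g. g \<in> A \<Longrightarrow> inv g \<in> A"
    and Am: "\<And>g h. g \<in> A \<Longrightarrow> h \<in> A \<Longrightarrow> g \<otimes> h \<in> A"
    using subgroup.mem_carrier[OF A] subgroup.m_inv_closed[OF A] subgroup.m_closed[OF A] by auto
  have "\<sigma> (a \<otimes> q \<otimes> inv a) * (\<sigma> a * f * \<rho> (inv a)) = \<sigma> a * f * \<rho> (inv a) * \<rho> (a \<otimes> q \<otimes> inv a)"
    if q: "q \<in> Q" for q
  proof -
    have qA: "q \<in> A" using q assms by auto
    have "\<sigma> (a \<otimes> q \<otimes> inv a) * (\<sigma> a * f * \<rho> (inv a))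
      = \<sigma> (a \<otimes> q \<otimes> inv a) * \<sigma> a * f * \<rho> (inv a)" by (simp add: mult.assoc)
    also have "\<sigma> (a \<otimes> q \<otimes> inv a) * \<sigma> a = \<sigma> a * \<sigma> q"
    proof -
      have "\<sigma> (a \<otimes> q \<otimes> inv a) * \<sigma> a = \<sigma> (a \<otimes> q \<otimes> inv a \<otimes> a)"
        using assms(2,6) qA Am Ai by (simp add: rep_def)
      also have "\<dots> = \<sigma> a * \<sigma> q" using assms(2,6) qA AG by (simp add: rep_def)
      finally show ?thesis .
    qed
    also have "\<sigma> a * \<sigma> q * f * \<rho> (inv a) = \<sigma> a * f * (\<rho> q * \<rho> (inv a))"
      using assms q by (simp add: Hom_def mult.assoc)
    also have "\<rho> q * \<rho> (inv a) = \<rho> (inv a) * \<rho> (a \<otimes> q \<otimes> inv a)"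
    proof -
      have "\<rho> (inv a) * \<rho> (a \<otimes> q \<otimes> inv a) = \<rho> (inv a \<otimes> (a \<otimes> q \<otimes> inv a))"
        using assms(1,6) qA Am Ai by (simp add: rep_def)
      also have "inv a \<otimes> (a \<otimes> q \<otimes> inv a) = q \<otimes> inv a" using assms qA AG by (simp add: m_assoc)
      finally show ?thesis using assms(1,6) qA Ai by (simp add: rep_def)
    qed
    finally show ?thesis by (simp add: mult.assoc)
  qed
  moreover have "\<sigma> \<one> * (\<sigma> a * f * \<rho> (inv a)) = \<sigma> a * f * \<rho> (inv a)"
    using rep_one(1)[OF assms(2,6)] by (simp flip: mult.assoc)
  moreover have "(\<sigma> a * f * \<rho> (inv a)) * \<rho> \<one> = \<sigma> a * f * \<rho> (inv a)"
    using rep_one(2)[OF assms(1) Ai[OF assms(6)]] by (simp add: mult.assoc)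
  ultimately show ?thesis
    unfolding Hom_def conj_subgroup_def by blast
qed

lemma rel_trace_conj:
  assumes "rep A \<rho>" "rep A \<sigma>" "subgroup Q G" "Q \<subseteq> A" "f \<in> Hom Q \<rho> \<sigma>" "a \<in> A"
  shows "rel_trace A (conj_subgroup a Q) \<rho> \<sigma> (\<sigma> a * f * \<rho> (inv a)) = rel_trace A Q \<rho> \<sigma> f"
proof -
  have A: "subgroup A G" using assms by (simp add: rep_def)
  have AG: "\<And>g. g \<in> A \<Longrightarrow> g \<in> carrier G" and Ai: "\<And>g. g \<in> A \<Longrightarrow> inv g \<in> A"
    and Am: "\<And>g h. g \<in> A \<Longrightarrow> h \<in> A \<Longrightarrow> g \<otimes> h \<in> A"
    using subgroup.mem_carrier[OF A] subgroup.m_inv_closed[OF A] subgroup.m_closed[OF A] by auto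
  have "conj_subgroup a Q \<subseteq> A" unfolding conj_subgroup_def using assms Am Ai by auto
  then have c: "coset_closed A (conj_subgroup a Q)"
    using A assms subgroup_conj_subgroup AG coset_closed_subgroup by blast
  have "rel_trace A (conj_subgroup a Q) \<rho> \<sigma> (\<sigma> a * f * \<rho> (inv a))
    = coset_sum A (conj_subgroup a Q) (\<lambda>g. \<sigma> (g \<otimes> a) * f * \<rho> (inv (g \<otimes> a)))"
    unfolding rel_trace_def
    by (rule coset_sum_cong[OF c]) (use assms AG Ai in \<open>simp add: rep_def inv_mult_group mult.assoc\<close>)
  also have "\<dots> = rel_trace A Q \<rho> \<sigma> f"
    unfolding rel_trace_def by (rule coset_sum_conj) (use assms A rel_trace_summand_invariant in auto)
  finally show ?thesis .
qed

text \<open>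
The sums of traces from subgroups in \<open>\<Q>\<close>; in module terms, the homomorphisms that factor through
sums of modules projective relative to members of \<open>\<Q>\<close>. They form an ideal of the category of
representations of \<open>A\<close>.
\<close>

inductive_set trace_ideal ::
  "'a set \<Rightarrow> 'a set set \<Rightarrow> ('a \<Rightarrow> 'c::ring_1) \<Rightarrow> ('a \<Rightarrow> 'c) \<Rightarrow> 'c set"
  for A \<Q> \<rho> \<sigma> where
  trace_ideal_zero: "0 \<in> trace_ideal A \<Q> \<rho> \<sigma>"
| trace_ideal_step: "\<lbrakk>y \<in> trace_ideal A \<Q> \<rho> \<sigma>; Q \<in> \<Q>; f \<in> Hom Q \<rho> \<sigma>\<rbrakk>
    \<Longrightarrow> rel_trace A Q \<rho> \<sigma> f + y \<in> trace_ideal A \<Q> \<rho> \<sigma>"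

definition subgroups_of :: "'a set \<Rightarrow> 'a set set \<Rightarrow> bool" where
  "subgroups_of A \<Q> \<longleftrightarrow> (\<forall>Q\<in>\<Q>. subgroup Q G \<and> Q \<subseteq> A)"

lemma trace_ideal_add:
  "y \<in> trace_ideal A \<Q> \<rho> \<sigma> \<Longrightarrow> z \<in> trace_ideal A \<Q> \<rho> \<sigma> \<Longrightarrow> y + z \<in> trace_ideal A \<Q> \<rho> \<sigma>"
  by (induction rule: trace_ideal.induct) (auto simp: add.assoc intro: trace_ideal_step)

lemma trace_ideal_rel_trace: "Q \<in> \<Q> \<Longrightarrow> f \<in> Hom Q \<rho> \<sigma> \<Longrightarrow> rel_trace A Q \<rho> \<sigma> f \<in> trace_ideal A \<Q> \<rho> \<sigma>"
  using trace_ideal_step[OF trace_ideal_zero] by fastforce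

lemma trace_ideal_mono: "y \<in> trace_ideal A \<Q> \<rho> \<sigma> \<Longrightarrow> \<Q> \<subseteq> \<R> \<Longrightarrow> y \<in> trace_ideal A \<R> \<rho> \<sigma>"
  by (induction rule: trace_ideal.induct) (auto intro: trace_ideal.intros)

lemma trace_ideal_in_Hom:
  "y \<in> trace_ideal A \<Q> \<rho> \<sigma> \<Longrightarrow> rep A \<rho> \<Longrightarrow> rep A \<sigma> \<Longrightarrow> subgroups_of A \<Q> \<Longrightarrow> y \<in> Hom A \<rho> \<sigma>"
  by (induction rule: trace_ideal.induct)
    (auto simp: subgroups_of_def intro: Hom_zero Hom_add rel_trace_in_Hom)

lemma trace_ideal_mult_left:
  assumes y: "y \<in> trace_ideal A \<Q> \<rho> \<sigma>" and A: "subgroup A G" and \<Q>: "subgroups_of A \<Q>"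
    and b: "b \<in> Hom A \<sigma> \<tau>"
  shows "b * y \<in> trace_ideal A \<Q> \<rho> \<tau>"
  using y
proof (induction rule: trace_ideal.induct)
  case (trace_ideal_step y Q f)
  have Q: "subgroup Q G" "Q \<subseteq> A" using \<Q> trace_ideal_step(2) by (auto simp: subgroups_of_def)
  have "b * f \<in> Hom Q \<rho> \<tau>" using Hom_mult[OF Hom_mono[OF b Q(2)] trace_ideal_step(3)] .
  from trace_ideal.trace_ideal_step[OF trace_ideal_step(4) trace_ideal_step(2) this]
  show ?case unfolding distrib_left rel_trace_mult_left[OF A Q b] .
qed (simp add: trace_ideal_zero)

lemma trace_ideal_mult_right:
  assumes y: "y \<in> trace_ideal A \<Q> \<rho> \<sigma>" and A: "subgroup A G" and \<Q>: "subgroups_of A \<Q>"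
    and b: "b \<in> Hom A \<pi> \<rho>"
  shows "y * b \<in> trace_ideal A \<Q> \<pi> \<sigma>"
  using y
proof (induction rule: trace_ideal.induct)
  case (trace_ideal_step y Q f)
  have Q: "subgroup Q G" "Q \<subseteq> A" using \<Q> trace_ideal_step(2) by (auto simp: subgroups_of_def)
  have "f * b \<in> Hom Q \<pi> \<sigma>" using Hom_mult[OF trace_ideal_step(3) Hom_mono[OF b Q(2)]] .
  from trace_ideal.trace_ideal_step[OF trace_ideal_step(4) trace_ideal_step(2) this]
  show ?case unfolding distrib_right rel_trace_mult_right[OF A Q b] .
qed (simp add: trace_ideal_zero)

lemma rel_trace_trace_ideal:
  assumes "y \<in> trace_ideal K \<Q> \<rho> \<sigma>" "rep L \<rho>" "rep L \<sigma>" "subgroup K G" "K \<subseteq> L" "subgroups_of K \<Q>"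
  shows "rel_trace L K \<rho> \<sigma> y \<in> trace_ideal L \<Q> \<rho> \<sigma>"
  using assms
proof (induction rule: trace_ideal.induct)
  case (trace_ideal_step y Q f)
  then show ?case
    by (auto simp: rel_trace_add rel_trace_trans subgroups_of_def intro: trace_ideal.intros)
qed (simp add: rel_trace_zero trace_ideal_zero)

text \<open>
Mackey's formula for a part \<open>T\<close> of \<open>L\<close> that is stable under \<open>K\<close> on the left and \<open>H\<close> on the right. The
group \<open>K\<close> permutes the cosets of \<open>H\<close> contained in \<open>T\<close>, the stabilizer of \<open>cH\<close> is \<open>K \<inter> cHc\<inverse>\<close>, and the sum
over one orbit is the trace from this stabilizer. Allowing such \<open>T\<close> permits splitting off the double
coset contained in \<open>K\<close> itself.
\<close>

lemma mackey_biset: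
  assumes "rep L \<rho>" "rep L \<sigma>" "subgroup K G" "K \<subseteq> L" "subgroup H G" "H \<subseteq> L" "f \<in> Hom H \<rho> \<sigma>"
    and "T \<subseteq> L" "\<And>k t. k \<in> K \<Longrightarrow> t \<in> T \<Longrightarrow> k \<otimes> t \<in> T" "\<And>t h. t \<in> T \<Longrightarrow> h \<in> H \<Longrightarrow> t \<otimes> h \<in> T"
  shows "coset_sum T H (\<lambda>g. \<sigma> g * f * \<rho> (inv g)) \<in> trace_ideal K {K \<inter> conj_subgroup c H | c. c \<in> T} \<rho> \<sigma>"
proof -
  have L: "subgroup L G" using assms by (simp add: rep_def)
  have LG: "\<And>g. g \<in> L \<Longrightarrow> g \<in> carrier G" and Li: "\<And>g. g \<in> L \<Longrightarrow> inv g \<in> L"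
    and Lm: "\<And>g h. g \<in> L \<Longrightarrow> h \<in> L \<Longrightarrow> g \<otimes> h \<in> L"
    using subgroup.mem_carrier[OF L] subgroup.m_inv_closed[OF L] subgroup.m_closed[OF L] by auto
  have KL: "\<And>g. g \<in> K \<Longrightarrow> g \<in> L" and HL: "\<And>g. g \<in> H \<Longrightarrow> g \<in> L" using assms by auto
  define F where "F g = \<sigma> g * f * \<rho> (inv g)" for g
  have Finv: "F (g \<otimes> h) = F g" if "g \<in> L" "h \<in> H" for g h
    unfolding F_def using assms that rel_trace_summand_invariant by blast
  have "finite T" using assms(8) finite_subset[OF subgroup.subset[OF L]] finite_subset by auto
  then show ?thesis using assms(8-10) unfolding F_def[symmetric]
  proof (induction T rule: finite_psubset_induct)
    case (psubset T)
    have TL: "\<And>g. g \<in> T \<Longrightarrow> g \<in> L" using psubset by auto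
    show ?case
    proof (cases "T = {}")
      case True
      then show ?thesis by (simp add: coset_sum_def trace_ideal_zero)
    next
      case False
      then obtain c where c: "c \<in> T" by blast
      define D where "D = {k \<otimes> c \<otimes> h | k h. k \<in> K \<and> h \<in> H}"
      define U where "U = T - D"
      have "c = \<one> \<otimes> c \<otimes> \<one>" using LG[OF TL[OF c]] by simp
      then have cD: "c \<in> D" unfolding D_def
        using subgroup.one_closed[OF assms(3)] subgroup.one_closed[OF assms(5)] by blast
      have DT: "D \<subseteq> T"
      proof
        fix t assume "t \<in> D"
        then obtain k h where "t = k \<otimes> c \<otimes> h" "k \<in> K" "h \<in> H" unfolding D_def by blast
        then show "t \<in> T" using psubset(4)[of k c] psubset(5)[of "k \<otimes> c" h] c by simp
      qed
      have Dr: "t \<otimes> h \<in> D" if "t \<in> D" "h \<in> H" for t h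
      proof -
        obtain k h' where kh: "t = k \<otimes> c \<otimes> h'" "k \<in> K" "h' \<in> H"
          using \<open>t \<in> D\<close> D_def by blast
        then have "t \<otimes> h = k \<otimes> c \<otimes> (h' \<otimes> h)" using that c TL HL KL LG by (simp add: m_assoc)
        then show ?thesis unfolding D_def using kh that subgroup.m_closed[OF assms(5)] by blast
      qed
      have Dl: "k \<otimes> t \<in> D" if "t \<in> D" "k \<in> K" for t k
      proof -
        obtain k' h' where kh: "t = k' \<otimes> c \<otimes> h'" "k' \<in> K" "h' \<in> H"
          using \<open>t \<in> D\<close> D_def by blast
        then have "k \<otimes> t = (k \<otimes> k') \<otimes> c \<otimes> h'" using that c TL HL KL LG by (simp add: m_assoc)
        then show ?thesis unfolding D_def using kh that subgroup.m_closed[OF assms(3)] by blast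
      qed
      have Ur: "t \<otimes> h \<in> U" if "t \<in> U" "h \<in> H" for t h
      proof -
        have "t \<otimes> h \<notin> D"
        proof
          assume "t \<otimes> h \<in> D"
          then have "t \<otimes> h \<otimes> inv h \<in> D" using Dr that subgroup.m_inv_closed[OF assms(5)] by blast
          then show False using that HL LG TL by (simp add: U_def)
        qed
        then show ?thesis using that psubset(5) by (auto simp: U_def)
      qed
      have Ul: "k \<otimes> t \<in> U" if "t \<in> U" "k \<in> K" for t k
      proof -
        have "k \<otimes> t \<notin> D"
        proof
          assume "k \<otimes> t \<in> D"
          then have "inv k \<otimes> (k \<otimes> t) \<in> D" using Dl that subgroup.m_inv_closed[OF assms(3)] by blast
          then show False using that KL LG TL by (simp add: U_def)
        qed
        then show ?thesis using that psubset(4) by (auto simp: U_def)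
      qed
      have cc: "coset_closed D H" "coset_closed U H"
        unfolding coset_closed_def using assms(5) DT Dr Ur LG TL by (auto simp: U_def)
      have "T = D \<union> U" "D \<inter> U = {}" using DT by (auto simp: U_def)
      then have split: "coset_sum T H F = coset_sum D H F + coset_sum U H F" using coset_sum_Un cc by metis
      have U: "coset_sum U H F \<in> trace_ideal K {K \<inter> conj_subgroup c H | c. c \<in> T} \<rho> \<sigma>"
      proof (rule trace_ideal_mono[OF psubset.IH])
        show "U \<subset> T" using cD c by (auto simp: U_def)
      qed (use Ur Ul psubset in \<open>auto simp: U_def\<close>)
      define S where "S = K \<inter> conj_subgroup c H"
      have S: "subgroup S G" unfolding S_def using assms c TL LG
        by (intro subgroups_Inter_pair subgroup_conj_subgroup) auto
      have KS: "coset_closed K S" using assms S by (intro coset_closed_subgroup) (auto simp: S_def)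
      have "coset_sum D H F = (\<Sum>C\<in>(\<lambda>g. g \<odot> H) ` D. F (SOME h. h \<in> C))" by (simp add: coset_sum_def)
      also have "\<dots> = coset_sum K S (\<lambda>k. F (SOME h. h \<in> (k \<otimes> c) \<odot> H))"
      proof (rule coset_sum_fibres[OF KS, symmetric])
        show "(\<lambda>k. (k \<otimes> c) \<odot> H) ` K = (\<lambda>g. g \<odot> H) ` D"
        proof (intro equalityI subsetI)
          fix C assume "C \<in> (\<lambda>k. (k \<otimes> c) \<odot> H) ` K"
          then show "C \<in> (\<lambda>g. g \<odot> H) ` D" using Dl cD by auto
        next
          fix C assume "C \<in> (\<lambda>g. g \<odot> H) ` D"
          then obtain k h where kh: "k \<in> K" "h \<in> H" "C = (k \<otimes> c \<otimes> h) \<odot> H" unfolding D_def by blast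
          then have "C = (k \<otimes> c) \<odot> H" using c TL LG HL KL
            by (simp add: coset_eq_iff[OF assms(5)] inv_mult_group m_assoc
                subgroup.m_inv_closed[OF assms(5)])
          then show "C \<in> (\<lambda>k. (k \<otimes> c) \<odot> H) ` K" using kh by blast
        qed
        fix g h assume gh: "g \<in> K" "h \<in> K"
        then have [simp]: "inv g \<otimes> h \<in> K"
          using subgroup.m_inv_closed[OF assms(3)] subgroup.m_closed[OF assms(3)] by auto
        show "((g \<otimes> c) \<odot> H = (h \<otimes> c) \<odot> H) \<longleftrightarrow> (inv g \<otimes> h \<in> S)"
          using gh c TL KL LG
          by (simp add: S_def coset_eq_iff[OF assms(5)] mem_conj_subgroup_iff[OF assms(5)] inv_mult_group m_assoc)
      qed
      also have "\<dots> = coset_sum K S (\<lambda>k. F (k \<otimes> c))"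
        by (rule coset_sum_cong[OF KS], rule value_at_coset_representative[OF cc(1)])
          (use Dl cD Finv DT TL in auto)
      also have "\<dots> = rel_trace K S \<rho> \<sigma> (F c)" unfolding rel_trace_def
        by (rule coset_sum_cong[OF KS])
          (use assms(1,2) c TL KL LG Li in \<open>simp add: F_def rep_def inv_mult_group mult.assoc\<close>)
      finally have "coset_sum D H F = rel_trace K S \<rho> \<sigma> (F c)" .
      moreover have "F c \<in> Hom S \<rho> \<sigma>"
        unfolding F_def S_def using assms c TL Hom_conj Hom_mono
        by (metis Int_lower2)
      ultimately have "coset_sum D H F \<in> trace_ideal K {K \<inter> conj_subgroup c H | c. c \<in> T} \<rho> \<sigma>"
        using c S_def by (auto intro!: trace_ideal_rel_trace)
      then show ?thesis unfolding split using U trace_ideal_add by blast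
    qed
  qed
qed

lemma mackey:
  assumes "rep L \<rho>" "rep L \<sigma>" "subgroup K G" "K \<subseteq> L" "subgroup H G" "H \<subseteq> L" "f \<in> Hom H \<rho> \<sigma>"
  shows "rel_trace L H \<rho> \<sigma> f \<in> trace_ideal K {K \<inter> conj_subgroup c H | c. c \<in> L} \<rho> \<sigma>"
proof -
  have L: "subgroup L G" using assms by (simp add: rep_def)
  show ?thesis unfolding rel_trace_def
    by (rule mackey_biset[OF assms]) (use assms subgroup.m_closed[OF L] in auto)
qed

text \<open>
The cosets of \<open>H\<close> inside \<open>K\<close> contribute precisely the trace from \<open>H\<close> to \<open>K\<close>.
\<close>

lemma mackey_split:
  assumes "rep L \<rho>" "rep L \<sigma>" "subgroup K G" "K \<subseteq> L" "subgroup H G" "H \<subseteq> K" "f \<in> Hom H \<rho> \<sigma>"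
  obtains y where "y \<in> trace_ideal K {K \<inter> conj_subgroup c H | c. c \<in> L - K} \<rho> \<sigma>"
    "rel_trace L H \<rho> \<sigma> f = rel_trace K H \<rho> \<sigma> f + y"
proof -
  have L: "subgroup L G" using assms by (simp add: rep_def)
  have LG: "\<And>g. g \<in> L \<Longrightarrow> g \<in> carrier G" and Lm: "\<And>g h. g \<in> L \<Longrightarrow> h \<in> L \<Longrightarrow> g \<otimes> h \<in> L"
    using subgroup.mem_carrier[OF L] subgroup.m_closed[OF L] by auto
  have out1: "k \<otimes> t \<in> L - K" if "k \<in> K" "t \<in> L - K" for k t
  proof -
    have "k \<otimes> t \<notin> K"
    proof
      assume "k \<otimes> t \<in> K"
      then have "inv k \<otimes> (k \<otimes> t) \<in> K"
        using that subgroup.m_closed[OF assms(3)] subgroup.m_inv_closed[OF assms(3)] by blast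
      then show False using that assms(4) LG by (simp add: subset_iff)
    qed
    then show ?thesis using that Lm assms(4) by auto
  qed
  have out2: "t \<otimes> h \<in> L - K" if "h \<in> K" "t \<in> L - K" for h t
  proof -
    have "t \<otimes> h \<notin> K"
    proof
      assume "t \<otimes> h \<in> K"
      then have "t \<otimes> h \<otimes> inv h \<in> K"
        using that subgroup.m_closed[OF assms(3)] subgroup.m_inv_closed[OF assms(3)] by blast
      then show False using that assms(4) LG by (simp add: subset_iff)
    qed
    then show ?thesis using that Lm assms(4) by auto
  qed
  have "coset_closed K H" using assms coset_closed_subgroup by blast
  moreover have "coset_closed (L - K) H"
    unfolding coset_closed_def using assms(5,6) LG out2 by blast
  ultimately have "coset_sum (K \<union> (L - K)) H F = coset_sum K H F + coset_sum (L - K) H F" for F :: "_ \<Rightarrow> 'c"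
    by (rule coset_sum_Un) auto
  moreover have "K \<union> (L - K) = L" using assms by auto
  ultimately have "rel_trace L H \<rho> \<sigma> f
      = rel_trace K H \<rho> \<sigma> f + coset_sum (L - K) H (\<lambda>g. \<sigma> g * f * \<rho> (inv g))"
    unfolding rel_trace_def by metis
  moreover have "coset_sum (L - K) H (\<lambda>g. \<sigma> g * f * \<rho> (inv g))
      \<in> trace_ideal K {K \<inter> conj_subgroup c H | c. c \<in> L - K} \<rho> \<sigma>"
    by (rule mackey_biset[OF assms(1-5) _ assms(7)]) (use assms(4,6) out1 out2 in auto)
  ultimately show ?thesis using that by blast
qed

text \<open>
One factor is absorbed into the other trace after being restricted to \<open>Q\<close>, where Mackey's formula
rewrites it. In module terms, projectivity relative to two subgroups implies projectivity relative
to intersections of their conjugates.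
\<close>

lemma rel_trace_product:
  assumes "rep K \<rho>" "rep K \<sigma>" "rep K \<tau>" "subgroup H G" "H \<subseteq> K" "subgroup Q G" "Q \<subseteq> K"
    and f: "f \<in> Hom H \<sigma> \<tau>" and h: "h \<in> Hom Q \<rho> \<sigma>"
  shows "rel_trace K H \<sigma> \<tau> f * rel_trace K Q \<rho> \<sigma> h \<in> trace_ideal K {Q \<inter> conj_subgroup c H | c. c \<in> K} \<rho> \<tau>"
proof -
  have K: "subgroup K G" using assms by (simp add: rep_def)
  define a where "a = rel_trace K H \<sigma> \<tau> f"
  have a: "a \<in> Hom K \<sigma> \<tau>" unfolding a_def using assms by (intro rel_trace_in_Hom)
  have s: "subgroups_of Q {Q \<inter> conj_subgroup c H | c. c \<in> K}"
    unfolding subgroups_of_def using assms subgroup.mem_carrier[OF K]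
    by (auto intro!: subgroups_Inter_pair subgroup_conj_subgroup)
  have "a \<in> trace_ideal Q {Q \<inter> conj_subgroup c H | c. c \<in> K} \<sigma> \<tau>"
    unfolding a_def using assms by (intro mackey) auto
  then have "a * h \<in> trace_ideal Q {Q \<inter> conj_subgroup c H | c. c \<in> K} \<rho> \<tau>"
    using assms(6) s h by (rule trace_ideal_mult_right)
  then have "rel_trace K Q \<rho> \<tau> (a * h) \<in> trace_ideal K {Q \<inter> conj_subgroup c H | c. c \<in> K} \<rho> \<tau>"
    using assms s by (intro rel_trace_trace_ideal)
  then show ?thesis using rel_trace_mult_left[OF K assms(6,7) a, of \<rho> h] a_def by simp
qed

end

section \<open>Local endomorphism rings and vertices\<close>

context finite_group
begin

definition unit_endo :: "'a set \<Rightarrow> ('a \<Rightarrow> 'c::ring_1) \<Rightarrow> 'c \<Rightarrow> bool" where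
  "unit_endo A \<rho> f \<longleftrightarrow> f \<in> Hom A \<rho> \<rho> \<and> (\<exists>g\<in>Hom A \<rho> \<rho>. f * g = \<rho> \<one> \<and> g * f = \<rho> \<one>)"

text \<open>
Fitting's lemma supplies this form of locality for indecomposable finite-dimensional modules.
\<close>

definition local_rep :: "'a set \<Rightarrow> ('a \<Rightarrow> 'c::ring_1) \<Rightarrow> bool" where
  "local_rep A \<rho> \<longleftrightarrow> rep A \<rho> \<and> \<rho> \<one> \<noteq> 0 \<and>
     (\<forall>f\<in>Hom A \<rho> \<rho>. (\<exists>n. f ^ n = 0) \<or> unit_endo A \<rho> f)"

text \<open>
A nilpotent element has no one-sided inverse, since the powers would be inverse to each other as well.
\<close>

lemma local_right_invertible:
  assumes "local_rep A \<rho>" "f \<in> Hom A \<rho> \<rho>" "g \<in> Hom A \<rho> \<rho>" "f * g = \<rho> \<one>"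
  shows "unit_endo A \<rho> f"
proof (rule ccontr)
  assume "\<not> ?thesis"
  then obtain n where n: "f ^ n = 0" using assms unfolding local_rep_def by blast
  have "f ^ Suc k * g ^ Suc k = \<rho> \<one>" for k
  proof (induction k)
    case (Suc k)
    have "f ^ Suc (Suc k) * g ^ Suc (Suc k) = f ^ Suc k * (f * g) * g ^ Suc k"
      unfolding power_Suc2[of f "Suc k"] power_Suc[of g "Suc k"] by (simp only: mult.assoc)
    also have "f * g = \<rho> \<one>" by fact
    also have "f ^ Suc k * \<rho> \<one> * g ^ Suc k = f ^ Suc k * g ^ Suc k"
    proof -
      have "\<rho> \<one> * g ^ Suc k = (\<rho> \<one> * g) * g ^ k" by (simp add: mult.assoc)
      then show ?thesis using Hom_idl[OF assms(3)] by (simp add: mult.assoc)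
    qed
    finally show ?case using Suc by simp
  qed (use assms in simp)
  from this[of n] n have "\<rho> \<one> = 0" by simp
  then show False using assms by (simp add: local_rep_def)
qed

lemma local_left_invertible:
  assumes "local_rep A \<rho>" "f \<in> Hom A \<rho> \<rho>" "g \<in> Hom A \<rho> \<rho>" "g * f = \<rho> \<one>"
  shows "unit_endo A \<rho> f"
proof -
  have "unit_endo A \<rho> g" using assms local_right_invertible by blast
  then obtain h where h: "h \<in> Hom A \<rho> \<rho>" "h * g = \<rho> \<one>" by (auto simp: unit_endo_def)
  have "h = h * (g * f)" unfolding assms(4) using Hom_idr[OF h(1)] by simp
  also have "\<dots> = f" using h Hom_idl[OF assms(2)] by (simp flip: mult.assoc)
  finally have "h = f" .
  then show ?thesis using h assms by (auto simp: unit_endo_def)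
qed

text \<open>
Locality leaves only nilpotency of \<open>1 - f\<close> to be excluded, for which it suffices that \<open>1 - f\<close> fixes
the last nonzero power of \<open>f\<close>.
\<close>

lemma unit_endo_one_minus_nilpotent:
  assumes loc: "local_rep A \<rho>" and f: "f \<in> Hom A \<rho> \<rho>" and n: "f ^ n = 0"
  shows "unit_endo A \<rho> (\<rho> \<one> - f)"
proof (rule ccontr)
  assume nu: "\<not> unit_endo A \<rho> (\<rho> \<one> - f)"
  have e: "\<rho> \<one> \<in> Hom A \<rho> \<rho>" "\<rho> \<one> \<noteq> 0" using loc Hom_id by (auto simp: local_rep_def)
  have "\<rho> \<one> - f \<in> Hom A \<rho> \<rho>" using Hom_diff[OF e(1) f] .
  then obtain m where m: "(\<rho> \<one> - f) ^ m = 0"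
    using loc nu unfolding local_rep_def by blast
  \<comment> \<open>The last nonzero power of f is fixed by 1 - f.\<close>
  define k where "k = (LEAST k. f ^ k * \<rho> \<one> = 0)"
  have k: "f ^ k * \<rho> \<one> = 0" unfolding k_def by (rule LeastI[of _ n]) (simp add: n)
  have "k \<noteq> 0" using k e by (metis mult_1 power_0)
  then obtain j where j: "k = Suc j" using not0_implies_Suc by blast
  define v where "v = f ^ j * \<rho> \<one>"
  have v: "v \<noteq> 0" using not_less_Least[of j "\<lambda>k. f ^ k * \<rho> \<one> = 0"] j by (simp add: v_def k_def)
  have 1: "\<rho> \<one> * v = v"
  proof (cases j)
    case 0
    then show ?thesis using Hom_idl[OF e(1)] by (simp add: v_def)
  next
    case (Suc i)
    then show ?thesis using Hom_idl[OF f] by (simp add: v_def flip: mult.assoc)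
  qed
  have "f * v = 0" using k by (simp add: v_def j mult.assoc)
  then have "(\<rho> \<one> - f) * v = v" using 1 by (simp add: left_diff_distrib)
  then have "(\<rho> \<one> - f) ^ i * v = v" for i
    by (induction i) (simp_all add: mult.assoc)
  from this[of m] m v show False by simp
qed

lemma local_unit_sum:
  assumes loc: "local_rep A \<rho>" and x: "x \<in> Hom A \<rho> \<rho>" and y: "y \<in> Hom A \<rho> \<rho>"
    and u: "unit_endo A \<rho> (x + y)"
  shows "unit_endo A \<rho> x \<or> unit_endo A \<rho> y"
proof -
  obtain w where w: "w \<in> Hom A \<rho> \<rho>" "w * (x + y) = \<rho> \<one>" using u by (auto simp: unit_endo_def)
  have wx: "w * x \<in> Hom A \<rho> \<rho>" and wy: "w * y \<in> Hom A \<rho> \<rho>" using Hom_mult w x y by blast+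
  have left: "unit_endo A \<rho> z" if "unit_endo A \<rho> (w * z)" "z \<in> Hom A \<rho> \<rho>" for z
  proof -
    obtain s where "s \<in> Hom A \<rho> \<rho>" "s * (w * z) = \<rho> \<one>"
      using \<open>unit_endo A \<rho> (w * z)\<close> by (auto simp: unit_endo_def)
    then have "s * w \<in> Hom A \<rho> \<rho>" "(s * w) * z = \<rho> \<one>"
      using Hom_mult w by (auto simp: mult.assoc)
    then show ?thesis using local_left_invertible loc that by blast
  qed
  show ?thesis
  proof (cases "unit_endo A \<rho> (w * x)")
    case False
    then obtain n where "(w * x) ^ n = 0" using loc wx by (auto simp: local_rep_def)
    then have "unit_endo A \<rho> (\<rho> \<one> - w * x)" using unit_endo_one_minus_nilpotent loc wx by blast
    moreover have "\<rho> \<one> - w * x = w * y" unfolding w(2)[symmetric] by (simp add: distrib_left)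
    ultimately show ?thesis using left y by simp
  qed (use left x in blast)
qed

text \<open>
Higman's form of relative projectivity.
\<close>

definition rel_proj :: "'a set \<Rightarrow> 'a set \<Rightarrow> ('a \<Rightarrow> 'c::ring_1) \<Rightarrow> bool" where
  "rel_proj A Q \<rho> \<longleftrightarrow> (\<exists>f\<in>Hom Q \<rho> \<rho>. rel_trace A Q \<rho> \<rho> f = \<rho> \<one>)"

definition has_vertex :: "'a set \<Rightarrow> 'a set \<Rightarrow> ('a \<Rightarrow> 'c::ring_1) \<Rightarrow> bool" where
  "has_vertex A H \<rho> \<longleftrightarrow> subgroup H G \<and> H \<subseteq> A \<and> rel_proj A H \<rho> \<and>
     (\<forall>Q. subgroup Q G \<and> Q \<subseteq> H \<and> rel_proj A Q \<rho> \<longrightarrow> Q = H)"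

lemma rel_proj_of_unit:
  assumes A: "subgroup A G" "subgroup Q G" "Q \<subseteq> A" and f: "f \<in> Hom Q \<rho> \<rho>"
    and u: "unit_endo A \<rho> (rel_trace A Q \<rho> \<rho> f)"
  shows "rel_proj A Q \<rho>"
proof -
  obtain g where g: "g \<in> Hom A \<rho> \<rho>" "rel_trace A Q \<rho> \<rho> f * g = \<rho> \<one>" using u by (auto simp: unit_endo_def)
  then have "rel_trace A Q \<rho> \<rho> (f * g) = \<rho> \<one>" using rel_trace_mult_right[OF A g(1)] by simp
  moreover have "f * g \<in> Hom Q \<rho> \<rho>" using f Hom_mono[OF g(1) A(3)] Hom_mult by blast
  ultimately show ?thesis unfolding rel_proj_def by blast
qed

text \<open>
Rosenberg's lemma: in a local ring a sum of ideals contains a unit only if one of them does.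
\<close>

lemma trace_ideal_unit_imp_rel_proj:
  assumes "y \<in> trace_ideal A \<Q> \<rho> \<rho>" and loc: "local_rep A \<rho>" and s: "subgroups_of A \<Q>"
    and "unit_endo A \<rho> y"
  shows "\<exists>Q\<in>\<Q>. rel_proj A Q \<rho>"
  using assms(1,4)
proof (induction rule: trace_ideal.induct)
  case trace_ideal_zero
  then show ?case using loc by (auto simp: unit_endo_def local_rep_def)
next
  case (trace_ideal_step y Q f)
  have \<rho>: "rep A \<rho>" and A: "subgroup A G" using loc by (auto simp: local_rep_def rep_def)
  have Q: "subgroup Q G" "Q \<subseteq> A" using s trace_ideal_step(2) by (auto simp: subgroups_of_def)
  have "rel_trace A Q \<rho> \<rho> f \<in> Hom A \<rho> \<rho>" using rel_trace_in_Hom \<rho> Q trace_ideal_step(3) by blast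
  moreover have "y \<in> Hom A \<rho> \<rho>" using trace_ideal_in_Hom trace_ideal_step(1) \<rho> s by blast
  ultimately have "unit_endo A \<rho> (rel_trace A Q \<rho> \<rho> f) \<or> unit_endo A \<rho> y"
    using local_unit_sum loc trace_ideal_step(5) by blast
  then show ?case
    using trace_ideal_step(2,4) rel_proj_of_unit[OF A Q trace_ideal_step(3)] by blast
qed

lemma trace_ideal_one_imp_rel_proj:
  assumes "\<rho> \<one> \<in> trace_ideal A \<Q> \<rho> \<rho>" and loc: "local_rep A \<rho>" and s: "subgroups_of A \<Q>"
  shows "\<exists>Q\<in>\<Q>. rel_proj A Q \<rho>"
proof -
  have \<rho>: "\<rho> \<one> \<in> Hom A \<rho> \<rho>" using loc Hom_id by (auto simp: local_rep_def)
  then have "unit_endo A \<rho> (\<rho> \<one>)" using Hom_idl[OF \<rho>] by (auto simp: unit_endo_def)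
  then show ?thesis using trace_ideal_unit_imp_rel_proj assms by blast
qed

lemma rel_proj_conj:
  assumes "rep A \<rho>" "subgroup Q G" "Q \<subseteq> A" "a \<in> A" "rel_proj A Q \<rho>"
  shows "rel_proj A (conj_subgroup a Q) \<rho>"
  using assms rel_trace_conj[of A \<rho> \<rho> Q _ a] Hom_conj[of A \<rho> \<rho> Q _ a] unfolding rel_proj_def by metis

text \<open>
Projectivity is invariant under conjugation of the subgroup, so minimality of \<open>H\<close> holds for its
conjugates as well.
\<close>

lemma has_vertex_conj:
  assumes \<rho>: "rep A \<rho>" and v: "has_vertex A H \<rho>" and Q: "subgroup Q G" and c: "c \<in> A"
    and QH: "Q \<subseteq> conj_subgroup c H" and p: "rel_proj A Q \<rho>"
  shows "Q = conj_subgroup c H"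
proof -
  have A: "subgroup A G" using \<rho> by (simp add: rep_def)
  have AG: "\<And>g. g \<in> A \<Longrightarrow> g \<in> carrier G" and Ai: "\<And>g. g \<in> A \<Longrightarrow> inv g \<in> A"
    and Am: "\<And>g h. g \<in> A \<Longrightarrow> h \<in> A \<Longrightarrow> g \<otimes> h \<in> A"
    using subgroup.mem_carrier[OF A] subgroup.m_inv_closed[OF A] subgroup.m_closed[OF A] by auto
  have H: "subgroup H G" "H \<subseteq> A" using v by (auto simp: has_vertex_def)
  have HG: "H \<subseteq> carrier G" and QG: "Q \<subseteq> carrier G" using H Q subgroup.subset by auto
  have "conj_subgroup c H \<subseteq> A" unfolding conj_subgroup_def using H c Am Ai by auto
  then have QA: "Q \<subseteq> A" using QH by simp
  have "conj_subgroup (inv c) Q \<subseteq> conj_subgroup (inv c) (conj_subgroup c H)"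
    using QH unfolding conj_subgroup_def by blast
  also have "\<dots> = H" using conj_subgroup_conj_subgroup[OF HG, of "inv c" c] c AG conj_subgroup_one HG by simp
  finally have "conj_subgroup (inv c) Q \<subseteq> H" .
  moreover have "rel_proj A (conj_subgroup (inv c) Q) \<rho>" using rel_proj_conj[OF \<rho> Q QA Ai[OF c] p] .
  moreover have "subgroup (conj_subgroup (inv c) Q) G" using subgroup_conj_subgroup Q c AG by simp
  ultimately have "conj_subgroup (inv c) Q = H" using v by (auto simp: has_vertex_def)
  then have "conj_subgroup c H = conj_subgroup c (conj_subgroup (inv c) Q)" by simp
  also have "\<dots> = Q" using conj_subgroup_conj_subgroup[OF QG, of c "inv c"] c AG conj_subgroup_one QG by simp
  finally show ?thesis by simp
qed

definition retract :: "'a set \<Rightarrow> ('a \<Rightarrow> 'c::ring_1) \<Rightarrow> ('a \<Rightarrow> 'c) \<Rightarrow> bool" where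
  "retract A \<nu> \<mu> \<longleftrightarrow> (\<exists>i\<in>Hom A \<nu> \<mu>. \<exists>p\<in>Hom A \<mu> \<nu>. p * i = \<nu> \<one>)"

definition rep_iso :: "'a set \<Rightarrow> ('a \<Rightarrow> 'c::ring_1) \<Rightarrow> ('a \<Rightarrow> 'c) \<Rightarrow> bool" where
  "rep_iso A \<rho> \<sigma> \<longleftrightarrow> (\<exists>i\<in>Hom A \<rho> \<sigma>. \<exists>p\<in>Hom A \<sigma> \<rho>. p * i = \<rho> \<one> \<and> i * p = \<sigma> \<one>)"

text \<open>
The composite in the other order is an idempotent of a local ring that is not zero, hence it is
the identity.
\<close>

lemma retract_of_local_imp_iso:
  assumes \<rho>: "rep A \<rho>" "\<rho> \<one> \<noteq> 0" and loc: "local_rep A \<sigma>"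
    and \<alpha>: "\<alpha> \<in> Hom A \<sigma> \<rho>" and \<beta>: "\<beta> \<in> Hom A \<rho> \<sigma>" and u: "unit_endo A \<rho> (\<alpha> * \<beta>)"
  shows "rep_iso A \<rho> \<sigma>"
proof -
  obtain w where w: "w \<in> Hom A \<rho> \<rho>" "\<alpha> * \<beta> * w = \<rho> \<one>" "w * (\<alpha> * \<beta>) = \<rho> \<one>"
    using u by (auto simp: unit_endo_def)
  have p: "w * \<alpha> \<in> Hom A \<sigma> \<rho>" using Hom_mult w \<alpha> by blast
  define E where "E = \<beta> * (w * \<alpha>)"
  have E: "E \<in> Hom A \<sigma> \<sigma>" unfolding E_def using Hom_mult \<beta> p by blast
  have pb: "(w * \<alpha>) * \<beta> = \<rho> \<one>" using w by (simp add: mult.assoc)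
  have "E * E = \<beta> * (((w * \<alpha>) * \<beta>) * (w * \<alpha>))" by (simp add: E_def mult.assoc)
  also have "\<dots> = E" unfolding pb Hom_idl[OF p] E_def ..
  finally have EE: "E * E = E" .
  have "E \<noteq> 0"
  proof
    assume "E = 0"
    have "\<rho> \<one> = (w * \<alpha>) * \<beta> * ((w * \<alpha>) * \<beta>)" unfolding pb using Hom_idl[OF Hom_id[OF \<rho>(1)]] by simp
    also have "\<dots> = (w * \<alpha>) * E * \<beta>" by (simp add: E_def mult.assoc)
    finally show False using \<open>E = 0\<close> \<rho> by simp
  qed
  moreover have "E ^ Suc n = E" for n by (induction n) (auto simp: EE mult.assoc)
  then have "E ^ n \<noteq> 0" for n using \<open>E \<noteq> 0\<close> by (cases n) auto
  ultimately have "unit_endo A \<sigma> E" using loc E by (auto simp: local_rep_def)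
  then obtain z where z: "z * E = \<sigma> \<one>" "z \<in> Hom A \<sigma> \<sigma>" by (auto simp: unit_endo_def)
  have "E = z * (E * E)" using z Hom_idl[OF E] by (simp flip: mult.assoc)
  then have "\<beta> * (w * \<alpha>) = \<sigma> \<one>" using EE z E_def by simp
  then show ?thesis unfolding rep_iso_def using pb p \<beta> by blast
qed

end

section \<open>The Green correspondence for representations in a ring\<close>

locale green = finite_group +
  fixes L K H :: "'a set"
  assumes L: "subgroup L G" and K: "subgroup K G" and H: "subgroup H G"
    and KL: "K \<subseteq> L" and HK: "H \<subseteq> K"
    and norm: "\<And>g. g \<in> L \<Longrightarrow> conj_subgroup g H = H \<Longrightarrow> g \<in> K"
begin

text \<open>
The subgroups that measure the failure of \<open>tr\<^sub>H\<^sup>L\<close> to restrict to \<open>tr\<^sub>H\<^sup>K\<close>.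
\<close>

definition outer_meets :: "'a set set" where "outer_meets = {K \<inter> conj_subgroup c H | c. c \<in> L - K}"

lemma HL: "H \<subseteq> L" using HK KL by simp

lemma LG: "g \<in> L \<Longrightarrow> g \<in> carrier G" using subgroup.mem_carrier[OF L] .

lemma subgroups_outer_meets: "subgroups_of K outer_meets"
  unfolding subgroups_of_def outer_meets_def using H K LG by (auto intro!: subgroups_Inter_pair subgroup_conj_subgroup)

lemma subgroups_twice:
  assumes "subgroup A G" "subgroup Y G" "Y \<subseteq> A" "K \<subseteq> A"
  shows "subgroups_of A {Y \<inter> conj_subgroup d H | d. d \<in> K}"
  unfolding subgroups_of_def using assms H KL LG by (auto intro!: subgroups_Inter_pair subgroup_conj_subgroup)

text \<open>
This is where the normalizer enters. If \<open>Y = K \<inter> gHg\<inverse>\<close> violated the claim, minimality would give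
\<open>dHd\<inverse> \<subseteq> gHg\<inverse>\<close>, by cardinality an equality, so \<open>d\<inverse>g\<close> would normalize \<open>H\<close> and \<open>g\<close> would lie in \<open>K\<close>.
\<close>

lemma not_rel_proj_double:
  assumes A: "K \<subseteq> A" and \<rho>: "rep A \<rho>" and v: "has_vertex A H \<rho>"
    and Y: "Y \<in> outer_meets" and d: "d \<in> K"
  shows "\<not> rel_proj A (Y \<inter> conj_subgroup d H) \<rho>"
proof
  assume p: "rel_proj A (Y \<inter> conj_subgroup d H) \<rho>"
  obtain g where g: "g \<in> L" "g \<notin> K" "Y = K \<inter> conj_subgroup g H" using Y by (auto simp: outer_meets_def)
  have [simp]: "g \<in> carrier G" "d \<in> carrier G" using g d KL LG by auto
  have HG: "H \<subseteq> carrier G" using subgroup.subset[OF H] .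
  have "subgroup (Y \<inter> conj_subgroup d H) G"
    using H K g d by (auto intro!: subgroups_Inter_pair subgroup_conj_subgroup)
  then have "Y \<inter> conj_subgroup d H = conj_subgroup d H" using has_vertex_conj[OF \<rho> v _ _ _ p] A d by auto
  then have "conj_subgroup d H \<subseteq> conj_subgroup g H" using g by auto
  moreover have "card (conj_subgroup d H) = card (conj_subgroup g H)" by (simp add: card_conj_subgroup HG)
  moreover have "finite (conj_subgroup g H)" unfolding conj_subgroup_def using finite_subset[OF HG] by auto
  ultimately have eq: "conj_subgroup d H = conj_subgroup g H" by (metis card_subset_eq)
  have "conj_subgroup (inv d \<otimes> g) H = conj_subgroup (inv d) (conj_subgroup d H)"
    unfolding eq using conj_subgroup_conj_subgroup[OF HG] by simp
  also have "\<dots> = H" using conj_subgroup_conj_subgroup[OF HG] conj_subgroup_one HG by simp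
  finally have "inv d \<otimes> g \<in> K"
    using norm g d KL subgroup.m_closed[OF L] subgroup.m_inv_closed[OF L] by blast
  then have "d \<otimes> (inv d \<otimes> g) \<in> K" using d subgroup.m_closed[OF K] by blast
  then show False using g by simp
qed

text \<open>
Otherwise the identity, being also a trace from \<open>H\<close>, would be a product of a trace from \<open>H\<close> and
one from some \<open>Y = K \<inter> gHg\<inverse>\<close>, hence a trace from some \<open>Y \<inter> dHd\<inverse>\<close>.
\<close>

lemma has_vertex_not_in_outer_meets:
  assumes loc: "local_rep K \<nu>" and v: "has_vertex K H \<nu>"
  shows "\<nu> \<one> \<notin> trace_ideal K outer_meets \<nu> \<nu>"
proof
  have \<nu>: "rep K \<nu>" using loc by (simp add: local_rep_def)
  assume "\<nu> \<one> \<in> trace_ideal K outer_meets \<nu> \<nu>"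
  then obtain Y where Y: "Y \<in> outer_meets" "rel_proj K Y \<nu>"
    using trace_ideal_one_imp_rel_proj loc subgroups_outer_meets by blast
  have YK: "subgroup Y G" "Y \<subseteq> K" using subgroups_outer_meets Y by (auto simp: subgroups_of_def)
  obtain h where h: "h \<in> Hom Y \<nu> \<nu>" "rel_trace K Y \<nu> \<nu> h = \<nu> \<one>" using Y by (auto simp: rel_proj_def)
  obtain a where a: "a \<in> Hom H \<nu> \<nu>" "rel_trace K H \<nu> \<nu> a = \<nu> \<one>"
    using v by (auto simp: rel_proj_def has_vertex_def)
  have "\<nu> \<one> * \<nu> \<one> \<in> trace_ideal K {Y \<inter> conj_subgroup d H | d. d \<in> K} \<nu> \<nu>"
    using rel_trace_product[OF \<nu> \<nu> \<nu> H HK YK a(1) h(1)] unfolding a h .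
  then have "\<nu> \<one> \<in> trace_ideal K {Y \<inter> conj_subgroup d H | d. d \<in> K} \<nu> \<nu>"
    using Hom_idl[OF Hom_id[OF \<nu>]] by simp
  then obtain d where "d \<in> K" "rel_proj K (Y \<inter> conj_subgroup d H) \<nu>"
    using trace_ideal_one_imp_rel_proj[OF _ loc subgroups_twice[OF K YK]] by blast
  then show False using not_rel_proj_double[OF _ \<nu> v Y(1)] by blast
qed

lemma restrict_rel_trace:
  assumes "rep L \<rho>" "rep L \<sigma>" "f \<in> Hom H \<rho> \<sigma>"
  obtains y where "y \<in> trace_ideal K outer_meets \<rho> \<sigma>" "rel_trace L H \<rho> \<sigma> f = rel_trace K H \<rho> \<sigma> f + y"
  unfolding outer_meets_def using mackey_split[OF assms(1,2) K KL H HK assms(3)] by blast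

text \<open>
Modulo the ideal, \<open>i p + y\<close> is the idempotent \<open>i p\<close>, and so are all its powers; the identity of
\<open>\<nu>\<close> would be in the ideal if one of these vanished. The computation is done after multiplying
by \<open>p\<close> on the left.
\<close>

lemma lifted_idempotent:
  assumes \<mu>: "rep L \<mu>" and loc: "local_rep K \<nu>" and v: "has_vertex K H \<nu>"
    and i: "i \<in> Hom K \<nu> \<mu>" and p: "p \<in> Hom K \<mu> \<nu>" and pi: "p * i = \<nu> \<one>"
    and y: "y \<in> trace_ideal K outer_meets \<mu> \<mu>"
  shows "(i * p + y) ^ n \<noteq> 0"
proof -
  have \<nu>: "rep K \<nu>" using loc by (simp add: local_rep_def)
  have \<mu>K: "rep K \<mu>" using \<mu> rep_mono K KL by blast
  have ip: "i * p \<in> Hom K \<mu> \<mu>" using Hom_mult i p by blast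
  have yK: "y \<in> Hom K \<mu> \<mu>" using trace_ideal_in_Hom y \<mu>K subgroups_outer_meets by blast
  have pip: "p * (i * p) = p"
    using Hom_idl[OF p] by (simp add: pi flip: mult.assoc)
  have "\<exists>z\<in>trace_ideal K outer_meets \<mu> \<nu>. p * (i * p + y) ^ n = p + z" for n
  proof (induction n)
    case 0
    then show ?case using trace_ideal_zero by force
  next
    case (Suc n)
    then obtain z where z: "z \<in> trace_ideal K outer_meets \<mu> \<nu>" "p * (i * p + y) ^ n = p + z" by blast
    have "p * (i * p + y) ^ Suc n = p * (i * p + y) ^ n * (i * p + y)"
      by (simp add: power_commutes mult.assoc)
    also have "\<dots> = p + (p * y + z * (i * p + y))"
      unfolding z using pip by (simp add: distrib_right distrib_left)
    finally have "p * (i * p + y) ^ Suc n = p + (p * y + z * (i * p + y))" .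
    moreover have "p * y + z * (i * p + y) \<in> trace_ideal K outer_meets \<mu> \<nu>"
      using trace_ideal_add trace_ideal_mult_left[OF y K subgroups_outer_meets p]
        trace_ideal_mult_right[OF z(1) K subgroups_outer_meets Hom_add[OF ip yK]] by blast
    ultimately show ?case by blast
  qed
  then obtain z where z: "z \<in> trace_ideal K outer_meets \<mu> \<nu>" "p * (i * p + y) ^ n = p + z" by blast
  show ?thesis
  proof
    assume "(i * p + y) ^ n = 0"
    then have "p = (- z)" using z by (simp add: add_eq_0_iff2)
    then have "\<nu> \<one> = z * (- i)" using pi by simp
    moreover have "- i \<in> Hom K \<nu> \<mu>" using Hom_diff[OF Hom_zero i] by simp
    ultimately have "\<nu> \<one> \<in> trace_ideal K outer_meets \<nu> \<nu>"
      using trace_ideal_mult_right[OF z(1) K subgroups_outer_meets] by metis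
    then show False using has_vertex_not_in_outer_meets loc v by blast
  qed
qed

text \<open>
Homomorphisms over \<open>K\<close> that factor through a representation with vertex \<open>H\<close> come from \<open>L\<close> up to the
ideal: the required lift is the trace of \<open>i a p\<close>, where the trace of \<open>a\<close> is the identity of \<open>\<nu>\<close>.
\<close>

lemma hom_mod_trace_ideal:
  assumes "rep L \<mu>" "rep L \<mu>'" "rep K \<nu>" "has_vertex K H \<nu>"
    and i: "i \<in> Hom K \<nu> \<mu>'" and p: "p \<in> Hom K \<mu> \<nu>"
  obtains u y where "u \<in> Hom L \<mu> \<mu>'" "y \<in> trace_ideal K outer_meets \<mu> \<mu>'" "u = i * p + y"
proof -
  obtain a where a: "a \<in> Hom H \<nu> \<nu>" "rel_trace K H \<nu> \<nu> a = \<nu> \<one>"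
    using assms by (auto simp: rel_proj_def has_vertex_def)
  have iap: "i * a * p \<in> Hom H \<mu> \<mu>'"
    using Hom_mult a Hom_mono[OF i HK] Hom_mono[OF p HK] by blast
  obtain y where y: "y \<in> trace_ideal K outer_meets \<mu> \<mu>'" "rel_trace L H \<mu> \<mu>' (i * a * p) = rel_trace K H \<mu> \<mu>' (i * a * p) + y"
    using restrict_rel_trace assms iap by blast
  have "rel_trace K H \<mu> \<mu>' (i * a * p) = i * rel_trace K H \<nu> \<nu> a * p"
    using rel_trace_mult_right[OF K H HK p] rel_trace_mult_left[OF K H HK i] by simp
  also have "\<dots> = i * p" unfolding a using Hom_idr[OF i] by simp
  finally have "rel_trace K H \<mu> \<mu>' (i * a * p) = i * p" .
  moreover have "rel_trace L H \<mu> \<mu>' (i * a * p) \<in> Hom L \<mu> \<mu>'" using rel_trace_in_Hom assms H HL iap by blast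
  ultimately show ?thesis using that y by metis
qed

text \<open>
Insert \<open>u\<inverse> u\<close> with \<open>u = i p + y\<close> between \<open>p'\<close> and \<open>i'\<close>. The identity of \<open>\<nu>'\<close> becomes a sum of an
endomorphism that factors through \<open>\<nu>\<close> and one in the ideal; the latter is not a unit.
\<close>

theorem restriction_summand_unique:
  assumes \<mu>: "local_rep L \<mu>" and \<nu>: "local_rep K \<nu>" "has_vertex K H \<nu>" and \<nu>': "local_rep K \<nu>'" "has_vertex K H \<nu>'"
    and r: "retract K \<nu> \<mu>" "retract K \<nu>' \<mu>"
  shows "rep_iso K \<nu>' \<nu>"
proof -
  obtain i p where ip: "i \<in> Hom K \<nu> \<mu>" "p \<in> Hom K \<mu> \<nu>" "p * i = \<nu> \<one>" using r by (auto simp: retract_def)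
  obtain i' p' where ip': "i' \<in> Hom K \<nu>' \<mu>" "p' \<in> Hom K \<mu> \<nu>'" "p' * i' = \<nu>' \<one>"
    using r by (auto simp: retract_def)
  have reps: "rep L \<mu>" "rep K \<nu>" "rep K \<nu>'" "rep K \<mu>"
    using \<mu> \<nu> \<nu>' rep_mono K KL by (auto simp: local_rep_def)
  obtain u y where u: "u \<in> Hom L \<mu> \<mu>" "y \<in> trace_ideal K outer_meets \<mu> \<mu>" "u = i * p + y"
    using hom_mod_trace_ideal[OF reps(1,1,2) \<nu>(2) ip(1,2)] .
  have "u ^ n \<noteq> 0" for n unfolding u(3) using lifted_idempotent reps \<nu> ip u(2) by blast
  then have "unit_endo L \<mu> u" using \<mu> u(1) by (auto simp: local_rep_def)
  then obtain w where w: "w \<in> Hom L \<mu> \<mu>" "w * u = \<mu> \<one>" by (auto simp: unit_endo_def)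
  have wK: "w \<in> Hom K \<mu> \<mu>" using Hom_mono w KL by blast
  have yK: "y \<in> Hom K \<mu> \<mu>" using trace_ideal_in_Hom u(2) reps subgroups_outer_meets by blast
  have \<alpha>: "p' * w * i \<in> Hom K \<nu> \<nu>'" and \<beta>: "p * i' \<in> Hom K \<nu>' \<nu>" using Hom_mult ip ip' wK by blast+
  have "\<nu>' \<one> = p' * \<mu> \<one> * i'" using ip' Hom_idl[OF ip'(1)] by (simp add: mult.assoc)
  also have "\<dots> = (p' * w * i) * (p * i') + p' * w * y * i'"
    unfolding w(2)[symmetric] u(3) by (simp add: distrib_left distrib_right mult.assoc)
  finally have sum: "\<nu>' \<one> = (p' * w * i) * (p * i') + p' * w * y * i'" .
  have t: "p' * w * y * i' \<in> trace_ideal K outer_meets \<nu>' \<nu>'"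
    using trace_ideal_mult_right[OF trace_ideal_mult_left[OF u(2) K subgroups_outer_meets Hom_mult[OF ip'(2) wK]]
        K subgroups_outer_meets ip'(1)] .
  have "\<not> unit_endo K \<nu>' (p' * w * y * i')"
  proof
    assume "unit_endo K \<nu>' (p' * w * y * i')"
    then obtain z where z: "z \<in> Hom K \<nu>' \<nu>'" "z * (p' * w * y * i') = \<nu>' \<one>" by (auto simp: unit_endo_def)
    then have "\<nu>' \<one> \<in> trace_ideal K outer_meets \<nu>' \<nu>'"
      using trace_ideal_mult_left[OF t K subgroups_outer_meets z(1)] by simp
    then show False using has_vertex_not_in_outer_meets \<nu>' by blast
  qed
  moreover have "unit_endo K \<nu>' (\<nu>' \<one>)"
    using Hom_id[OF reps(3)] Hom_idl[OF Hom_id[OF reps(3)]] by (auto simp: unit_endo_def)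
  ultimately have "unit_endo K \<nu>' ((p' * w * i) * (p * i'))"
    using local_unit_sum[OF \<nu>'(1) Hom_mult[OF \<alpha> \<beta>] trace_ideal_in_Hom[OF t reps(3,3) subgroups_outer_meets]] sum
    by simp
  then show ?thesis
    using retract_of_local_imp_iso[OF reps(3) _ \<nu>(1) \<alpha> \<beta>] \<nu>' by (simp add: local_rep_def)
qed

text \<open>
Lift \<open>i' p\<close> and \<open>i p'\<close> to homomorphisms between \<open>\<mu>\<close> and \<open>\<mu>'\<close> over \<open>L\<close>. Their composite is \<open>i p\<close> up to the
ideal, hence not nilpotent and so a unit.
\<close>

theorem induction_summand_unique:
  assumes \<mu>: "local_rep L \<mu>" "local_rep L \<mu>'" and \<nu>: "local_rep K \<nu>" "has_vertex K H \<nu>"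
    and r: "retract K \<nu> \<mu>" "retract K \<nu> \<mu>'"
  shows "rep_iso L \<mu> \<mu>'"
proof -
  obtain i p where ip: "i \<in> Hom K \<nu> \<mu>" "p \<in> Hom K \<mu> \<nu>" "p * i = \<nu> \<one>" using r by (auto simp: retract_def)
  obtain i' p' where ip': "i' \<in> Hom K \<nu> \<mu>'" "p' \<in> Hom K \<mu>' \<nu>" "p' * i' = \<nu> \<one>"
    using r by (auto simp: retract_def)
  have reps: "rep L \<mu>" "rep L \<mu>'" "rep K \<nu>" "rep K \<mu>" "rep K \<mu>'"
    using \<mu> \<nu> rep_mono K KL by (auto simp: local_rep_def)
  obtain u y where u: "u \<in> Hom L \<mu> \<mu>'" "y \<in> trace_ideal K outer_meets \<mu> \<mu>'" "u = i' * p + y"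
    using hom_mod_trace_ideal[OF reps(1,2,3) \<nu>(2) ip'(1) ip(2)] .
  obtain v z where v: "v \<in> Hom L \<mu>' \<mu>" "z \<in> trace_ideal K outer_meets \<mu>' \<mu>" "v = i * p' + z"
    using hom_mod_trace_ideal[OF reps(2,1,3) \<nu>(2) ip(1) ip'(2)] .
  have uK: "u \<in> Hom K \<mu> \<mu>'" using Hom_mono u KL by blast
  have 1: "i * p' \<in> Hom K \<mu>' \<mu>" using ip ip' Hom_mult by blast
  have "v * u = i * (p' * i') * p + (i * p' * y + z * u)"
    unfolding v(3) by (simp add: distrib_left distrib_right u(3) mult.assoc)
  then have "v * u = i * p + (i * p' * y + z * u)" using ip' Hom_idr[OF ip(1)] by simp
  moreover have "i * p' * y + z * u \<in> trace_ideal K outer_meets \<mu> \<mu>"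
    using trace_ideal_add[OF trace_ideal_mult_left[OF u(2) K subgroups_outer_meets 1]
        trace_ideal_mult_right[OF v(2) K subgroups_outer_meets uK]] .
  ultimately have "(v * u) ^ n \<noteq> 0" for n using lifted_idempotent reps \<nu> ip by metis
  then have "unit_endo L \<mu> (v * u)" using \<mu> Hom_mult[OF v(1) u(1)] by (auto simp: local_rep_def)
  then show ?thesis
    using retract_of_local_imp_iso[OF reps(1) _ \<mu>(2) v(1) u(1)] \<mu> by (simp add: local_rep_def)
qed

text \<open>
The hypothesis on the unit singles out the right summand: the restriction of \<open>\<mu>\<close> may also contain
summands whose vertex is conjugate to \<open>H\<close> in \<open>L\<close> but not in \<open>K\<close>. For these the product of the trace
of \<open>f\<close> and \<open>i p\<close> is a sum of traces from groups smaller than \<open>H\<close>, hence does not yield a unit.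
\<close>

theorem vertex_of_restriction_summand:
  assumes \<mu>: "local_rep L \<mu>" "has_vertex L H \<mu>" and \<nu>: "local_rep K \<nu>"
    and f: "f \<in> Hom H \<mu> \<mu>"
    and i: "i \<in> Hom K \<nu> \<mu>" and p: "p \<in> Hom K \<mu> \<nu>" and pi: "p * i = \<nu> \<one>"
    and u: "unit_endo L \<mu> (rel_trace L K \<mu> \<mu> (rel_trace K H \<mu> \<mu> f * (i * p)))"
  shows "has_vertex K H \<nu>"
proof -
  have reps: "rep L \<mu>" "rep K \<mu>" "rep K \<nu>" using \<mu> \<nu> rep_mono K KL by (auto simp: local_rep_def)
  have fK: "rel_trace K H \<mu> \<mu> f \<in> Hom K \<mu> \<mu>" using rel_trace_in_Hom reps H HK f by blast
  have no: "\<not> rel_proj K Y \<nu>" if Y: "Y \<in> outer_meets" for Y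
  proof
    assume "rel_proj K Y \<nu>"
    then obtain h where h: "h \<in> Hom Y \<nu> \<nu>" "rel_trace K Y \<nu> \<nu> h = \<nu> \<one>" by (auto simp: rel_proj_def)
    have YK: "subgroup Y G" "Y \<subseteq> K" using subgroups_outer_meets Y by (auto simp: subgroups_of_def)
    have ihp: "i * h * p \<in> Hom Y \<mu> \<mu>"
      using Hom_mult h Hom_mono[OF i YK(2)] Hom_mono[OF p YK(2)] by blast
    have "i * p = i * rel_trace K Y \<nu> \<nu> h * p" unfolding h using Hom_idr[OF i] by simp
    also have "\<dots> = rel_trace K Y \<mu> \<mu> (i * h * p)"
      using rel_trace_mult_right[OF K YK p] rel_trace_mult_left[OF K YK i] by simp
    finally have "rel_trace K H \<mu> \<mu> f * (i * p) \<in> trace_ideal K {Y \<inter> conj_subgroup d H | d. d \<in> K} \<mu> \<mu>"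
      using rel_trace_product[OF reps(2,2,2) H HK YK f ihp] by simp
    then have "rel_trace L K \<mu> \<mu> (rel_trace K H \<mu> \<mu> f * (i * p)) \<in> trace_ideal L {Y \<inter> conj_subgroup d H | d. d \<in> K} \<mu> \<mu>"
      using rel_trace_trace_ideal reps K KL subgroups_twice[OF K YK] by blast
    then obtain d where "d \<in> K" "rel_proj L (Y \<inter> conj_subgroup d H) \<mu>"
      using trace_ideal_unit_imp_rel_proj[OF _ \<mu>(1) subgroups_twice[OF L YK(1)] u] YK KL by blast
    then show False using not_rel_proj_double[OF KL reps(1) \<mu>(2) Y] by blast
  qed
  obtain f0 where f0: "f0 \<in> Hom H \<mu> \<mu>" "rel_trace L H \<mu> \<mu> f0 = \<mu> \<one>"
    using \<mu> by (auto simp: has_vertex_def rel_proj_def)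
  obtain y where y: "y \<in> trace_ideal K outer_meets \<mu> \<mu>" "\<mu> \<one> = rel_trace K H \<mu> \<mu> f0 + y"
    using restrict_rel_trace[OF reps(1,1) f0(1)] f0 by metis
  have "\<nu> \<one> = p * \<mu> \<one> * i" using pi Hom_idr[OF p] by simp
  also have "\<dots> = p * rel_trace K H \<mu> \<mu> f0 * i + p * y * i"
    unfolding y(2) by (simp add: distrib_left distrib_right)
  also have "p * rel_trace K H \<mu> \<mu> f0 * i = rel_trace K H \<nu> \<nu> (p * f0 * i)"
    using rel_trace_mult_right[OF K H HK i] rel_trace_mult_left[OF K H HK p] by simp
  finally have sum: "\<nu> \<one> = rel_trace K H \<nu> \<nu> (p * f0 * i) + p * y * i" .
  have pfi: "p * f0 * i \<in> Hom H \<nu> \<nu>"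
    using Hom_mult f0 Hom_mono[OF i HK] Hom_mono[OF p HK] by blast
  have pyi: "p * y * i \<in> trace_ideal K outer_meets \<nu> \<nu>"
    using trace_ideal_mult_right[OF trace_ideal_mult_left[OF y(1) K subgroups_outer_meets p] K subgroups_outer_meets i] .
  have "unit_endo K \<nu> (\<nu> \<one>)"
    using Hom_id[OF reps(3)] Hom_idl[OF Hom_id[OF reps(3)]] by (auto simp: unit_endo_def)
  then have "unit_endo K \<nu> (rel_trace K H \<nu> \<nu> (p * f0 * i)) \<or> unit_endo K \<nu> (p * y * i)"
    using local_unit_sum[OF \<nu> rel_trace_in_Hom[OF reps(3,3) H HK pfi]
        trace_ideal_in_Hom[OF pyi reps(3,3) subgroups_outer_meets]] sum by simp
  moreover have "\<not> unit_endo K \<nu> (p * y * i)"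
    using trace_ideal_unit_imp_rel_proj[OF pyi \<nu> subgroups_outer_meets] no by blast
  ultimately have pr: "rel_proj K H \<nu>" using rel_proj_of_unit[OF K H HK pfi] by blast
  have "Q = H" if Q: "subgroup Q G" "Q \<subseteq> H" "rel_proj K Q \<nu>" for Q
  proof -
    have QK: "Q \<subseteq> K" and QL: "Q \<subseteq> L" using Q HK KL by auto
    obtain h where h: "h \<in> Hom Q \<nu> \<nu>" "rel_trace K Q \<nu> \<nu> h = \<nu> \<one>" using Q by (auto simp: rel_proj_def)
    have ihp: "i * h * p \<in> Hom Q \<mu> \<mu>"
      using Hom_mult h Hom_mono[OF i QK] Hom_mono[OF p QK] by blast
    have "i * p = i * rel_trace K Q \<nu> \<nu> h * p" unfolding h using Hom_idr[OF i] by simp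
    also have "\<dots> = rel_trace K Q \<mu> \<mu> (i * h * p)"
      using rel_trace_mult_right[OF K Q(1) QK p] rel_trace_mult_left[OF K Q(1) QK i] by simp
    finally have "rel_trace K H \<mu> \<mu> f * (i * p) = rel_trace K Q \<mu> \<mu> (rel_trace K H \<mu> \<mu> f * (i * h * p))"
      using rel_trace_mult_left[OF K Q(1) QK fK] by simp
    moreover have g: "rel_trace K H \<mu> \<mu> f * (i * h * p) \<in> Hom Q \<mu> \<mu>"
      using Hom_mult Hom_mono[OF fK QK] ihp by blast
    ultimately have "unit_endo L \<mu> (rel_trace L Q \<mu> \<mu> (rel_trace K H \<mu> \<mu> f * (i * h * p)))"
      using u rel_trace_trans[OF reps(1,1) K KL Q(1) QK] by metis
    then have "rel_proj L Q \<mu>" using rel_proj_of_unit[OF L Q(1) QL g] by blast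
    then show ?thesis using \<mu>(2) Q by (auto simp: has_vertex_def)
  qed
  then show ?thesis unfolding has_vertex_def using pr H HK by blast
qed

text \<open>
Were \<open>\<mu>\<close> projective relative to a smaller \<open>Q\<close>, its restriction and then \<open>\<nu>\<close> would be projective relative
to some \<open>K \<inter> cQc\<inverse>\<close>, which is too small to contain a conjugate of \<open>H\<close>.
\<close>

theorem vertex_of_induction_summand:
  assumes \<mu>: "local_rep L \<mu>" "rel_proj L H \<mu>" and \<nu>: "local_rep K \<nu>" "has_vertex K H \<nu>" and r: "retract K \<nu> \<mu>"
  shows "has_vertex L H \<mu>"
proof -
  obtain i p where ip: "i \<in> Hom K \<nu> \<mu>" "p \<in> Hom K \<mu> \<nu>" "p * i = \<nu> \<one>" using r by (auto simp: retract_def)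
  have reps: "rep L \<mu>" "rep K \<nu>" using \<mu> \<nu> by (auto simp: local_rep_def)
  have "Q = H" if Q: "subgroup Q G" "Q \<subseteq> H" "rel_proj L Q \<mu>" for Q
  proof -
    have QL: "Q \<subseteq> L" using Q HK KL by auto
    define \<Q> where "\<Q> = {K \<inter> conj_subgroup c Q | c. c \<in> L}"
    have s: "subgroups_of K \<Q>" unfolding subgroups_of_def \<Q>_def using Q K LG
      by (auto intro!: subgroups_Inter_pair subgroup_conj_subgroup)
    obtain h where h: "h \<in> Hom Q \<mu> \<mu>" "rel_trace L Q \<mu> \<mu> h = \<mu> \<one>" using Q by (auto simp: rel_proj_def)
    have "\<mu> \<one> \<in> trace_ideal K \<Q> \<mu> \<mu>"
      using mackey[OF reps(1,1) K KL Q(1) QL h(1)] unfolding h \<Q>_def .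
    then have "p * \<mu> \<one> * i \<in> trace_ideal K \<Q> \<nu> \<nu>"
      using trace_ideal_mult_right[OF trace_ideal_mult_left[OF _ K s ip(2)] K s ip(1)] by blast
    then have "\<nu> \<one> \<in> trace_ideal K \<Q> \<nu> \<nu>" using ip Hom_idr[OF ip(2)] by simp
    then obtain c where c: "c \<in> L" "rel_proj K (K \<inter> conj_subgroup c Q) \<nu>"
      using trace_ideal_one_imp_rel_proj \<nu> s unfolding \<Q>_def by blast
    define Y where "Y = K \<inter> conj_subgroup c Q"
    have Y: "subgroup Y G" "Y \<subseteq> K" using s c by (auto simp: subgroups_of_def \<Q>_def Y_def)
    obtain k where k: "k \<in> Hom Y \<nu> \<nu>" "rel_trace K Y \<nu> \<nu> k = \<nu> \<one>" using c by (auto simp: rel_proj_def Y_def)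
    obtain a where a: "a \<in> Hom H \<nu> \<nu>" "rel_trace K H \<nu> \<nu> a = \<nu> \<one>"
      using \<nu> by (auto simp: rel_proj_def has_vertex_def)
    have "\<nu> \<one> * \<nu> \<one> \<in> trace_ideal K {Y \<inter> conj_subgroup d H | d. d \<in> K} \<nu> \<nu>"
      using rel_trace_product[OF reps(2,2,2) H HK Y a(1) k(1)] unfolding a k .
    then have "\<nu> \<one> \<in> trace_ideal K {Y \<inter> conj_subgroup d H | d. d \<in> K} \<nu> \<nu>"
      using Hom_idl[OF Hom_id[OF reps(2)]] by simp
    then obtain d where d: "d \<in> K" "rel_proj K (Y \<inter> conj_subgroup d H) \<nu>"
      using trace_ideal_one_imp_rel_proj[OF _ \<nu>(1) subgroups_twice[OF K Y]] by blast
    have "subgroup (Y \<inter> conj_subgroup d H) G"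
      using Y d H KL LG by (auto intro!: subgroups_Inter_pair subgroup_conj_subgroup)
    then have "Y \<inter> conj_subgroup d H = conj_subgroup d H"
      using has_vertex_conj[OF reps(2) \<nu>(2) _ d(1) _ d(2)] by auto
    then have sub: "conj_subgroup d H \<subseteq> conj_subgroup c Q" by (auto simp: Y_def)
    have G: "H \<subseteq> carrier G" "Q \<subseteq> carrier G" "c \<in> carrier G" "d \<in> carrier G"
      using subgroup.subset[OF H] subgroup.subset[OF Q(1)] c d LG KL by auto
    have "card H = card (conj_subgroup d H)" using G by (simp add: card_conj_subgroup)
    also have "\<dots> \<le> card (conj_subgroup c Q)"
      by (rule card_mono[OF _ sub]) (use finite_subset[OF G(2)] in \<open>auto simp: conj_subgroup_def\<close>)
    also have "\<dots> = card Q" using G by (simp add: card_conj_subgroup)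
    finally show ?thesis using Q(2) G finite_subset[OF G(1)] by (metis card_seteq finite_carrier)
  qed
  then show ?thesis unfolding has_vertex_def using \<mu> H HL by blast
qed

text \<open>
The whole restriction of \<open>\<mu>\<close> satisfies the condition imposed in \<open>vertex_of_restriction_summand\<close>, and
the next lemma passes it on to one of two complementary summands.
\<close>

lemma start_restriction:
  assumes "local_rep L \<mu>" "has_vertex L H \<mu>"
  obtains f where "f \<in> Hom H \<mu> \<mu>" "unit_endo L \<mu> (rel_trace L K \<mu> \<mu> (rel_trace K H \<mu> \<mu> f * (\<mu> \<one> * \<mu> \<one>)))"
proof -
  have reps: "rep L \<mu>" "rep K \<mu>" using assms rep_mono K KL by (auto simp: local_rep_def)
  obtain f where f: "f \<in> Hom H \<mu> \<mu>" "rel_trace L H \<mu> \<mu> f = \<mu> \<one>"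
    using assms by (auto simp: has_vertex_def rel_proj_def)
  have fK: "rel_trace K H \<mu> \<mu> f \<in> Hom K \<mu> \<mu>" using rel_trace_in_Hom reps H HK f by blast
  have "rel_trace K H \<mu> \<mu> f * (\<mu> \<one> * \<mu> \<one>) = rel_trace K H \<mu> \<mu> f"
    using Hom_idr[OF fK] by (simp flip: mult.assoc)
  then have "rel_trace L K \<mu> \<mu> (rel_trace K H \<mu> \<mu> f * (\<mu> \<one> * \<mu> \<one>)) = \<mu> \<one>"
    using rel_trace_trans[OF reps(1,1) K KL H HK f(1)] f by simp
  moreover have "unit_endo L \<mu> (\<mu> \<one>)"
    using Hom_id[OF reps(1)] Hom_idl[OF Hom_id[OF reps(1)]] by (auto simp: unit_endo_def)
  ultimately show ?thesis using that f by metis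
qed

lemma split_restriction:
  assumes \<mu>: "local_rep L \<mu>" and f: "f \<in> Hom H \<mu> \<mu>"
    and e: "e \<in> Hom K \<mu> \<mu>" "e' \<in> Hom K \<mu> \<mu>"
    and u: "unit_endo L \<mu> (rel_trace L K \<mu> \<mu> (rel_trace K H \<mu> \<mu> f * (e + e')))"
  shows "unit_endo L \<mu> (rel_trace L K \<mu> \<mu> (rel_trace K H \<mu> \<mu> f * e)) \<or> unit_endo L \<mu> (rel_trace L K \<mu> \<mu> (rel_trace K H \<mu> \<mu> f * e'))"
proof -
  have reps: "rep L \<mu>" "rep K \<mu>" using assms rep_mono K KL by (auto simp: local_rep_def)
  have fK: "rel_trace K H \<mu> \<mu> f \<in> Hom K \<mu> \<mu>" using rel_trace_in_Hom reps H HK f by blast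
  have "rel_trace L K \<mu> \<mu> (rel_trace K H \<mu> \<mu> f * a) \<in> Hom L \<mu> \<mu>" if "a \<in> Hom K \<mu> \<mu>" for a
    using rel_trace_in_Hom reps K KL Hom_mult fK that by blast
  then show ?thesis using local_unit_sum[OF \<mu>] e u by (simp add: distrib_left rel_trace_add)
qed

end

section \<open>Finite-dimensional spaces and their endomorphisms\<close>

lemma fd_space_subspace: "fd_space V \<Longrightarrow> seqs.subspace V"
  unfolding fd_space_def using seqs.subspace_span by blast

lemma independent_in_fd_finite:
  assumes "fd_space V" "B \<subseteq> V" "seqs.independent B" shows "finite B"
  using assms seqs.independent_span_bound unfolding fd_space_def by blast

lemma fd_basis:
  assumes "fd_space V"
  obtains B where "B \<subseteq> V" "seqs.independent B" "seqs.span B = V" "finite B" "card B = seqs.dim V"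
proof -
  obtain B where B: "B \<subseteq> V" "seqs.independent B" "V \<subseteq> seqs.span B" "card B = seqs.dim V"
    using seqs.basis_exists[of V] .
  have "seqs.span B \<subseteq> V" using seqs.span_minimal[OF B(1) fd_space_subspace[OF assms]] .
  then have "seqs.span B = V" using B(3) by (rule equalityI)
  then show ?thesis using that[OF B(1,2) _ independent_in_fd_finite[OF assms B(1,2)] B(4)] by blast
qed

lemma fd_space_sub:
  assumes "fd_space V" "seqs.subspace U" "U \<subseteq> V" shows "fd_space U"
proof -
  obtain B where B: "B \<subseteq> U" "seqs.independent B" "U \<subseteq> seqs.span B"
    using seqs.basis_exists[of U] .
  then have "seqs.span B = U" using seqs.span_minimal[OF B(1) assms(2)] by simp
  moreover have "finite B" using independent_in_fd_finite[OF assms(1) _ B(2)] B(1) assms(3) by simp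
  ultimately show ?thesis unfolding fd_space_def by blast
qed

lemma fd_dim_mono:
  assumes V: "fd_space V" and U: "seqs.subspace U" "U \<subseteq> V"
  shows "seqs.dim U \<le> seqs.dim V"
proof -
  obtain B where B: "seqs.span B = V" "finite B" "card B = seqs.dim V" using fd_basis[OF V] by blast
  obtain B' where B': "B' \<subseteq> U" "seqs.independent B'" "card B' = seqs.dim U"
    using fd_basis[OF fd_space_sub[OF V U]] by blast
  have "B' \<subseteq> seqs.span B" using B B' U by blast
  then show ?thesis using seqs.independent_span_bound[OF B(2) B'(2)] B B' by simp
qed

text \<open>
The ambient space of all sequences has infinite dimension, so dimension arguments have to be made
inside a given finite-dimensional subspace.
\<close>

lemma fd_dim_eq:
  assumes V: "fd_space V" and U: "seqs.subspace U" "U \<subseteq> V" and d: "seqs.dim V \<le> seqs.dim U"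
  shows "U = V"
proof (rule ccontr)
  assume "U \<noteq> V"
  then obtain v where v: "v \<in> V" "v \<notin> U" using U by blast
  obtain B where B: "seqs.span B = V" "finite B" "card B = seqs.dim V" using fd_basis[OF V] by blast
  obtain B' where B': "B' \<subseteq> U" "seqs.independent B'" "seqs.span B' = U" "finite B'" "card B' = seqs.dim U"
    using fd_basis[OF fd_space_sub[OF V U]] by blast
  have i: "seqs.independent (insert v B')" using B' v seqs.independent_insertI by blast
  have "insert v B' \<subseteq> seqs.span B" using B B' U v by blast
  then have "card (insert v B') \<le> card B" using seqs.independent_span_bound[OF B(2) i] by simp
  moreover have "v \<notin> B'" using v B' by blast
  ultimately show False using B B' d by simp
qed

lemma lin_map_zero:
  assumes "lin_map V W f" "seqs.subspace V" shows "f 0 = 0"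
proof -
  have "f (seq_scale 0 0) = seq_scale 0 (f 0)"
    using assms seqs.subspace_0 unfolding lin_map_def by blast
  then show ?thesis by (simp add: seq_scale_def fun_eq_iff zero_fun_def)
qed

lemma lin_map_comp: "lin_map U V f \<Longrightarrow> lin_map V W g \<Longrightarrow> lin_map U W (\<lambda>v. g (f v))"
  unfolding lin_map_def by auto

lemma lin_map_image_subspace:
  assumes f: "lin_map V W f" and U: "seqs.subspace U" "U \<subseteq> V"
  shows "seqs.subspace (f ` U)"
proof -
  have "f 0 = 0"
  proof -
    have "0 \<in> V" using U seqs.subspace_0 by blast
    then have "f (seq_scale 0 0) = seq_scale 0 (f 0)" using f unfolding lin_map_def by blast
    then show ?thesis by (simp add: seq_scale_def fun_eq_iff zero_fun_def)
  qed
  show ?thesis unfolding seqs.subspace_def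
  proof (intro conjI ballI allI)
    show "0 \<in> f ` U" using \<open>f 0 = 0\<close> seqs.subspace_0[OF U(1)] by force
    fix x y assume "x \<in> f ` U" "y \<in> f ` U"
    then obtain u v where uv: "u \<in> U" "v \<in> U" "x = f u" "y = f v" by blast
    then have "u \<in> V" "v \<in> V" using U(2) by auto
    then have "x + y = f (u + v)" using f uv by (simp add: lin_map_def)
    then show "x + y \<in> f ` U" using uv seqs.subspace_add[OF U(1)] by blast
  next
    fix c x assume "x \<in> f ` U"
    then obtain u where u: "u \<in> U" "x = f u" by blast
    then have "u \<in> V" using U(2) by auto
    then have "seq_scale c x = f (seq_scale c u)" using f u by (simp add: lin_map_def)
    then show "seq_scale c x \<in> f ` U" using u seqs.subspace_scale[OF U(1)] by blast
  qed
qed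

text \<open>
Linear endomorphisms of the space of all sequences form the ring in which the modules at hand are
represented.
A representation on a subspace \<open>V\<close> becomes one in this ring by composing with a projection onto \<open>V\<close>,
which then is the identity \<open>\<rho> \<one>\<close> of the representation.
\<close>

typedef (overloaded) 'k endo =
  "{f :: (nat \<Rightarrow> 'k::field) \<Rightarrow> nat \<Rightarrow> 'k. lin_map UNIV UNIV f}"
  morphisms app Endo
  by (rule exI[of _ "\<lambda>v. v"]) (simp add: lin_map_def)

lemma app_add [simp]: "app f (u + v) = app f u + app f v"
  and app_scale: "app f (seq_scale c v) = seq_scale c (app f v)"
  using app[of f] by (auto simp: lin_map_def)

lemma app_0 [simp]: "app f 0 = 0"
  using app[of f] lin_map_zero[of UNIV UNIV] by (simp add: seqs.subspace_UNIV)

lemma app_lin_map: "(\<And>v. v \<in> V \<Longrightarrow> app f v \<in> W) \<Longrightarrow> lin_map V W (app f)"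
  by (simp add: lin_map_def app_scale)

lemma app_Endo: "lin_map UNIV UNIV f \<Longrightarrow> app (Endo f) = f"
  by (simp add: Endo_inverse)

lemma endo_eqI: "(\<And>v. app f v = app g v) \<Longrightarrow> f = g"
  by (metis app_inject ext)

instantiation endo :: (field) ring_1
begin

definition "0 = Endo (\<lambda>v. 0)"
definition "1 = Endo (\<lambda>v. v)"
definition "f + g = Endo (\<lambda>v. app f v + app g v)"
definition "f - g = Endo (\<lambda>v. app f v - app g v)"
definition "- f = Endo (\<lambda>v. - app f v)"
definition "f * g = Endo (\<lambda>v. app f (app g v))"

lemma app_zero_endo [simp]: "app 0 v = 0"
  by (simp add: zero_endo_def app_Endo lin_map_def seq_scale_def fun_eq_iff)

lemma app_one_endo [simp]: "app 1 v = v"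
  by (simp add: one_endo_def app_Endo lin_map_def)

lemma app_plus_endo [simp]: "app (f + g) v = app f v + app g v"
proof -
  have "lin_map UNIV UNIV (\<lambda>v. app f v + app g v)"
    by (simp add: lin_map_def app_scale seqs.scale_right_distrib add.assoc add.left_commute)
  then show ?thesis by (simp add: plus_endo_def app_Endo)
qed

lemma app_minus_endo [simp]: "app (f - g) v = app f v - app g v"
proof -
  have "lin_map UNIV UNIV (\<lambda>v. app f v - app g v)"
    by (simp add: lin_map_def app_scale seqs.scale_right_diff_distrib)
  then show ?thesis by (simp add: minus_endo_def app_Endo)
qed

lemma app_uminus_endo [simp]: "app (- f) v = - app f v"
proof -
  have "lin_map UNIV UNIV (\<lambda>v. - app f v)"
    by (simp add: lin_map_def app_scale)
  then show ?thesis by (simp add: uminus_endo_def app_Endo)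
qed

lemma app_times_endo [simp]: "app (f * g) v = app f (app g v)"
  by (simp add: times_endo_def app_Endo lin_map_def app_scale)

instance
proof
  show "(0::'a endo) \<noteq> 1"
  proof
    assume "(0::'a endo) = 1"
    then have "app (0::'a endo) (\<lambda>_. 1) = app 1 (\<lambda>_. 1)" by simp
    then show False by (simp add: fun_eq_iff)
  qed
qed (rule endo_eqI; simp add: algebra_simps)+

end

lemma app_sum: "app (sum f I) v = (\<Sum>i\<in>I. app (f i) v)"
  by (induction I rule: infinite_finite_induct) auto

lemma app_diff [simp]: "app f (u - v) = app f u - app f v"
proof -
  have "app f (u - v) + app f v = app f u" using app_add[of f "u - v" v] by simp
  then show ?thesis by (simp add: eq_diff_eq)
qed

definition proj_onto :: "(nat \<Rightarrow> 'k::field) set \<Rightarrow> 'k endo" where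
  "proj_onto V = (SOME e. (\<forall>v. app e v \<in> V) \<and> (\<forall>v\<in>V. app e v = v))"

lemma proj_onto:
  fixes V :: "(nat \<Rightarrow> 'k::field) set"
  assumes "seqs.subspace V"
  shows "app (proj_onto V) v \<in> V" "v \<in> V \<Longrightarrow> app (proj_onto V) v = v"
proof -
  interpret vector_space_pair "seq_scale :: 'k::field \<Rightarrow> _" "seq_scale :: 'k \<Rightarrow> _"
    by unfold_locales
  have "Vector_Spaces.linear seq_scale seq_scale (\<lambda>v::nat \<Rightarrow> 'k. v)"
    by (simp add: seqs.linear_ident)
  from linear_exists_left_inverse_on[OF this assms]
  obtain g where g: "g ` UNIV \<subseteq> V" "Vector_Spaces.linear seq_scale seq_scale g" "\<forall>v\<in>V. g v = v"
    by (metis inj_on_id2)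
  interpret g: Vector_Spaces.linear seq_scale seq_scale g by fact
  have "lin_map UNIV UNIV g" by (simp add: lin_map_def g.add g.scale)
  then have "app (Endo g) = g" by (rule app_Endo)
  then have "\<exists>e. (\<forall>v. app e v \<in> V) \<and> (\<forall>v\<in>V. app e v = v)"
    using g by (intro exI[of _ "Endo g"]) auto
  from someI_ex[OF this] show "app (proj_onto V) v \<in> V" "v \<in> V \<Longrightarrow> app (proj_onto V) v = v"
    unfolding proj_onto_def by auto
qed

definition as_endo :: "(nat \<Rightarrow> 'k::field) set \<Rightarrow> ((nat \<Rightarrow> 'k) \<Rightarrow> nat \<Rightarrow> 'k) \<Rightarrow> 'k endo" where
  "as_endo V f = Endo (\<lambda>v. f (app (proj_onto V) v))"

lemma app_as_endo:
  assumes "seqs.subspace V" "lin_map V W f"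
  shows "app (as_endo V f) v = f (app (proj_onto V) v)"
proof -
  have "lin_map UNIV UNIV (\<lambda>v. f (app (proj_onto V) v))"
    using lin_map_comp[OF app_lin_map[of UNIV "proj_onto V" V] assms(2)] proj_onto[OF assms(1)]
    by (auto simp: lin_map_def)
  then show ?thesis unfolding as_endo_def by (simp add: app_Endo)
qed

lemma app_as_endo_on:
  "seqs.subspace V \<Longrightarrow> lin_map V W f \<Longrightarrow> v \<in> V \<Longrightarrow> app (as_endo V f) v = f v"
  by (simp add: app_as_endo proj_onto)

lemma as_endo_proj_onto:
  "seqs.subspace V \<Longrightarrow> lin_map V W f \<Longrightarrow> as_endo V f * proj_onto V = as_endo V f"
  by (rule endo_eqI) (simp add: app_as_endo proj_onto)

lemma endo_eq_on:
  assumes V: "seqs.subspace V" and "f * proj_onto V = f" "g * proj_onto V = g"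
    and eq: "\<And>v. v \<in> V \<Longrightarrow> app f v = app g v"
  shows "f = g"
proof (rule endo_eqI)
  fix v
  have "app f v = app f (app (proj_onto V) v)" using assms by (metis app_times_endo)
  also have "\<dots> = app g (app (proj_onto V) v)" using eq proj_onto[OF V] by blast
  also have "\<dots> = app g v" using assms by (metis app_times_endo)
  finally show "app f v = app g v" .
qed

text \<open>
The decreasing chain of images and the increasing chain of kernels of powers of \<open>f\<close> both become
stationary; beyond that point image and kernel are complements.
\<close>

lemma fitting:
  assumes V: "fd_space V" and f: "\<And>v. v \<in> V \<Longrightarrow> app f v \<in> V"
  obtains n where "n > 0"
    "\<And>v. v \<in> V \<Longrightarrow> \<exists>u\<in>V. \<exists>w\<in>V. v = u + app (f ^ n) w \<and> app (f ^ n) u = 0"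
    "\<And>v. v \<in> V \<Longrightarrow> app (f ^ n) (app (f ^ n) v) = 0 \<Longrightarrow> app (f ^ n) v = 0"
proof -
  define I where "I n = app (f ^ n) ` V" for n
  define Z where "Z n = {v \<in> V. app (f ^ n) v = 0}" for n
  have fn: "app (f ^ n) v \<in> V" if "v \<in> V" for n v
    using that by (induction n) (auto intro: f)
  have sV: "seqs.subspace V" using fd_space_subspace[OF V] .
  have sI: "seqs.subspace (I n)" "I n \<subseteq> V" for n
    unfolding I_def using lin_map_image_subspace[OF app_lin_map[of V "f ^ n" V] sV] fn by auto
  have sZ: "seqs.subspace (Z n)" "Z n \<subseteq> V" for n
    unfolding Z_def seqs.subspace_def
    using seqs.subspace_0[OF sV] seqs.subspace_add[OF sV] seqs.subspace_scale[OF sV]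
    by (auto simp: app_scale)
  have I_mono: "I (m + n) \<subseteq> I n" for m n
  proof -
    have "app (f ^ (m + n)) v = app (f ^ n) (app (f ^ m) v)" for v
      by (simp add: power_add[of f n m] add.commute[of m n])
    then show ?thesis unfolding I_def using fn by auto
  qed
  have Z_mono: "Z n \<subseteq> Z (m + n)" for m n
    unfolding Z_def by (auto simp: power_add)
  obtain a where a: "\<And>m. seqs.dim (I a) \<le> seqs.dim (I m)"
    using ex_has_least_nat[of "\<lambda>_. True" 0 "\<lambda>n. seqs.dim (I n)"] by blast
  have Ieq: "I n = I a" if "n \<ge> a" for n
    using fd_dim_eq[OF fd_space_sub[OF V sI] sI(1), of n a] I_mono[of "n - a" a] a that by simp
  obtain b where b: "\<And>m. seqs.dim V - seqs.dim (Z b) \<le> seqs.dim V - seqs.dim (Z m)"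
    using ex_has_least_nat[of "\<lambda>_. True" 0 "\<lambda>n. seqs.dim V - seqs.dim (Z n)"] by blast
  have Zeq: "Z n = Z b" if "n \<ge> b" for n
  proof -
    have "seqs.dim (Z n) \<le> seqs.dim (Z b)"
      using b[of n] fd_dim_mono[OF V sZ, of b] fd_dim_mono[OF V sZ, of n] by linarith
    then show ?thesis
      using fd_dim_eq[OF fd_space_sub[OF V sZ] sZ(1), of b n] Z_mono[of b "n - b"] that by auto
  qed
  \<comment> \<open>The summand 1 gives a positive exponent, as the lemma promises.\<close>
  define n where "n = a + b + 1"
  have I2: "I (n + n) = I n" and Z2: "Z (n + n) = Z n"
  proof -
    have "a \<le> n" "a \<le> n + n" "b \<le> n" "b \<le> n + n" by (simp_all add: n_def)
    then show "I (n + n) = I n" "Z (n + n) = Z n" by (metis Ieq, metis Zeq)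
  qed
  have "\<exists>u\<in>V. \<exists>w\<in>V. v = u + app (f ^ n) w \<and> app (f ^ n) u = 0" if "v \<in> V" for v
  proof -
    have "app (f ^ n) v \<in> I (n + n)" using that I2 by (auto simp: I_def)
    then obtain w where w: "w \<in> V" "app (f ^ n) v = app (f ^ n) (app (f ^ n) w)"
      by (auto simp: I_def power_add)
    have "v - app (f ^ n) w \<in> V" using that fn[OF w(1)] seqs.subspace_diff[OF sV] by blast
    then show ?thesis using w by (intro bexI[of _ "v - app (f ^ n) w"] bexI[of _ w]) auto
  qed
  moreover have "app (f ^ n) v = 0" if "v \<in> V" "app (f ^ n) (app (f ^ n) v) = 0" for v
  proof -
    have "v \<in> Z (n + n)" using that by (simp add: Z_def power_add)
    then show ?thesis unfolding Z2 by (simp add: Z_def)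
  qed
  ultimately show ?thesis using that[of n] by (simp add: n_def)
qed

section \<open>Decomposition of modules\<close>

lemma transporter_simps [simp]:
  "Obj (transporter G r \<phi> Q H) = Q"
  "Dom (transporter G r \<phi> Q H) (y, g, z) = y"
  "Cod (transporter G r \<phi> Q H) (y, g, z) = z"
  "Ide (transporter G r \<phi> Q H) y = (y, \<one>\<^bsub>G\<^esub>, y)"
  "Cmp (transporter G r \<phi> Q H) (z, g, w) (y, h, z') = (y, g \<otimes>\<^bsub>G\<^esub> h, w)"
  "(y, g, z) \<in> Arr (transporter G r \<phi> Q H) \<longleftrightarrow> y \<in> Q \<and> g \<in> H \<and> z \<in> Q \<and> (\<phi> g y, z) \<in> r"
  by (auto simp: transporter_def)

lemma ball_Arr_transporter:
  "(\<forall>a\<in>Arr (transporter G r \<phi> Q H). R a) \<longleftrightarrow>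
    (\<forall>y\<in>Q. \<forall>g\<in>H. \<forall>z\<in>Q. (\<phi> g y, z) \<in> r \<longrightarrow> R (y, g, z))"
  by (auto simp: transporter_def)

definition direct_sum ::
  "('o, 'a) cat \<Rightarrow> ('o, 'a, 'k::field) kmod \<Rightarrow> ('o \<Rightarrow> (nat \<Rightarrow> 'k) set) \<Rightarrow> ('o \<Rightarrow> (nat \<Rightarrow> 'k) set) \<Rightarrow> bool" where
  "direct_sum C M U W \<longleftrightarrow> is_submodule C M U \<and> is_submodule C M W \<and>
        (\<forall>x\<in>Obj C. Spc M x = {u + w | u w. u \<in> U x \<and> w \<in> W x} \<and> U x \<inter> W x = {0})"

lemma submodule_is_module:
  assumes M: "is_module C M" and U: "is_submodule C M U"
    and C: "\<And>a. a \<in> Arr C \<Longrightarrow> Dom C a \<in> Obj C \<and> Cod C a \<in> Obj C"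
  shows "is_module C (M\<lparr>Spc := U\<rparr>)"
proof -
  have sub: "U y \<subseteq> Spc M y" if "y \<in> Obj C" for y using U that by (auto simp: is_submodule_def)
  have "fd_space (U y)" if "y \<in> Obj C" for y
    using M U that fd_space_sub[of "Spc M y" "U y"] by (auto simp: is_submodule_def is_module_def)
  moreover have "lin_map (U (Dom C a)) (U (Cod C a)) (Map M a)" if "a \<in> Arr C" for a
  proof -
    have "lin_map (Spc M (Dom C a)) (Spc M (Cod C a)) (Map M a)"
      using M that by (simp add: is_module_def)
    moreover have "\<forall>u\<in>U (Dom C a). Map M a u \<in> U (Cod C a)"
      using U that by (simp add: is_submodule_def)
    ultimately show ?thesis using sub[of "Dom C a"] C[OF that] by (simp add: lin_map_def subset_iff)
  qed
  ultimately show ?thesis using M sub C unfolding is_module_def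
    by (simp add: subset_iff)
qed

lemma direct_sum_commute: "direct_sum C M U W \<Longrightarrow> direct_sum C M W U"
proof -
  assume d: "direct_sum C M U W"
  have "{u + w |u w. u \<in> U x \<and> w \<in> W x} = {u + w |u w. u \<in> W x \<and> w \<in> U x}" for x
    by (metis (no_types, opaque_lifting) add.commute)
  then show ?thesis using d by (auto simp: direct_sum_def)
qed

lemma indecomposable_iff:
  "indecomposable C M \<longleftrightarrow> is_module C M \<and> (\<exists>x\<in>Obj C. Spc M x \<noteq> {0}) \<and>
     (\<forall>U W. direct_sum C M U W \<longrightarrow> (\<forall>x\<in>Obj C. U x = {0}) \<or> (\<forall>x\<in>Obj C. W x = {0}))"
  unfolding indecomposable_def direct_sum_def by auto

text \<open>
A module of least total dimension with the property \<open>\<Phi>\<close> has no proper direct summand with this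
property. If the property passes to one of any two complementary summands, this module is
indecomposable.
\<close>

lemma exists_indecomposable:
  assumes fin: "finite (Obj C)"
    and C: "\<And>a. a \<in> Arr C \<Longrightarrow> Dom C a \<in> Obj C \<and> Cod C a \<in> Obj C"
    and M: "is_module C M" "\<Phi> M"
    and nz: "\<And>M. is_module C M \<Longrightarrow> \<Phi> M \<Longrightarrow> \<exists>x\<in>Obj C. Spc M x \<noteq> {0}"
    and split: "\<And>M U W. is_module C M \<Longrightarrow> \<Phi> M \<Longrightarrow> direct_sum C M U W \<Longrightarrow>
      \<Phi> (M\<lparr>Spc := U\<rparr>) \<or> \<Phi> (M\<lparr>Spc := W\<rparr>)"
  obtains N where "indecomposable C N" "\<Phi> N"
proof -
  define d where "d M = (\<Sum>y\<in>Obj C. seqs.dim (Spc M y))" for M :: "('a, 'b, 'c) kmod"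
  obtain N where N: "is_module C N" "\<Phi> N" and least: "\<And>N'. is_module C N' \<Longrightarrow> \<Phi> N' \<Longrightarrow> d N \<le> d N'"
    using ex_has_least_nat[of "\<lambda>M. is_module C M \<and> \<Phi> M" M d] M by blast
  have key: "\<forall>x\<in>Obj C. W x = {0}" if ds: "direct_sum C N U W" and \<Phi>: "\<Phi> (N\<lparr>Spc := U\<rparr>)" for U W
  proof -
    have sub: "is_submodule C N U" "is_submodule C N W" using ds by (auto simp: direct_sum_def)
    have U: "seqs.subspace (U y)" "U y \<subseteq> Spc N y" "fd_space (Spc N y)" if "y \<in> Obj C" for y
      using sub(1) that N(1) by (auto simp: is_submodule_def is_module_def)
    have "is_module C (N\<lparr>Spc := U\<rparr>)" using submodule_is_module N sub C by blast
    then have "d N \<le> (\<Sum>y\<in>Obj C. seqs.dim (U y))" using least \<Phi> by (fastforce simp: d_def)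
    moreover have "seqs.dim (U y) \<le> seqs.dim (Spc N y)" if "y \<in> Obj C" for y
      using U[OF that] fd_dim_mono by blast
    ultimately have "seqs.dim (Spc N y) \<le> seqs.dim (U y)" if "y \<in> Obj C" for y
      using that fin sum_strict_mono_ex1[of "Obj C" "\<lambda>y. seqs.dim (U y)" "\<lambda>y. seqs.dim (Spc N y)"]
      unfolding d_def by (meson leD leI)
    then have eq: "U y = Spc N y" if "y \<in> Obj C" for y
      using fd_dim_eq U that by blast
    show ?thesis
    proof
      fix y assume y: "y \<in> Obj C"
      have "W y \<subseteq> Spc N y" using sub(2) y by (auto simp: is_submodule_def)
      moreover have "U y \<inter> W y = {0}" using ds y by (simp add: direct_sum_def)
      ultimately show "W y = {0}" using eq[OF y] by blast
    qed
  qed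
  have "(\<forall>x\<in>Obj C. U x = {0}) \<or> (\<forall>x\<in>Obj C. W x = {0})" if "direct_sum C N U W" for U W
    using split[OF N that] key[OF that] key[OF direct_sum_commute[OF that]] by blast
  then have "indecomposable C N" unfolding indecomposable_iff using N nz by blast
  then show ?thesis using that N by blast
qed

section \<open>Representations carried by modules\<close>

definition mrep :: "('x, 'x \<times> 'g \<times> 'x, 'k::field) kmod \<Rightarrow> 'x \<Rightarrow> 'g \<Rightarrow> 'k endo" where
  "mrep M x g = as_endo (Spc M x) (Map M (x, g, x))"

text \<open>
By reflexivity of the order at \<open>x\<close> every group element fixing \<open>x\<close> is a morphism, so that modules
over the transporter category of such a group on \<open>{x}\<close> are group representations.
\<close>

locale fixed_point = finite_group G for G (structure) +
  fixes r :: "('x \<times> 'x) set" and \<phi> :: "'a \<Rightarrow> 'x \<Rightarrow> 'x" and x :: 'x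
  assumes refl_x: "(x, x) \<in> r"
begin

abbreviation pt :: "'a set \<Rightarrow> ('x, 'x \<times> 'a \<times> 'x) cat" where
  "pt B \<equiv> transporter G r \<phi> {x} B"

definition fixing :: "'a set \<Rightarrow> bool" where
  "fixing B \<longleftrightarrow> subgroup B G \<and> (\<forall>b\<in>B. \<phi> b x = x)"

lemma pt_module_iff:
  assumes "fixing B"
  shows "is_module (pt B) M \<longleftrightarrow> fd_space (Spc M x) \<and>
    (\<forall>b\<in>B. lin_map (Spc M x) (Spc M x) (Map M (x, b, x))) \<and>
    (\<forall>v\<in>Spc M x. Map M (x, \<one>, x) v = v) \<and>
    (\<forall>a\<in>B. \<forall>b\<in>B. \<forall>v\<in>Spc M x. Map M (x, a \<otimes> b, x) v = Map M (x, a, x) (Map M (x, b, x) v))"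
  unfolding is_module_def ball_Arr_transporter using assms refl_x by (simp add: fixing_def)

lemma pt_module_mono:
  "is_module (pt B) M \<Longrightarrow> fixing B \<Longrightarrow> fixing B' \<Longrightarrow> B' \<subseteq> B \<Longrightarrow> is_module (pt B') M"
  unfolding pt_module_iff by blast

lemma pt_hom_iff:
  assumes "fixing B"
  shows "mod_hom (pt B) M N \<theta> \<longleftrightarrow> lin_map (Spc M x) (Spc N x) (\<theta> x) \<and>
    (\<forall>b\<in>B. \<forall>v\<in>Spc M x. \<theta> x (Map M (x, b, x) v) = Map N (x, b, x) (\<theta> x v))"
  unfolding mod_hom_def ball_Arr_transporter using assms refl_x by (simp add: fixing_def)

context
  fixes B :: "'a set" and M :: "('x, 'x \<times> 'a \<times> 'x, 'k::field) kmod"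
  assumes B: "fixing B" and M: "is_module (pt B) M"
begin

lemma subspace_pt: "seqs.subspace (Spc M x)"
  using M B fd_space_subspace[of "Spc M x"] by (simp add: pt_module_iff)

lemma lin_map_pt: "b \<in> B \<Longrightarrow> lin_map (Spc M x) (Spc M x) (Map M (x, b, x))"
  using M B by (simp add: pt_module_iff)

lemma app_mrep: "b \<in> B \<Longrightarrow> app (mrep M x b) v = Map M (x, b, x) (app (proj_onto (Spc M x)) v)"
  unfolding mrep_def using app_as_endo[OF subspace_pt lin_map_pt] .

lemma app_mrep_on: "b \<in> B \<Longrightarrow> v \<in> Spc M x \<Longrightarrow> app (mrep M x b) v = Map M (x, b, x) v"
  by (simp add: app_mrep proj_onto subspace_pt)

lemma Map_pt_closed: "b \<in> B \<Longrightarrow> v \<in> Spc M x \<Longrightarrow> Map M (x, b, x) v \<in> Spc M x"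
  using lin_map_pt by (auto simp: lin_map_def)

lemma one_B: "\<one> \<in> B" using B subgroup.one_closed by (auto simp: fixing_def)

lemma mrep_one: "mrep M x \<one> = proj_onto (Spc M x)"
  using M B one_B by (intro endo_eqI) (simp add: app_mrep proj_onto subspace_pt pt_module_iff)

lemma rep_mrep: "rep B (mrep M x)"
  unfolding rep_def
proof (intro conjI ballI)
  show "subgroup B G" using B by (simp add: fixing_def)
  fix g h assume gh: "g \<in> B" "h \<in> B"
  then have "g \<otimes> h \<in> B" using B subgroup.m_closed by (auto simp: fixing_def)
  then show "mrep M x (g \<otimes> h) = mrep M x g * mrep M x h"
    using M B gh by (intro endo_eqI)
      (simp add: app_mrep proj_onto subspace_pt pt_module_iff Map_pt_closed)
qed

end

lemma Hom_mrep_iff: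
  assumes B: "fixing B" and M: "is_module (pt B) M" and N: "is_module (pt B) N"
  shows "f \<in> Hom B (mrep M x) (mrep N x) \<longleftrightarrow> f * proj_onto (Spc M x) = f \<and>
    (\<forall>v\<in>Spc M x. app f v \<in> Spc N x) \<and>
    (\<forall>b\<in>B. \<forall>v\<in>Spc M x. app f (Map M (x, b, x) v) = Map N (x, b, x) (app f v))"
    (is "?l \<longleftrightarrow> ?r")
proof
  note sM = subspace_pt[OF B M] and sN = subspace_pt[OF B N]
  assume f: ?l
  have 1: "proj_onto (Spc N x) * f = f" "f * proj_onto (Spc M x) = f"
    using f by (simp_all add: Hom_def mrep_one[OF B M] mrep_one[OF B N])
  have 2: "app f v \<in> Spc N x" for v using proj_onto(1)[OF sN] 1(1) by (metis app_times_endo)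
  have "app f (Map M (x, b, x) v) = Map N (x, b, x) (app f v)" if "b \<in> B" "v \<in> Spc M x" for b v
  proof -
    have "app (mrep N x b * f) v = app (f * mrep M x b) v" using f that by (simp add: Hom_def)
    then show ?thesis using that 2 by (simp add: app_mrep_on[OF B M] app_mrep_on[OF B N])
  qed
  then show ?r using 1 2 by blast
next
  note sM = subspace_pt[OF B M] and sN = subspace_pt[OF B N]
  assume r: ?r
  have fp: "app f (app (proj_onto (Spc M x)) v) = app f v" for v using r by (metis app_times_endo)
  then have 2: "app f v \<in> Spc N x" for v using r proj_onto(1)[OF sM] by metis
  have "mrep N x \<one> * f = f"
    by (rule endo_eqI) (simp add: mrep_one[OF B N] proj_onto[OF sN] 2)
  moreover have "f * mrep M x \<one> = f" using r by (simp add: mrep_one[OF B M])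
  moreover have "mrep N x b * f = f * mrep M x b" if b: "b \<in> B" for b
  proof (rule endo_eqI)
    fix v
    have "app (mrep N x b * f) v = Map N (x, b, x) (app f (app (proj_onto (Spc M x)) v))"
      using b 2 fp by (simp add: app_mrep_on[OF B N])
    also have "\<dots> = app f (Map M (x, b, x) (app (proj_onto (Spc M x)) v))"
      using r b proj_onto(1)[OF sM] by simp
    finally show "app (mrep N x b * f) v = app (f * mrep M x b) v"
      using b by (simp add: app_mrep[OF B M])
  qed
  ultimately show ?l by (simp add: Hom_def)
qed

lemma as_endo_in_Hom:
  assumes B: "fixing B" and M: "is_module (pt B) M" and N: "is_module (pt B) N"
    and f: "lin_map (Spc M x) (Spc N x) f"
    and eq: "\<And>b v. b \<in> B \<Longrightarrow> v \<in> Spc M x \<Longrightarrow> f (Map M (x, b, x) v) = Map N (x, b, x) (f v)"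
  shows "as_endo (Spc M x) f \<in> Hom B (mrep M x) (mrep N x)"
proof -
  note sM = subspace_pt[OF B M]
  show ?thesis unfolding Hom_mrep_iff[OF B M N]
    using as_endo_proj_onto[OF sM f] app_as_endo_on[OF sM f] f eq Map_pt_closed[OF B M]
    by (simp add: lin_map_def)
qed

lemma Hom_eqI:
  assumes B: "fixing B" and M: "is_module (pt B) M" and N: "is_module (pt B) N"
    and "f \<in> Hom B (mrep M x) (mrep N x)" "g \<in> Hom B (mrep M x) (mrep N x)"
    and "\<And>v. v \<in> Spc M x \<Longrightarrow> app f v = app g v"
  shows "f = g"
  using assms endo_eq_on[OF subspace_pt[OF B M], of f g] by (simp add: Hom_mrep_iff)

lemma Hom_app:
  assumes B: "fixing B" and M: "is_module (pt B) M" and N: "is_module (pt B) N"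
    and f: "f \<in> Hom B (mrep M x) (mrep N x)"
  shows "lin_map (Spc M x) (Spc N x) (app f)"
    "\<And>v. v \<in> Spc M x \<Longrightarrow> app f v \<in> Spc N x"
    "\<And>b v. b \<in> B \<Longrightarrow> v \<in> Spc M x \<Longrightarrow> app f (Map M (x, b, x) v) = Map N (x, b, x) (app f v)"
  using f Hom_mrep_iff[OF B M N, of f] app_lin_map by auto

lemma app_rel_trace:
  assumes B: "fixing B" and Q: "fixing Q" "Q \<subseteq> B"
    and M: "is_module (pt B) M" and f: "f \<in> Hom Q (mrep M x) (mrep M x)" and v: "v \<in> Spc M x"
  shows "app (rel_trace B Q (mrep M x) (mrep M x) f) v
    = coset_sum B Q (\<lambda>g. Map M (x, g, x) (app f (Map M (x, inv g, x) v)))"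
proof -
  have MQ: "is_module (pt Q) M" using pt_module_mono M B Q by blast
  have BQ: "coset_closed B Q" using B Q coset_closed_subgroup by (auto simp: fixing_def)
  have "app (rel_trace B Q (mrep M x) (mrep M x) f) v
    = coset_sum B Q (\<lambda>g. app (mrep M x g * f * mrep M x (inv g)) v)"
    unfolding rel_trace_def coset_sum_def app_sum ..
  also have "\<dots> = coset_sum B Q (\<lambda>g. Map M (x, g, x) (app f (Map M (x, inv g, x) v)))"
  proof (rule coset_sum_cong[OF BQ])
    fix g assume g: "g \<in> B"
    then have "inv g \<in> B" using B subgroup.m_inv_closed by (auto simp: fixing_def)
    then show "app (mrep M x g * f * mrep M x (inv g)) v
      = Map M (x, g, x) (app f (Map M (x, inv g, x) v))"
      using g v Map_pt_closed[OF B M] Hom_app(2)[OF Q(1) MQ MQ f] by (simp add: app_mrep_on[OF B M])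
  qed
  finally show ?thesis .
qed

end

section \<open>The transporter category of an orbit\<close>

text \<open>
The two sides of the correspondence are instances of the same situation: a subgroup \<open>A\<close> acting on a stable
subposet \<open>X\<close>, and a point \<open>x \<in> X\<close>. On one side \<open>A\<close> is the whole group and \<open>X\<close> the whole poset, on
the other \<open>A = K\<close> and \<open>X = {x}\<close>.
\<close>

locale orbit_cat = finite_group G for G (structure) +
  fixes P :: "'x set" and r :: "('x \<times> 'x) set" and \<phi> :: "'a \<Rightarrow> 'x \<Rightarrow> 'x"
    and A :: "'a set" and X :: "'x set" and x :: 'x
  assumes finite_P: "finite P" and gposet: "gposet G P r \<phi>"
    and A: "subgroup A G" and XP: "X \<subseteq> P"
    and X_stable: "\<And>a y. a \<in> A \<Longrightarrow> y \<in> X \<Longrightarrow> \<phi> a y \<in> X" and xX: "x \<in> X"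
begin

sublocale group_action G P \<phi> using gposet by (simp add: gposet_def)

lemma po: "refl_on P r" "antisym r" "trans r"
  using gposet by (auto simp: gposet_def partial_order_on_def preorder_on_def)

lemma r_refl: "y \<in> P \<Longrightarrow> (y, y) \<in> r"
  using po by (auto simp: refl_on_def)

sublocale fixed_point G r \<phi> x
  by unfold_locales (use r_refl xX XP in blast)

definition S :: "'a set" where "S = {g \<in> A. \<phi> g x = x}"
definition Orb :: "'x set" where "Orb = (\<lambda>g. \<phi> g x) ` A"
text \<open>
The group elements that carry \<open>x\<close> to \<open>y\<close>: a left coset of the stabilizer \<open>S\<close> if \<open>y\<close> lies in the
orbit, and empty otherwise.
\<close>

definition T :: "'x \<Rightarrow> 'a set" where "T y = {g \<in> A. \<phi> g x = y}"

abbreviation C where "C \<equiv> transporter G r \<phi> X A"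
abbreviation OC where "OC \<equiv> transporter G r \<phi> Orb A"

lemma AG: "g \<in> A \<Longrightarrow> g \<in> carrier G" using subgroup.mem_carrier[OF A] .
lemma Am: "g \<in> A \<Longrightarrow> h \<in> A \<Longrightarrow> g \<otimes> h \<in> A" using subgroup.m_closed[OF A] .
lemma Ai: "g \<in> A \<Longrightarrow> inv g \<in> A" using subgroup.m_inv_closed[OF A] .
lemma A1: "\<one> \<in> A" using subgroup.one_closed[OF A] .

lemma phi_mult: "y \<in> P \<Longrightarrow> g \<in> A \<Longrightarrow> h \<in> A \<Longrightarrow> \<phi> (g \<otimes> h) y = \<phi> g (\<phi> h y)"
  using composition_rule AG by blast
lemma phi_one: "y \<in> P \<Longrightarrow> \<phi> \<one> y = y"
  using id_eq_one by (metis restrict_apply')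
lemma phi_inv: "y \<in> P \<Longrightarrow> g \<in> A \<Longrightarrow> \<phi> (inv g) (\<phi> g y) = y"
  using orbit_sym_aux AG by blast
lemma phi_inv': "y \<in> P \<Longrightarrow> g \<in> A \<Longrightarrow> \<phi> g (\<phi> (inv g) y) = y"
  using phi_inv[of y "inv g"] Ai AG by simp
lemma phi_P: "y \<in> P \<Longrightarrow> g \<in> A \<Longrightarrow> \<phi> g y \<in> P"
  using element_image AG by blast
lemma phi_mono: "g \<in> A \<Longrightarrow> (y, z) \<in> r \<Longrightarrow> (\<phi> g y, \<phi> g z) \<in> r"
  using gposet AG by (simp add: gposet_def)

lemma xP: "x \<in> P" using xX XP by blast
lemma Orb_X: "Orb \<subseteq> X" unfolding Orb_def using X_stable xX by blast
lemma Orb_P: "y \<in> Orb \<Longrightarrow> y \<in> P" using Orb_X XP by blast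
lemma x_Orb: "x \<in> Orb" unfolding Orb_def using phi_one[OF xP] A1 by force
lemma Orb_phi: "y \<in> Orb \<Longrightarrow> g \<in> A \<Longrightarrow> \<phi> g y \<in> Orb"
  unfolding Orb_def using phi_mult[OF xP] Am by force

lemma OrbE: assumes "y \<in> Orb" obtains t where "t \<in> T y"
  using assms by (auto simp: Orb_def T_def)

lemma T_A: "g \<in> T y \<Longrightarrow> g \<in> A" and T_x: "g \<in> T y \<Longrightarrow> \<phi> g x = y" by (auto simp: T_def)
lemma T_Orb: "g \<in> T y \<Longrightarrow> y \<in> Orb" by (auto simp: T_def Orb_def)
lemma T_S: "T x = S" by (simp add: T_def S_def)

lemma fixing_S: "fixing S"
proof -
  have "subgroup S G"
  proof (rule subgroupI)
    show "S \<subseteq> carrier G" "S \<noteq> {}" using AG A1 phi_one[OF xP] by (auto simp: S_def)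
    fix g h assume g: "g \<in> S" and h: "h \<in> S"
    then show "inv g \<in> S" using phi_inv[OF xP, of g] Ai by (simp add: S_def)
    show "g \<otimes> h \<in> S" using g h Am phi_mult[OF xP] by (simp add: S_def)
  qed
  then show ?thesis by (simp add: fixing_def S_def)
qed

lemma fixing_sub: "subgroup Q G \<Longrightarrow> Q \<subseteq> S \<Longrightarrow> fixing Q"
  using fixing_S by (auto simp: fixing_def)

text \<open>
Iterating gives \<open>\<phi> h y \<le> \<phi> (h ^ n) y\<close> for all \<open>n \<ge> 1\<close>, and for \<open>n\<close> the group order the right side is \<open>y\<close>.
\<close>

lemma translate_below_eq:
  assumes y: "y \<in> P" and h: "h \<in> A" and le: "(y, \<phi> h y) \<in> r"
  shows "\<phi> h y = y"
proof -
  define c where "c n = \<phi> (h [^] (n::nat)) y" for n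
  have hn: "h [^] n \<in> A" for n :: nat
    by (induction n) (auto simp: A1 Am h)
  have c: "c (Suc n) = \<phi> h (c n)" for n
    using phi_mult[OF y h hn, of n] nat_pow_Suc2[OF AG[OF h], of n] by (simp add: c_def)
  have step: "(c n, c (Suc n)) \<in> r" for n
  proof (induction n)
    case 0
    then show ?case using le y by (simp add: c_def phi_one AG[OF h])
  next
    case (Suc n)
    then show ?case using phi_mono[OF h] c by metis
  qed
  have up: "(\<phi> h y, c (Suc n)) \<in> r" for n
  proof (induction n)
    case 0
    then show ?case using r_refl phi_P y h by (simp add: c_def AG[OF h])
  next
    case (Suc n)
    then show ?case using step[of "Suc n"] po(3) by (meson transD)
  qed
  have "card (carrier G) > 0" using one_closed by (auto simp: card_gt_0_iff)
  then obtain n where n: "card (carrier G) = Suc n" using gr0_implies_Suc by blast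
  have "c (Suc n) = y"
    using pow_order_eq_1[OF AG[OF h]] phi_one[OF y] by (simp add: c_def n order_def del: nat_pow_Suc)
  then show ?thesis using up[of n] le po(2) by (metis antisymD)
qed

lemma Orb_antichain:
  assumes "y \<in> Orb" "z \<in> Orb" "g \<in> A" "(\<phi> g y, z) \<in> r"
  shows "\<phi> g y = z"
proof -
  obtain s t where st: "s \<in> T y" "t \<in> T z" using assms OrbE by metis
  have w: "\<phi> g y \<in> P" using assms Orb_P phi_P by blast
  have eq: "\<phi> (t \<otimes> inv s \<otimes> inv g) (\<phi> g y) = z"
  proof -
    have "\<phi> (t \<otimes> inv s \<otimes> inv g) (\<phi> g y) = \<phi> t (\<phi> (inv s) (\<phi> (inv g) (\<phi> g y)))"
      using w st assms(3) by (simp add: phi_mult phi_P Am Ai T_A)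
    also have "\<dots> = z"
      using phi_inv[OF Orb_P[OF assms(1)] assms(3)] phi_inv[OF xP T_A[OF st(1)]] T_x st by simp
    finally show ?thesis .
  qed
  have "t \<otimes> inv s \<otimes> inv g \<in> A" using st assms(3) by (simp add: Am Ai T_A)
  then show ?thesis using translate_below_eq[OF w, of "t \<otimes> inv s \<otimes> inv g"] assms(4) eq by simp
qed

lemma OC_arr_iff: "(y, g, z) \<in> Arr OC \<longleftrightarrow> y \<in> Orb \<and> g \<in> A \<and> z = \<phi> g y"
  using Orb_antichain r_refl Orb_P Orb_phi by auto

lemma C_OC: "is_module C M \<Longrightarrow> is_module OC M"
  using Orb_X unfolding is_module_def ball_Arr_transporter by (simp add: subset_iff)

lemma OC_pt:
  assumes "is_module OC M" shows "is_module (pt S) M"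
  using assms x_Orb refl_x unfolding pt_module_iff[OF fixing_S]
  unfolding is_module_def ball_Arr_transporter
  by (auto simp: S_def)

context
  fixes M :: "('x, 'x \<times> 'a \<times> 'x, 'k::field) kmod"
  assumes M: "is_module OC M"
begin

lemma fd_Orb: "y \<in> Orb \<Longrightarrow> fd_space (Spc M y)" using M by (simp add: is_module_def)
lemma subspace_Orb: "y \<in> Orb \<Longrightarrow> seqs.subspace (Spc M y)" using fd_space_subspace fd_Orb by blast

lemma lin_map_Orb:
  assumes "y \<in> Orb" "g \<in> A" "\<phi> g y = z"
  shows "lin_map (Spc M y) (Spc M z) (Map M (y, g, z))"
proof -
  have "(y, g, z) \<in> Arr OC" using assms OC_arr_iff by blast
  then have "lin_map (Spc M (Dom OC (y, g, z))) (Spc M (Cod OC (y, g, z))) (Map M (y, g, z))"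
    using M unfolding is_module_def by blast
  then show ?thesis by simp
qed

lemma Map_closed: "y \<in> Orb \<Longrightarrow> g \<in> A \<Longrightarrow> \<phi> g y = z \<Longrightarrow> v \<in> Spc M y \<Longrightarrow> Map M (y, g, z) v \<in> Spc M z"
  using lin_map_Orb by (auto simp: lin_map_def)

lemma Map_Map:
  assumes "y \<in> Orb" "g \<in> A" "h \<in> A" "\<phi> g y = z" "\<phi> h z = w" "v \<in> Spc M y"
  shows "Map M (z, h, w) (Map M (y, g, z) v) = Map M (y, h \<otimes> g, w) v"
proof -
  have z: "z \<in> Orb" using assms Orb_phi by blast
  have "(y, g, z) \<in> Arr OC" "(z, h, w) \<in> Arr OC" using assms z OC_arr_iff by auto
  moreover have "\<forall>a\<in>Arr OC. \<forall>b\<in>Arr OC. Dom OC a = Cod OC b \<longrightarrow>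
      (\<forall>v\<in>Spc M (Dom OC b). Map M (Cmp OC a b) v = Map M a (Map M b v))"
    using M by (simp add: is_module_def)
  ultimately have "Dom OC (z, h, w) = Cod OC (y, g, z) \<longrightarrow> (\<forall>v\<in>Spc M (Dom OC (y, g, z)).
      Map M (Cmp OC (z, h, w) (y, g, z)) v = Map M (z, h, w) (Map M (y, g, z) v))" by blast
  then show ?thesis using assms(6) by simp
qed

lemma Map_one: "y \<in> Orb \<Longrightarrow> v \<in> Spc M y \<Longrightarrow> Map M (y, \<one>, y) v = v"
  using M by (simp add: is_module_def)

lemma Map_inv:
  assumes "y \<in> Orb" "g \<in> A" "\<phi> g y = z" "v \<in> Spc M y"
  shows "Map M (z, inv g, y) (Map M (y, g, z) v) = v"
  using assms Map_Map[of y g "inv g" z y v] Map_one Ai AG phi_inv[OF Orb_P] by auto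

lemma Map_inv':
  assumes "y \<in> Orb" "g \<in> A" "\<phi> g y = z" "v \<in> Spc M z"
  shows "Map M (y, g, z) (Map M (z, inv g, y) v) = v"
proof -
  have "z \<in> Orb" "\<phi> (inv g) z = y" using assms Orb_phi phi_inv[OF Orb_P] by auto
  then show ?thesis using Map_inv[of z "inv g" y v] assms Ai AG by simp
qed

lemma Map_zero: "y \<in> Orb \<Longrightarrow> g \<in> A \<Longrightarrow> \<phi> g y = z \<Longrightarrow> Map M (y, g, z) 0 = 0"
  using lin_map_zero[OF lin_map_Orb subspace_Orb] by blast

lemma Spc_trivial:
  assumes "Spc M x = {0}" "y \<in> Orb" shows "Spc M y = {0}"
proof -
  obtain t where t: "t \<in> T y" using assms OrbE by blast
  have "v = 0" if "v \<in> Spc M y" for v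
  proof -
    have "Map M (y, inv t, x) v \<in> Spc M x"
      using Map_closed[OF assms(2) Ai[OF T_A[OF t]] _ that] T_x[OF t] phi_inv[OF xP T_A[OF t]] by simp
    then have "Map M (x, t, y) (Map M (y, inv t, x) v) = 0"
      using assms(1) Map_zero[OF x_Orb T_A[OF t] T_x[OF t]] by simp
    then show ?thesis using Map_inv'[OF x_Orb T_A[OF t] T_x[OF t] that] by simp
  qed
  then show ?thesis using seqs.subspace_0[OF subspace_Orb[OF assms(2)]] by blast
qed

end

definition supported :: "('x, 'x \<times> 'a \<times> 'x, 'k::field) kmod \<Rightarrow> bool" where
  "supported M \<longleftrightarrow> (\<forall>y\<in>X - Orb. Spc M y = {0})"

lemma supp_obs_iff:
  assumes "is_module C M"
  shows "supp_obs C M = Orb \<longleftrightarrow> supported M \<and> Spc M x \<noteq> {0}"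
proof
  assume "supp_obs C M = Orb"
  then show "supported M \<and> Spc M x \<noteq> {0}"
    using x_Orb by (auto simp: supp_obs_def supported_def)
next
  assume s: "supported M \<and> Spc M x \<noteq> {0}"
  have "Spc M y \<noteq> {0}" if y: "y \<in> Orb" for y
  proof
    assume 0: "Spc M y = {0}"
    obtain t where t: "t \<in> T y" using y OrbE by blast
    note m = C_OC[OF assms]
    have "v = 0" if v: "v \<in> Spc M x" for v
    proof -
      have "Map M (x, t, y) v = 0"
        using Map_closed[OF m x_Orb T_A[OF t] T_x[OF t] v] 0 by simp
      moreover have "\<phi> (inv t) y = x" using phi_inv[OF xP T_A[OF t]] T_x[OF t] by simp
      ultimately show ?thesis
        using Map_inv[OF m x_Orb T_A[OF t] T_x[OF t] v] Map_zero[OF m y Ai[OF T_A[OF t]]] by simp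
    qed
    then have "Spc M x = {0}" using seqs.subspace_0[OF subspace_Orb[OF m x_Orb]] by blast
    then show False using s by simp
  qed
  then show "supp_obs C M = Orb" using s Orb_X by (auto simp: supp_obs_def supported_def)
qed

text \<open>
A subrepresentation \<open>U\<close> of \<open>M(x)\<close> extends to the submodule of the elements that are carried into
\<open>U\<close> by every isomorphism to \<open>x\<close>. A point off the orbit has no such isomorphism, and there the whole of
\<open>M\<close> is taken, which will be zero.
\<close>

definition extend :: "('x, 'x \<times> 'a \<times> 'x, 'k::field) kmod \<Rightarrow> (nat \<Rightarrow> 'k) set \<Rightarrow> 'x \<Rightarrow> (nat \<Rightarrow> 'k) set" where
  "extend M U y = {v \<in> Spc M y. \<forall>g\<in>T y. Map M (y, inv g, x) v \<in> U}"

lemma C_lin_map: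
  assumes "is_module C M" "y \<in> X" "g \<in> A" "z \<in> X" "(\<phi> g y, z) \<in> r"
  shows "lin_map (Spc M y) (Spc M z) (Map M (y, g, z))"
proof -
  have "(y, g, z) \<in> Arr C" using assms by simp
  then have "lin_map (Spc M (Dom C (y, g, z))) (Spc M (Cod C (y, g, z))) (Map M (y, g, z))"
    using assms(1) unfolding is_module_def by blast
  then show ?thesis by simp
qed

lemma T_inv: "g \<in> T y \<Longrightarrow> \<phi> (inv g) y = x"
  using phi_inv[OF xP T_A] T_x by metis

context
  fixes M :: "('x, 'x \<times> 'a \<times> 'x, 'k::field) kmod"
  assumes M: "is_module C M" and supp: "supported M"
begin

lemma extend_submodule:
  assumes U: "seqs.subspace U"
  shows "is_submodule C M (extend M U)"
proof -
  note m = C_OC[OF M]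
  have "seqs.subspace (extend M U y)" if y: "y \<in> X" for y
  proof (cases "y \<in> Orb")
    case True
    have lin: "lin_map (Spc M y) (Spc M x) (Map M (y, inv g, x))" if "g \<in> T y" for g
      using lin_map_Orb[OF m True Ai[OF T_A[OF that]] T_inv[OF that]] .
    have z: "Map M (y, inv g, x) 0 = 0" if "g \<in> T y" for g
      using lin_map_zero[OF lin[OF that] subspace_Orb[OF m True]] .
    note s = subspace_Orb[OF m True]
    show ?thesis unfolding seqs.subspace_def extend_def
      using seqs.subspace_0[OF s] seqs.subspace_add[OF s] seqs.subspace_scale[OF s]
        seqs.subspace_0[OF U] seqs.subspace_add[OF U] seqs.subspace_scale[OF U] lin z
      by (auto simp: lin_map_def)
  next
    case False
    then have "T y = {}" using T_Orb by blast
    moreover have "seqs.subspace (Spc M y)" using M y fd_space_subspace by (auto simp: is_module_def)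
    ultimately show ?thesis by (simp add: extend_def)
  qed
  moreover have "Map M (y, a, z) v \<in> extend M U z"
    if a: "y \<in> X" "a \<in> A" "z \<in> X" "(\<phi> a y, z) \<in> r" and v: "v \<in> extend M U y" for y a z v
  proof -
    have lin: "lin_map (Spc M y) (Spc M z) (Map M (y, a, z))" using C_lin_map M a by blast
    then have 1: "Map M (y, a, z) v \<in> Spc M z" using v by (auto simp: lin_map_def extend_def)
    moreover have "Map M (z, inv g, x) (Map M (y, a, z) v) \<in> U" if g: "g \<in> T z" for g
    proof (cases "y \<in> Orb")
      case True
      have z: "z \<in> Orb" "\<phi> a y = z" using T_Orb[OF g] Orb_antichain True a by auto
      have "Map M (z, inv g, x) (Map M (y, a, z) v) = Map M (y, inv g \<otimes> a, x) v"
        using Map_Map[OF m True a(2) Ai[OF T_A[OF g]] z(2) T_inv[OF g]] v by (simp add: extend_def)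
      also have "inv g \<otimes> a = inv (inv a \<otimes> g)" using a T_A[OF g] AG by (simp add: inv_mult_group)
      finally have "Map M (z, inv g, x) (Map M (y, a, z) v) = Map M (y, inv (inv a \<otimes> g), x) v" .
      moreover have "inv a \<otimes> g \<in> T y"
        using a T_A[OF g] T_x[OF g] z(2) phi_inv[OF Orb_P[OF True] a(2)] Am Ai phi_mult[OF xP]
        by (simp add: T_def)
      ultimately show ?thesis using v by (simp add: extend_def)
    next
      case False
      then have "Spc M y = {0}" using supp a by (auto simp: supported_def)
      then have "v = 0" using v by (auto simp: extend_def)
      moreover have "seqs.subspace (Spc M y)" using M a fd_space_subspace by (auto simp: is_module_def)
      ultimately have "Map M (y, a, z) v = 0" using lin_map_zero[OF lin] by simp
      then show ?thesis
        using Map_zero[OF m T_Orb[OF g] Ai[OF T_A[OF g]] T_inv[OF g]] seqs.subspace_0[OF U] by simp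
    qed
    ultimately show ?thesis by (simp add: extend_def)
  qed
  ultimately show ?thesis unfolding is_submodule_def ball_Arr_transporter by (auto simp: extend_def)
qed

lemma extend_x:
  assumes U: "U \<subseteq> Spc M x" "\<And>s u. s \<in> S \<Longrightarrow> u \<in> U \<Longrightarrow> Map M (x, s, x) u \<in> U"
  shows "extend M U x = U"
proof -
  note m = C_OC[OF M]
  have S: "inv s \<in> S" if "s \<in> S" for s
    using that fixing_S subgroup.m_inv_closed by (auto simp: fixing_def)
  have "\<one> \<in> S" using fixing_S subgroup.one_closed by (auto simp: fixing_def)
  then have "v \<in> U" if "v \<in> extend M U x" for v
  proof -
    have "v \<in> Spc M x" "Map M (x, inv \<one>, x) v \<in> U"
      using that \<open>\<one> \<in> S\<close> T_S unfolding extend_def by blast+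
    then show ?thesis using Map_one[OF m x_Orb] by simp
  qed
  moreover have "u \<in> extend M U x" if "u \<in> U" for u
    using that U S unfolding extend_def T_S by blast
  ultimately show ?thesis by blast
qed

lemma extend_direct_sum:
  assumes U: "seqs.subspace U" "\<And>s u. s \<in> S \<Longrightarrow> u \<in> U \<Longrightarrow> Map M (x, s, x) u \<in> U"
    and W: "seqs.subspace W" "\<And>s u. s \<in> S \<Longrightarrow> u \<in> W \<Longrightarrow> Map M (x, s, x) u \<in> W"
    and sum: "Spc M x = {u + w | u w. u \<in> U \<and> w \<in> W}" and int: "U \<inter> W = {0}"
  shows "direct_sum C M (extend M U) (extend M W)"
proof -
  note m = C_OC[OF M]
  have sub: "U \<subseteq> Spc M x" "W \<subseteq> Spc M x"
  proof -
    have "u = u + 0" "u = 0 + u" for u :: "nat \<Rightarrow> 'k" by simp_all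
    then show "U \<subseteq> Spc M x" "W \<subseteq> Spc M x"
      unfolding sum using seqs.subspace_0[OF W(1)] seqs.subspace_0[OF U(1)] by blast+
  qed
  have s: "is_submodule C M (extend M U)" "is_submodule C M (extend M W)"
    using extend_submodule U W by auto
  have carry: "Map M (x, t, y) u \<in> extend M Z y"
    if Z: "\<And>s u. s \<in> S \<Longrightarrow> u \<in> Z \<Longrightarrow> Map M (x, s, x) u \<in> Z" "Z \<subseteq> Spc M x"
      and t: "t \<in> T y" and u: "u \<in> Z" for Z t y u
  proof -
    have uM: "u \<in> Spc M x" using u Z by blast
    have "Map M (y, inv g, x) (Map M (x, t, y) u) \<in> Z" if g: "g \<in> T y" for g
    proof -
      have "Map M (y, inv g, x) (Map M (x, t, y) u) = Map M (x, inv g \<otimes> t, x) u"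
        using Map_Map[OF m x_Orb T_A[OF t] Ai[OF T_A[OF g]] T_x[OF t] T_inv[OF g] uM] .
      moreover have "inv g \<otimes> t \<in> S"
        using Am[OF Ai[OF T_A[OF g]] T_A[OF t]] phi_mult[OF xP Ai[OF T_A[OF g]] T_A[OF t]]
          T_x[OF t] T_inv[OF g] by (simp add: S_def)
      ultimately show ?thesis using Z u by simp
    qed
    then show ?thesis using Map_closed[OF m x_Orb T_A[OF t] T_x[OF t] uM] by (simp add: extend_def)
  qed
  have "Spc M y = {u + w |u w. u \<in> extend M U y \<and> w \<in> extend M W y} \<and>
    extend M U y \<inter> extend M W y = {0}" if y: "y \<in> X" for y
  proof (cases "y \<in> Orb")
    case True
    obtain t where t: "t \<in> T y" using True OrbE by blast
    note ti = T_inv[OF t] and tA = T_A[OF t] and tx = T_x[OF t]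
    have sp: "seqs.subspace (Spc M y)" using subspace_Orb[OF m True] .
    have "\<exists>u w. v = u + w \<and> u \<in> extend M U y \<and> w \<in> extend M W y" if v: "v \<in> Spc M y" for v
    proof -
      have "Map M (y, inv t, x) v \<in> Spc M x" using Map_closed[OF m True Ai[OF tA] ti v] .
      then obtain u w where uw: "u \<in> U" "w \<in> W" "Map M (y, inv t, x) v = u + w"
        unfolding sum by blast
      have "v = Map M (x, t, y) (u + w)"
        using Map_inv'[OF m x_Orb tA tx v] uw by simp
      also have "\<dots> = Map M (x, t, y) u + Map M (x, t, y) w"
      proof -
        have "u \<in> Spc M x" "w \<in> Spc M x" using uw sub by auto
        then show ?thesis using lin_map_Orb[OF m x_Orb tA tx] by (simp add: lin_map_def)
      qed
      finally show ?thesis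
        using carry[OF U(2) sub(1) t uw(1)] carry[OF W(2) sub(2) t uw(2)] by blast
    qed
    moreover have "extend M U y \<subseteq> Spc M y" "extend M W y \<subseteq> Spc M y" by (auto simp: extend_def)
    ultimately have 1: "Spc M y = {u + w |u w. u \<in> extend M U y \<and> w \<in> extend M W y}"
      using seqs.subspace_add[OF sp] by blast
    have "v = 0" if v: "v \<in> extend M U y" "v \<in> extend M W y" for v
    proof -
      have "Map M (y, inv t, x) v \<in> U \<inter> W" using v t by (auto simp: extend_def)
      then have "Map M (y, inv t, x) v = 0" using int by blast
      then have "Map M (x, t, y) (Map M (y, inv t, x) v) = 0" using Map_zero[OF m x_Orb tA tx] by simp
      moreover have "v \<in> Spc M y" using v by (simp add: extend_def)
      ultimately show ?thesis using Map_inv'[OF m x_Orb tA tx] by metis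
    qed
    moreover have "0 \<in> extend M U y" "0 \<in> extend M W y"
      using s y seqs.subspace_0[of "extend M U y"] seqs.subspace_0[of "extend M W y"]
      by (auto simp: is_submodule_def)
    ultimately show ?thesis using 1 by blast
  next
    case False
    then have "Spc M y = {0}" "T y = {}" using supp y T_Orb by (auto simp: supported_def)
    then have "extend M U y = {0}" "extend M W y = {0}" by (auto simp: extend_def)
    then show ?thesis using \<open>Spc M y = {0}\<close> by simp
  qed
  then show ?thesis using s unfolding direct_sum_def by simp
qed

text \<open>
The Fitting decomposition of an endomorphism of \<open>M(x)\<close> consists of subrepresentations and hence
extends to a decomposition of \<open>M\<close>. So the endomorphism is nilpotent or bijective.
\<close>

lemma indecomposable_local:
  assumes indec: "indecomposable C M"
  shows "local_rep S (mrep M x)" "Spc M x \<noteq> {0}"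
proof -
  note m = C_OC[OF M] and F = fixing_S and ms = OC_pt[OF C_OC[OF M]]
  define V where "V = Spc M x"
  have sV: "seqs.subspace V" unfolding V_def using subspace_pt F ms by blast
  have fdV: "fd_space V" unfolding V_def using fd_Orb[OF m x_Orb] .
  show nz: "Spc M x \<noteq> {0}"
  proof
    assume "Spc M x = {0}"
    then have "Spc M y = {0}" if "y \<in> X" for y
      using Spc_trivial[OF m] supp that by (cases "y \<in> Orb") (auto simp: supported_def)
    then show False using indec by (simp add: indecomposable_def)
  qed
  have "mrep M x \<one> \<noteq> 0"
  proof
    assume "mrep M x \<one> = 0"
    then have "proj_onto V = 0" using mrep_one[OF F ms] by (simp add: V_def)
    then have "v = 0" if "v \<in> V" for v using proj_onto(2)[OF sV that] by simp
    then show False using nz seqs.subspace_0[OF sV] unfolding V_def by blast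
  qed
  moreover have "(\<exists>n. f ^ n = 0) \<or> unit_endo S (mrep M x) f" if f: "f \<in> Hom S (mrep M x) (mrep M x)" for f
  proof -
    have fV: "app f v \<in> V" if "v \<in> V" for v using Hom_app(2)[OF F ms ms f] that by (simp add: V_def)
    have feq: "app f (Map M (x, s, x) v) = Map M (x, s, x) (app f v)" if "s \<in> S" "v \<in> V" for s v
      using Hom_app(3)[OF F ms ms f] that by (simp add: V_def)
    have Mc: "Map M (x, s, x) v \<in> V" if "s \<in> S" "v \<in> V" for s v
      using Map_pt_closed[OF F ms] that by (simp add: V_def)
    obtain n where n: "n > 0"
      and sum: "\<And>v. v \<in> V \<Longrightarrow> \<exists>u\<in>V. \<exists>w\<in>V. v = u + app (f ^ n) w \<and> app (f ^ n) u = 0"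
      and int: "\<And>v. v \<in> V \<Longrightarrow> app (f ^ n) (app (f ^ n) v) = 0 \<Longrightarrow> app (f ^ n) v = 0"
      using fitting[OF fdV fV] by metis
    have pV: "app (f ^ k) v \<in> V" if "v \<in> V" for k v using that by (induction k) (auto intro: fV)
    have peq: "app (f ^ k) (Map M (x, s, x) v) = Map M (x, s, x) (app (f ^ k) v)"
      if "s \<in> S" "v \<in> V" for k s v
      using that by (induction k) (auto simp: feq pV)
    have M0: "Map M (x, s, x) 0 = 0" if "s \<in> S" for s
      using lin_map_zero[OF lin_map_pt[OF F ms that] subspace_pt[OF F ms]] .
    define U where "U = {v \<in> V. app (f ^ n) v = 0}"
    define W where "W = app (f ^ n) ` V"
    have sU: "seqs.subspace U" unfolding U_def seqs.subspace_def
      using seqs.subspace_0[OF sV] seqs.subspace_add[OF sV] seqs.subspace_scale[OF sV]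
      by (auto simp: app_scale)
    have sW: "seqs.subspace W"
      unfolding W_def using lin_map_image_subspace[OF app_lin_map[of V "f ^ n" V] sV] pV by auto
    have tU: "Map M (x, s, x) u \<in> U" if "s \<in> S" "u \<in> U" for s u
      using that Mc peq M0 by (auto simp: U_def)
    have tW: "Map M (x, s, x) u \<in> W" if "s \<in> S" "u \<in> W" for s u
    proof -
      obtain w where "w \<in> V" "u = app (f ^ n) w" using \<open>u \<in> W\<close> by (auto simp: W_def)
      then show ?thesis using peq[OF \<open>s \<in> S\<close>, of w n] Mc[OF \<open>s \<in> S\<close>] unfolding W_def by force
    qed
    have "Spc M x = {u + w |u w. u \<in> U \<and> w \<in> W}"
    proof
      show "Spc M x \<subseteq> {u + w |u w. u \<in> U \<and> w \<in> W}"
        using sum unfolding V_def[symmetric] U_def W_def by blast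
      show "{u + w |u w. u \<in> U \<and> w \<in> W} \<subseteq> Spc M x"
        unfolding V_def[symmetric] U_def W_def using seqs.subspace_add[OF sV] pV by blast
    qed
    moreover have "U \<inter> W = {0}"
    proof -
      have "0 \<in> U" "0 \<in> W" using sU sW seqs.subspace_0 by auto
      then show ?thesis using int unfolding U_def W_def by blast
    qed
    ultimately have "direct_sum C M (extend M U) (extend M W)" using extend_direct_sum sU sW tU tW by blast
    then have "(\<forall>y\<in>X. extend M U y = {0}) \<or> (\<forall>y\<in>X. extend M W y = {0})"
      using indec unfolding indecomposable_iff by auto
    moreover have "U \<subseteq> Spc M x" "W \<subseteq> Spc M x"
      using pV by (auto simp: U_def W_def V_def)
    then have "extend M U x = U" "extend M W x = W"
      using extend_x[OF _ tU] extend_x[OF _ tW] by blast+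
    ultimately consider "U = {0}" | "W = {0}" using xX by metis
    then show ?thesis
    proof cases
      case 2
      have "f * proj_onto V = f" using f Hom_mrep_iff[OF F ms ms] by (simp add: V_def)
      then have "f ^ n * proj_onto V = f ^ n" using n by (metis gr0_implies_Suc mult.assoc power_Suc2)
      then have "app (f ^ n) v = app (f ^ n) (app (proj_onto V) v)" for v by (metis app_times_endo)
      moreover have "app (f ^ n) w = 0" if "w \<in> V" for w using that 2 by (auto simp: W_def)
      ultimately have "f ^ n = 0" using proj_onto(1)[OF sV] by (intro endo_eqI) simp
      then show ?thesis by blast
    next
      case 1
      obtain k where k: "n = Suc k" using n gr0_implies_Suc by blast
      have inj: "inj_on (app f) V"
      proof (rule inj_onI)
        fix u v assume uv: "u \<in> V" "v \<in> V" "app f u = app f v"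
        then have "app f (u - v) = 0" by simp
        then have "app (f ^ n) (u - v) = 0" unfolding k power_Suc2 by simp
        moreover have "u - v \<in> V" using uv seqs.subspace_diff[OF sV] by blast
        ultimately have "u - v \<in> U" by (simp add: U_def)
        then show "u = v" using 1 by simp
      qed
      have surj: "app f ` V = V"
      proof
        show "app f ` V \<subseteq> V" using fV by blast
        show "V \<subseteq> app f ` V"
        proof
          fix v assume "v \<in> V"
          then obtain u w where uw: "u \<in> V" "w \<in> V" "v = u + app (f ^ n) w" "app (f ^ n) u = 0"
            using sum by blast
          then have "u \<in> U" by (simp add: U_def)
          then have "v = app f (app (f ^ k) w)" using uw 1 by (simp add: k)
          then show "v \<in> app f ` V" using pV uw by blast
        qed
      qed
      define h where "h = inv_into V (app f)"
      have h1: "app f (h v) = v" "h v \<in> V" if "v \<in> V" for v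
        using that surj by (auto simp: h_def f_inv_into_f inv_into_into)
      have h2: "h (app f v) = v" if "v \<in> V" for v using that inj by (simp add: h_def)
      have lin: "lin_map V V h" unfolding lin_map_def
      proof (intro conjI ballI allI)
        fix u v c assume u: "u \<in> V"
        show "h u \<in> V" using h1 u by blast
        have "app f (seq_scale c (h u)) = seq_scale c u" using h1 u by (simp add: app_scale)
        then show "h (seq_scale c u) = seq_scale c (h u)"
          using h2[of "seq_scale c (h u)"] h1 u seqs.subspace_scale[OF sV] by metis
        assume v: "v \<in> V"
        have "app f (h u + h v) = u + v" using h1 u v by simp
        then show "h (u + v) = h u + h v"
          using h2[of "h u + h v"] h1 u v seqs.subspace_add[OF sV] by metis
      qed
      have heq: "h (Map M (x, s, x) v) = Map M (x, s, x) (h v)" if "s \<in> S" "v \<in> V" for s v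
        using feq[OF that(1) h1(2)[OF that(2)]] h1 h2 Mc that by metis
      have g: "as_endo V h \<in> Hom S (mrep M x) (mrep M x)"
        unfolding V_def by (rule as_endo_in_Hom[OF F ms ms]) (use lin heq V_def in auto)
      have e: "mrep M x \<one> \<in> Hom S (mrep M x) (mrep M x)" using Hom_id rep_mrep[OF F ms] by blast
      have "f * as_endo V h = mrep M x \<one>"
        by (rule Hom_eqI[OF F ms ms Hom_mult[OF f g] e])
          (simp add: app_as_endo_on[OF sV lin] mrep_one[OF F ms] proj_onto(2)[OF sV] h1 flip: V_def)
      moreover have "as_endo V h * f = mrep M x \<one>"
        by (rule Hom_eqI[OF F ms ms Hom_mult[OF g f] e])
          (simp add: app_as_endo_on[OF sV lin] mrep_one[OF F ms] proj_onto(2)[OF sV] h2 fV flip: V_def)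
      ultimately show ?thesis using f g unfolding unit_endo_def by blast
    qed
  qed
  ultimately show "local_rep S (mrep M x)"
    using rep_mrep[OF F ms] by (simp add: local_rep_def)
qed

end

text \<open>
A homomorphism at \<open>x\<close> is transported along a chosen \<open>t y\<close> with \<open>\<phi> (t y) x = y\<close>; equivariance under the
stabilizer makes the result natural.
\<close>

lemma mod_iso_of_rep_iso:
  assumes M: "is_module C M" "supported M" and N: "is_module C N" "supported N"
    and iso: "rep_iso S (mrep M x) (mrep N x)"
  shows "mod_iso C M N"
proof -
  note F = fixing_S
  define t where "t y = (SOME g. g \<in> T y)" for y
  have t: "t y \<in> T y" if "y \<in> Orb" for y unfolding t_def using OrbE[OF that] by (metis someI)
  define tw where "tw f N M y v = (if y \<in> Orb then Map N (x, t y, y) (app f (Map M (y, inv (t y), x) v)) else 0)"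
    for f :: "'c endo" and M N :: "('x, 'x \<times> 'a \<times> 'x, 'c) kmod" and y v
  have hom: "mod_hom C M N (tw f N M)"
    if M: "is_module C M" "supported M" and N: "is_module C N" "supported N"
      and f: "f \<in> Hom S (mrep M x) (mrep N x)" for M N :: "('x, 'x \<times> 'a \<times> 'x, 'c) kmod" and f
    unfolding mod_hom_def ball_Arr_transporter
  proof (intro conjI ballI impI)
    note m = C_OC[OF M(1)] and n = C_OC[OF N(1)]
    note lf = Hom_app[OF F OC_pt[OF m] OC_pt[OF n] f]
    have lin: "lin_map (Spc M y) (Spc N y) (tw f N M y)" if y: "y \<in> X" for y
    proof (cases "y \<in> Orb")
      case True
      note ty = t[OF True]
      have "lin_map (Spc M y) (Spc N y) (\<lambda>v. Map N (x, t y, y) (app f (Map M (y, inv (t y), x) v)))"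
        using lin_map_comp[OF lin_map_comp[OF lin_map_Orb[OF m True Ai[OF T_A[OF ty]] T_inv[OF ty]] lf(1)]
            lin_map_Orb[OF n x_Orb T_A[OF ty] T_x[OF ty]]] .
      then show ?thesis using True by (simp add: tw_def lin_map_def)
    next
      case False
      then have "Spc M y = {0}" "Spc N y = {0}" using M N y by (auto simp: supported_def)
      then show ?thesis using False by (simp add: tw_def lin_map_def)
    qed
    then show "lin_map (Spc M y) (Spc N y) (tw f N M y)" if "y \<in> Obj C" for y using that by simp
    fix y a z v assume a: "y \<in> X" "a \<in> A" "z \<in> X" "(\<phi> a y, z) \<in> r"
      and v: "v \<in> Spc M (Dom C (y, a, z))"
    then have v: "v \<in> Spc M y" by simp
    have "tw f N M z (Map M (y, a, z) v) = Map N (y, a, z) (tw f N M y v)"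
    proof (cases "y \<in> Orb \<and> z \<in> Orb")
      case True
      then have y: "y \<in> Orb" and z: "z \<in> Orb" and az: "\<phi> a y = z"
        using Orb_antichain a by auto
      define s where "s = inv (t z) \<otimes> a \<otimes> t y"
      have sA: "s \<in> A" unfolding s_def using Am Ai T_A[OF t[OF y]] T_A[OF t[OF z]] a by simp
      have "\<phi> s x = \<phi> (inv (t z)) (\<phi> a (\<phi> (t y) x))"
        unfolding s_def using a T_A[OF t[OF y]] T_A[OF t[OF z]] xP
        by (simp add: phi_mult Am Ai phi_P)
      then have sS: "s \<in> S"
        using sA T_x[OF t[OF y]] T_inv[OF t[OF z]] az by (simp add: S_def)
      define w where "w = Map M (y, inv (t y), x) v"
      have w: "w \<in> Spc M x" unfolding w_def
        using Map_closed[OF m y Ai[OF T_A[OF t[OF y]]] T_inv[OF t[OF y]] v] .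
      have "Map M (z, inv (t z), x) (Map M (y, a, z) v) = Map M (y, inv (t z) \<otimes> a, x) v"
        using Map_Map[OF m y a(2) Ai[OF T_A[OF t[OF z]]] az T_inv[OF t[OF z]] v] .
      also have "inv (t z) \<otimes> a = s \<otimes> inv (t y)"
        unfolding s_def using a AG T_A[OF t[OF y]] T_A[OF t[OF z]] by (simp add: m_assoc)
      also have "Map M (y, s \<otimes> inv (t y), x) v = Map M (x, s, x) w" unfolding w_def
        using Map_Map[OF m y Ai[OF T_A[OF t[OF y]]] sA T_inv[OF t[OF y]] _ v] sS by (simp add: S_def)
      finally have "tw f N M z (Map M (y, a, z) v) = Map N (x, t z, z) (app f (Map M (x, s, x) w))"
        using z by (simp add: tw_def)
      also have "\<dots> = Map N (x, t z, z) (Map N (x, s, x) (app f w))" using lf(3)[OF sS w] by simp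
      also have "\<dots> = Map N (x, t z \<otimes> s, z) (app f w)"
        using Map_Map[OF n x_Orb sA T_A[OF t[OF z]] _ T_x[OF t[OF z]] lf(2)[OF w]] sS by (simp add: S_def)
      also have "t z \<otimes> s = a \<otimes> t y"
        unfolding s_def using a AG T_A[OF t[OF y]] T_A[OF t[OF z]] by (simp add: m_assoc)
      also have "Map N (x, a \<otimes> t y, z) (app f w) = Map N (y, a, z) (Map N (x, t y, y) (app f w))"
        using Map_Map[OF n x_Orb T_A[OF t[OF y]] a(2) T_x[OF t[OF y]] az lf(2)[OF w]] by simp
      finally show ?thesis using y by (simp add: tw_def w_def)
    next
      case False
      have l: "lin_map (Spc M y) (Spc M z) (Map M (y, a, z))" "lin_map (Spc N y) (Spc N z) (Map N (y, a, z))"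
        using C_lin_map M N a by auto
      have s: "seqs.subspace (Spc M y)" "seqs.subspace (Spc N y)"
        using M N a fd_space_subspace by (auto simp: is_module_def)
      have z0: "lin_map (Spc M z) (Spc N z) (tw f N M z)" "seqs.subspace (Spc M z)"
        using lin a M fd_space_subspace by (auto simp: is_module_def)
      have wN: "tw f N M y v \<in> Spc N y" using lin[OF a(1)] v by (simp add: lin_map_def)
      show ?thesis
      proof (cases "y \<in> Orb")
        case True
        then have "z \<notin> Orb" using False by simp
        then have "Spc N z = {0}" "Spc M z = {0}" using M N a by (auto simp: supported_def)
        moreover have "Map N (y, a, z) (tw f N M y v) \<in> Spc N z" "Map M (y, a, z) v \<in> Spc M z"
          using l wN v by (auto simp: lin_map_def)
        ultimately show ?thesis using \<open>z \<notin> Orb\<close> by (simp add: tw_def)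
      next
        case False
        then have "v = 0" using v M a by (auto simp: supported_def)
        then show ?thesis
          using False lin_map_zero[OF l(1) s(1)] lin_map_zero[OF l(2) s(2)] lin_map_zero[OF z0]
          by (simp add: tw_def)
      qed
    qed
    then show "tw f N M (Cod C (y, a, z)) (Map M (y, a, z) v) =
      Map N (y, a, z) (tw f N M (Dom C (y, a, z)) v)" by simp
  qed
  have inverse: "tw g M N y (tw f N M y v) = v"
    if M: "is_module C M" "supported M" and N: "is_module C N" "supported N"
      and f: "f \<in> Hom S (mrep M x) (mrep N x)" and g: "g \<in> Hom S (mrep N x) (mrep M x)"
      and gf: "g * f = mrep M x \<one>" and y: "y \<in> X" and v: "v \<in> Spc M y"
    for M N :: "('x, 'x \<times> 'a \<times> 'x, 'c) kmod" and f g y v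
  proof (cases "y \<in> Orb")
    case True
    note m = C_OC[OF M(1)] and n = C_OC[OF N(1)] and ty = t[OF True]
    note lf = Hom_app[OF F OC_pt[OF m] OC_pt[OF n] f]
    define w where "w = Map M (y, inv (t y), x) v"
    have w: "w \<in> Spc M x" unfolding w_def
      using Map_closed[OF m True Ai[OF T_A[OF ty]] T_inv[OF ty] v] .
    have "app g (app f w) = w"
      using gf w mrep_one[OF F OC_pt[OF m]] proj_onto(2)[OF subspace_pt[OF F OC_pt[OF m]] w]
      by (metis app_times_endo)
    then show ?thesis using True
        Map_inv[OF n x_Orb T_A[OF ty] T_x[OF ty] lf(2)[OF w]] Map_inv'[OF m x_Orb T_A[OF ty] T_x[OF ty] v]
      by (simp add: tw_def flip: w_def)
  next
    case False
    then show ?thesis using v M y by (simp add: tw_def supported_def)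
  qed
  obtain i p where "i \<in> Hom S (mrep M x) (mrep N x)" "p \<in> Hom S (mrep N x) (mrep M x)"
    "p * i = mrep M x \<one>" "i * p = mrep N x \<one>" using iso by (auto simp: rep_iso_def)
  then show ?thesis unfolding mod_iso_def using hom inverse M N
    by (intro exI[of _ "tw i N M"] exI[of _ "tw p M N"]) simp
qed

end

section \<open>Induced modules as left Kan extensions\<close>

context finite_group
begin

definition elt_index :: "'a \<Rightarrow> nat" where "elt_index = (SOME f. inj_on f (carrier G))"

lemma inj_elt_index: "inj_on elt_index (carrier G)"
  unfolding elt_index_def using finite_imp_inj_to_nat_seg[OF finite_carrier] by (metis someI)

text \<open>
Values of modules must be spaces of sequences. A family of sequences indexed by the group is
interleaved into one sequence, from which \<open>decode\<close> recovers the members.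
\<close>

definition encode :: "('a \<Rightarrow> nat \<Rightarrow> 'k::field) \<Rightarrow> nat \<Rightarrow> 'k" where
  "encode F j = (case prod_decode j of (n, i) \<Rightarrow>
     if n \<in> elt_index ` carrier G then F (inv_into (carrier G) elt_index n) i else 0)"

definition decode :: "(nat \<Rightarrow> 'k::field) \<Rightarrow> 'a \<Rightarrow> nat \<Rightarrow> 'k" where
  "decode s g = (\<lambda>i. s (prod_encode (elt_index g, i)))"

lemma decode_encode: "g \<in> carrier G \<Longrightarrow> decode (encode F) g = F g"
  by (simp add: decode_def encode_def inj_elt_index fun_eq_iff)

lemma encode_cong: "(\<And>g. g \<in> carrier G \<Longrightarrow> F g = F' g) \<Longrightarrow> encode F = encode F'"
  by (rule ext) (simp add: encode_def inv_into_into split: prod.split)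

lemma decode_add: "decode (s + t) g = decode s g + decode t g"
  and decode_zero: "decode 0 g = 0"
  and decode_scale: "decode (seq_scale c s) g = seq_scale c (decode s g)"
  by (simp_all add: decode_def seq_scale_def fun_eq_iff)

lemma encode_add: "encode (\<lambda>g. F g + F' g) = encode F + encode F'"
  and encode_zero: "encode (\<lambda>g. 0) = 0"
  and encode_scale: "encode (\<lambda>g. seq_scale c (F g)) = seq_scale c (encode F)"
  by (auto simp: encode_def seq_scale_def fun_eq_iff split: prod.split)

lemma encode_sum: "finite I \<Longrightarrow> encode (\<lambda>g. \<Sum>i\<in>I. F i g) = (\<Sum>i\<in>I. encode (F i))"
proof (induction I rule: finite_induct)
  case empty
  show ?case by (simp only: sum.empty encode_zero)
next
  case (insert i I)
  show ?case by (simp only: sum.insert[OF insert(1,2)] encode_add insert(3))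
qed

lemma encode_delta_in_span:
  assumes "v \<in> seqs.span B"
  shows "encode (\<lambda>h. if h = g then v else 0) \<in> seqs.span ((\<lambda>b. encode (\<lambda>h. if h = g then b else 0)) ` B)"
  using assms
proof (induction rule: seqs.span_induct_alt)
  case base
  show ?case by (simp only: if_cancel encode_zero seqs.span_zero)
next
  case (step c b v)
  have "encode (\<lambda>h. if h = g then seq_scale c b + v else 0)
    = seq_scale c (encode (\<lambda>h. if h = g then b else 0)) + encode (\<lambda>h. if h = g then v else 0)"
    unfolding encode_scale[symmetric] encode_add[symmetric] by (rule encode_cong) simp
  moreover have "seq_scale c (encode (\<lambda>h. if h = g then b else 0))
      \<in> seqs.span ((\<lambda>b. encode (\<lambda>h. if h = g then b else 0)) ` B)"
    using step(1) by (intro seqs.span_scale seqs.span_base imageI)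
  ultimately show ?case using seqs.span_add step(2) by metis
qed

lemma fd_encode:
  assumes V: "fd_space V" and W: "seqs.subspace W"
    and sub: "W \<subseteq> encode ` {F. (\<forall>g\<in>carrier G. F g \<in> V)}"
  shows "fd_space W"
proof -
  obtain B where B: "finite B" "seqs.span B = V" using V by (auto simp: fd_space_def)
  define E where "E = (\<Union>g\<in>carrier G. (\<lambda>b. encode (\<lambda>h. if h = g then b else 0)) ` B)"
  have "fd_space (seqs.span E)" unfolding fd_space_def E_def using B by (intro exI conjI refl) auto
  moreover have "W \<subseteq> seqs.span E"
  proof
    fix s assume "s \<in> W"
    then obtain F where F: "s = encode F" "\<And>g. g \<in> carrier G \<Longrightarrow> F g \<in> V" using sub by blast
    have "s = encode (\<lambda>h. \<Sum>g\<in>carrier G. if h = g then F g else 0)"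
      unfolding F(1) by (rule encode_cong) simp
    also have "\<dots> = (\<Sum>g\<in>carrier G. encode (\<lambda>h. if h = g then F g else 0))"
      by (rule encode_sum) simp
    also have "\<dots> \<in> seqs.span E"
    proof (rule seqs.span_sum)
      fix g assume g: "g \<in> carrier G"
      have "encode (\<lambda>h. if h = g then F g else 0) \<in> seqs.span ((\<lambda>b. encode (\<lambda>h. if h = g then b else 0)) ` B)"
        using encode_delta_in_span F(2)[OF g] B by blast
      moreover have "(\<lambda>b. encode (\<lambda>h. if h = g then b else 0)) ` B \<subseteq> E" using g by (auto simp: E_def)
      ultimately show "encode (\<lambda>h. if h = g then F g else 0) \<in> seqs.span E"
        using seqs.span_mono by blast
    qed
    finally show "s \<in> seqs.span E" .
  qed
  ultimately show ?thesis using fd_space_sub W by blast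
qed

end

context orbit_cat
begin

definition equivariant_fun :: "('x, 'x \<times> 'a \<times> 'x, 'k::field) kmod \<Rightarrow> 'a set \<Rightarrow> 'x \<Rightarrow> ('a \<Rightarrow> nat \<Rightarrow> 'k) set" where
  "equivariant_fun M Q y = {F. (\<forall>g. g \<notin> T y \<longrightarrow> F g = 0) \<and> (\<forall>g\<in>T y. F g \<in> Spc M x) \<and>
     (\<forall>g\<in>T y. \<forall>q\<in>Q. F (g \<otimes> q) = Map M (x, inv q, x) (F g))}"

text \<open>
The value at \<open>y\<close> is the space of functions \<open>F\<close> from \<open>T y\<close> to \<open>M(x)\<close> with \<open>F(g q) = q\<inverse> F(g)\<close>, on which \<open>a\<close> acts by
\<open>(a F)(g) = F(a\<inverse> g)\<close>. As \<open>G\<close> is finite this coinduced module is also the induced one. It is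
automatically zero off the orbit, so it is a module over all of \<open>C\<close>.
\<close>

definition induced :: "('x, 'x \<times> 'a \<times> 'x, 'k::field) kmod \<Rightarrow> 'a set \<Rightarrow> ('x, 'x \<times> 'a \<times> 'x, 'k) kmod" where
  "induced M Q = \<lparr>Spc = (\<lambda>y. encode ` equivariant_fun M Q y),
     Map = (\<lambda>(y, a, z) s. encode (\<lambda>g. if g \<in> T z then decode s (inv a \<otimes> g) else 0))\<rparr>"

text \<open>
The unit of the adjunction sends \<open>v\<close> to the function supported on \<open>Q\<close> with value \<open>v\<close> at \<open>\<one>\<close>.
\<close>

definition unit_map :: "('x, 'x \<times> 'a \<times> 'x, 'k::field) kmod \<Rightarrow> 'a set \<Rightarrow> (nat \<Rightarrow> 'k) \<Rightarrow> nat \<Rightarrow> 'k" where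
  "unit_map M Q v = encode (\<lambda>g. if g \<in> Q then Map M (x, inv g, x) v else 0)"

text \<open>
The homomorphism from the induced module that corresponds to \<open>\<theta>\<close> under the adjunction.
\<close>

definition kan_lift :: "('x, 'x \<times> 'a \<times> 'x, 'k::field) kmod \<Rightarrow> 'a set \<Rightarrow> ((nat \<Rightarrow> 'k) \<Rightarrow> nat \<Rightarrow> 'k)
    \<Rightarrow> 'x \<Rightarrow> (nat \<Rightarrow> 'k) \<Rightarrow> nat \<Rightarrow> 'k" where
  "kan_lift N Q \<theta> y s = coset_sum (T y) Q (\<lambda>g. Map N (x, g, y) (\<theta> (decode s g)))"

lemma Map_induced: "Map (induced M Q) (y, a, z) s = encode (\<lambda>g. if g \<in> T z then decode s (inv a \<otimes> g) else 0)"
  by (simp add: induced_def)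

lemma T_G: "g \<in> T y \<Longrightarrow> g \<in> carrier G" using T_A AG by blast

lemma decode_Map_induced: "g \<in> T z \<Longrightarrow> decode (Map (induced M Q) (y, a, z) s) g = decode s (inv a \<otimes> g)"
  by (simp add: Map_induced decode_encode T_G)

lemma T_coset_closed: "subgroup Q G \<Longrightarrow> Q \<subseteq> S \<Longrightarrow> coset_closed (T y) Q"
  unfolding coset_closed_def
proof (intro conjI ballI)
  fix g q assume "Q \<subseteq> S" "g \<in> T y" "q \<in> Q"
  then have "q \<in> A" "\<phi> q x = x" "g \<in> A" "\<phi> g x = y" by (auto simp: S_def T_def)
  then show "g \<otimes> q \<in> T y" by (simp add: T_def Am phi_mult[OF xP])
qed (use T_G in auto)

lemma T_translate:
  assumes "a \<in> A" "y \<in> P" "\<phi> a y = z" shows "(\<lambda>g. a \<otimes> g) ` T y = T z"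
proof (intro equalityI subsetI)
  fix g assume "g \<in> T z"
  then have g: "g \<in> A" "\<phi> g x = z" by (auto simp: T_def)
  have "inv a \<otimes> g \<in> T y" "g = a \<otimes> (inv a \<otimes> g)"
    using assms(1,3) g phi_inv[OF assms(2,1)] by (simp_all add: T_def phi_mult xP Am Ai AG)
  then show "g \<in> (\<lambda>g. a \<otimes> g) ` T y" by blast
next
  fix h assume "h \<in> (\<lambda>g. a \<otimes> g) ` T y"
  then obtain g where "h = a \<otimes> g" "g \<in> A" "\<phi> g x = y" by (auto simp: T_def)
  then show "h \<in> T z" using assms by (simp add: T_def phi_mult xP Am)
qed

lemma T_translate_inv:
  assumes "a \<in> A" "y \<in> P" "\<phi> a y = z" "g \<in> T z" shows "inv a \<otimes> g \<in> T y"
proof -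
  have "g \<in> A" "\<phi> g x = z" using assms(4) by (auto simp: T_def)
  then show ?thesis using assms(1,3) phi_inv[OF assms(2,1)] by (simp add: T_def phi_mult xP Am Ai)
qed

context
  fixes M :: "('x, 'x \<times> 'a \<times> 'x, 'k::field) kmod" and Q :: "'a set"
  assumes Q: "subgroup Q G" "Q \<subseteq> S" and M: "is_module (pt Q) M"
begin

lemma FQ: "fixing Q" using fixing_sub Q by blast

lemma Qi: "q \<in> Q \<Longrightarrow> inv q \<in> Q" using subgroup.m_inv_closed[OF Q(1)] .

lemma Q1: "\<one> \<in> Q" using subgroup.one_closed[OF Q(1)] .

lemma QG: "q \<in> Q \<Longrightarrow> q \<in> carrier G" using subgroup.mem_carrier[OF Q(1)] .

lemma QA: "q \<in> Q \<Longrightarrow> q \<in> A" "q \<in> Q \<Longrightarrow> \<phi> q x = x" using Q(2) by (auto simp: S_def)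

lemma Map_Q: "a \<in> Q \<Longrightarrow> b \<in> Q \<Longrightarrow> v \<in> Spc M x \<Longrightarrow>
    Map M (x, a, x) (Map M (x, b, x) v) = Map M (x, a \<otimes> b, x) v"
  and Map_Q1: "v \<in> Spc M x \<Longrightarrow> Map M (x, \<one>, x) v = v"
  using M[unfolded pt_module_iff[OF FQ]] by auto

lemma Map_Q0: "q \<in> Q \<Longrightarrow> Map M (x, q, x) 0 = 0"
  using lin_map_zero[OF lin_map_pt[OF FQ M] subspace_pt[OF FQ M]] .

lemma Map_Q_add: "q \<in> Q \<Longrightarrow> u \<in> Spc M x \<Longrightarrow> v \<in> Spc M x \<Longrightarrow>
    Map M (x, q, x) (u + v) = Map M (x, q, x) u + Map M (x, q, x) v"
  and Map_Q_scale: "q \<in> Q \<Longrightarrow> u \<in> Spc M x \<Longrightarrow>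
    Map M (x, q, x) (seq_scale c u) = seq_scale c (Map M (x, q, x) u)"
  using lin_map_pt[OF FQ M] by (simp_all add: lin_map_def)

lemma Map_Q_closed: "q \<in> Q \<Longrightarrow> v \<in> Spc M x \<Longrightarrow> Map M (x, q, x) v \<in> Spc M x"
  using Map_pt_closed[OF FQ M] .

lemma V0: "0 \<in> Spc M x" using seqs.subspace_0[OF subspace_pt[OF FQ M]] .

lemma TQ: "g \<in> T y \<Longrightarrow> q \<in> Q \<Longrightarrow> g \<otimes> q \<in> T y"
  using T_coset_closed[OF Q] unfolding coset_closed_def by blast

lemma induced_memD:
  assumes "s \<in> Spc (induced M Q) y"
  shows "\<And>g. g \<in> T y \<Longrightarrow> decode s g \<in> Spc M x"
    "\<And>g q. g \<in> T y \<Longrightarrow> q \<in> Q \<Longrightarrow> decode s (g \<otimes> q) = Map M (x, inv q, x) (decode s g)"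
    "\<And>g. g \<in> carrier G \<Longrightarrow> g \<notin> T y \<Longrightarrow> decode s g = 0"
    "s = encode (\<lambda>g. if g \<in> T y then decode s g else 0)"
proof -
  obtain F where F: "F \<in> equivariant_fun M Q y" "s = encode F" using assms by (auto simp: induced_def)
  show "\<And>g. g \<in> T y \<Longrightarrow> decode s g \<in> Spc M x"
    "\<And>g. g \<in> carrier G \<Longrightarrow> g \<notin> T y \<Longrightarrow> decode s g = 0"
    using F T_G by (auto simp: decode_encode equivariant_fun_def)
  show "decode s (g \<otimes> q) = Map M (x, inv q, x) (decode s g)" if "g \<in> T y" "q \<in> Q" for g q
    using F that T_G QG by (simp add: decode_encode equivariant_fun_def)
  show "s = encode (\<lambda>g. if g \<in> T y then decode s g else 0)"
    unfolding F(2) by (rule encode_cong) (use F in \<open>simp add: decode_encode equivariant_fun_def\<close>)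
qed

lemma induced_memI:
  assumes "\<And>g. g \<in> T y \<Longrightarrow> F g \<in> Spc M x"
    "\<And>g q. g \<in> T y \<Longrightarrow> q \<in> Q \<Longrightarrow> F (g \<otimes> q) = Map M (x, inv q, x) (F g)"
  shows "encode (\<lambda>g. if g \<in> T y then F g else 0) \<in> Spc (induced M Q) y"
proof -
  have "(\<lambda>g. if g \<in> T y then F g else 0) \<in> equivariant_fun M Q y"
    unfolding equivariant_fun_def using assms TQ by simp
  then show ?thesis by (simp add: induced_def)
qed

lemma induced_memI':
  assumes "s = encode (\<lambda>g. if g \<in> T y then decode s g else 0)" "\<And>g. g \<in> T y \<Longrightarrow> decode s g \<in> Spc M x"
    "\<And>g q. g \<in> T y \<Longrightarrow> q \<in> Q \<Longrightarrow> decode s (g \<otimes> q) = Map M (x, inv q, x) (decode s g)"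
  shows "s \<in> Spc (induced M Q) y"
  using induced_memI[of y "decode s"] assms by metis

lemma induced_eqI:
  assumes "s \<in> Spc (induced M Q) y" "s' \<in> Spc (induced M Q) y" "\<And>g. g \<in> T y \<Longrightarrow> decode s g = decode s' g"
  shows "s = s'"
proof -
  have "encode (\<lambda>g. if g \<in> T y then decode s g else 0) = encode (\<lambda>g. if g \<in> T y then decode s' g else 0)"
    by (rule encode_cong) (simp add: assms(3))
  then show ?thesis using induced_memD(4)[OF assms(1)] induced_memD(4)[OF assms(2)] by metis
qed

lemma induced_subspace: "seqs.subspace (Spc (induced M Q) y)"
proof -
  note sV = subspace_pt[OF FQ M]
  show ?thesis unfolding seqs.subspace_def
  proof (intro conjI ballI allI)
    have "encode (\<lambda>g. if g \<in> T y then 0 else 0) \<in> Spc (induced M Q) y"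
      by (rule induced_memI) (simp_all add: V0 Map_Q0 Qi)
    then show "0 \<in> Spc (induced M Q) y" by (simp add: encode_zero)
    fix s t assume s: "s \<in> Spc (induced M Q) y" and t: "t \<in> Spc (induced M Q) y"
    have "s + t = encode (\<lambda>g. if g \<in> T y then decode s g else 0) + encode (\<lambda>g. if g \<in> T y then decode t g else 0)"
      using induced_memD(4)[OF s] induced_memD(4)[OF t] by simp
    also have "\<dots> = encode (\<lambda>g. if g \<in> T y then decode (s + t) g else 0)"
      unfolding encode_add[symmetric] by (rule encode_cong) (simp add: decode_add)
    finally have e: "s + t = \<dots>" .
    show "s + t \<in> Spc (induced M Q) y"
      by (rule induced_memI'[OF e]) (simp_all add: decode_add induced_memD(1,2)[OF s] induced_memD(1,2)[OF t]
          seqs.subspace_add[OF sV] Map_Q_add Qi)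
  next
    fix c s assume s: "s \<in> Spc (induced M Q) y"
    have "seq_scale c s = seq_scale c (encode (\<lambda>g. if g \<in> T y then decode s g else 0))"
      using induced_memD(4)[OF s] by simp
    also have "\<dots> = encode (\<lambda>g. if g \<in> T y then decode (seq_scale c s) g else 0)"
      unfolding encode_scale[symmetric] by (rule encode_cong) (simp add: decode_scale)
    finally have e: "seq_scale c s = \<dots>" .
    show "seq_scale c s \<in> Spc (induced M Q) y"
      by (rule induced_memI'[OF e]) (simp_all add: decode_scale induced_memD(1,2)[OF s]
          seqs.subspace_scale[OF sV] Map_Q_scale Qi)
  qed
qed

lemma induced_fd: "fd_space (Spc (induced M Q) y)"
proof (rule fd_encode[OF _ induced_subspace])
  show "fd_space (Spc M x)" using M pt_module_iff[OF FQ] by blast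
  show "Spc (induced M Q) y \<subseteq> encode ` {F. \<forall>g\<in>carrier G. F g \<in> Spc M x}"
  proof
    fix s assume s: "s \<in> Spc (induced M Q) y"
    have "(if g \<in> T y then decode s g else 0) \<in> Spc M x" for g using induced_memD(1)[OF s] V0 by simp
    then show "s \<in> encode ` {F. \<forall>g\<in>carrier G. F g \<in> Spc M x}" using induced_memD(4)[OF s] by blast
  qed
qed

lemma induced_off_Orb: "y \<notin> Orb \<Longrightarrow> Spc (induced M Q) y = {0}"
proof -
  assume "y \<notin> Orb"
  then have "T y = {}" using T_Orb by blast
  then have "s = 0" if "s \<in> Spc (induced M Q) y" for s
    using induced_memD(4)[OF that] by (simp add: encode_zero)
  then show ?thesis using seqs.subspace_0[OF induced_subspace] by blast
qed

lemma induced_Map_closed: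
  assumes a: "a \<in> A" "y \<in> X" "(\<phi> a y, z) \<in> r" and z: "z \<in> X" and s: "s \<in> Spc (induced M Q) y"
  shows "Map (induced M Q) (y, a, z) s \<in> Spc (induced M Q) z"
proof (cases "y \<in> Orb \<and> z \<in> Orb")
  case True
  then have az: "\<phi> a y = z" "y \<in> P" using Orb_antichain a Orb_P by auto
  have i: "inv a \<otimes> g \<in> T y" if "g \<in> T z" for g using T_translate_inv[OF a(1) az(2,1) that] .
  show ?thesis unfolding Map_induced
  proof (rule induced_memI)
    fix g q assume g: "g \<in> T z"
    show "decode s (inv a \<otimes> g) \<in> Spc M x" using induced_memD(1)[OF s i[OF g]] .
    assume q: "q \<in> Q"
    have "inv a \<otimes> (g \<otimes> q) = inv a \<otimes> g \<otimes> q" using a AG T_G[OF g] QG[OF q] by (simp add: m_assoc)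
    then show "decode s (inv a \<otimes> (g \<otimes> q)) = Map M (x, inv q, x) (decode s (inv a \<otimes> g))"
      using induced_memD(2)[OF s i[OF g] q] by simp
  qed
next
  case False
  have "Map (induced M Q) (y, a, z) s = 0"
  proof (cases "y \<in> Orb")
    case True
    then have "T z = {}" using False T_Orb by blast
    then show ?thesis by (simp add: Map_induced encode_zero)
  next
    case False
    then have "s = 0" using induced_off_Orb s by blast
    have "Map (induced M Q) (y, a, z) s = encode (\<lambda>g. 0)"
      unfolding Map_induced \<open>s = 0\<close> by (rule encode_cong) (simp add: decode_zero)
    then show ?thesis using encode_zero by metis
  qed
  then show ?thesis using seqs.subspace_0[OF induced_subspace] by simp
qed

text \<open>
For functoriality the critical composites start and end in the orbit but pass through some other
point \<open>z\<close>, where the module is zero. Convexity of the orbit rules them out.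
\<close>

lemma induced_module: "is_module C (induced M Q)"
  unfolding is_module_def ball_Arr_transporter
proof (intro conjI ballI impI)
  show "fd_space (Spc (induced M Q) y)" for y using induced_fd .
  show "lin_map (Spc (induced M Q) (Dom C (y, a, z))) (Spc (induced M Q) (Cod C (y, a, z))) (Map (induced M Q) (y, a, z))"
    if "y \<in> X" "a \<in> A" "z \<in> X" "(\<phi> a y, z) \<in> r" for y a z
    unfolding lin_map_def
  proof (intro conjI ballI allI)
    fix u v c
    show "u \<in> Spc (induced M Q) (Dom C (y, a, z)) \<Longrightarrow> Map (induced M Q) (y, a, z) u \<in> Spc (induced M Q) (Cod C (y, a, z))"
      using induced_Map_closed that by simp
    show "Map (induced M Q) (y, a, z) (u + v) = Map (induced M Q) (y, a, z) u + Map (induced M Q) (y, a, z) v"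
      unfolding Map_induced encode_add[symmetric] by (rule encode_cong) (simp add: decode_add)
    show "Map (induced M Q) (y, a, z) (seq_scale c v) = seq_scale c (Map (induced M Q) (y, a, z) v)"
      unfolding Map_induced encode_scale[symmetric] by (rule encode_cong) (simp add: decode_scale)
  qed
  fix y s assume s: "s \<in> Spc (induced M Q) y"
  have "Map (induced M Q) (y, \<one>, y) s = encode (\<lambda>g. if g \<in> T y then decode s g else 0)"
    unfolding Map_induced by (rule encode_cong) simp
  then show "Map (induced M Q) (Ide C y) s = s" using induced_memD(4)[OF s] by simp
next
  fix z b w y a z' s
  assume b: "z \<in> X" "b \<in> A" "w \<in> X" "(\<phi> b z, w) \<in> r" and a: "y \<in> X" "a \<in> A" "z' \<in> X" "(\<phi> a y, z') \<in> r"
    and "Dom C (z, b, w) = Cod C (y, a, z')" and s: "s \<in> Spc (induced M Q) (Dom C (y, a, z'))"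
  then have [simp]: "z' = z" and s: "s \<in> Spc (induced M Q) y" by simp_all
  have "decode s (inv (b \<otimes> a) \<otimes> g) =
      decode (encode (\<lambda>g. if g \<in> T z then decode s (inv a \<otimes> g) else 0)) (inv b \<otimes> g)" if g: "g \<in> T w" for g
  proof -
    have e: "inv (b \<otimes> a) \<otimes> g = inv a \<otimes> (inv b \<otimes> g)"
      using a b AG T_G[OF g] by (simp add: inv_mult_group m_assoc)
    have bg: "inv b \<otimes> g \<in> A" "inv a \<otimes> (inv b \<otimes> g) \<in> A" using a b T_A[OF g] Am Ai by auto
    have "decode s (inv a \<otimes> (inv b \<otimes> g)) = 0" if n: "inv b \<otimes> g \<notin> T z"
    proof (rule induced_memD(3)[OF s AG[OF bg(2)]])
      show "inv a \<otimes> (inv b \<otimes> g) \<notin> T y"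
      proof
        assume "inv a \<otimes> (inv b \<otimes> g) \<in> T y"
        then have y: "y \<in> Orb" and "\<phi> (inv a) (\<phi> (inv b \<otimes> g) x) = y"
          using T_Orb T_x phi_mult[OF xP Ai[OF a(2)] bg(1)] by auto
        then have "\<phi> a y = \<phi> (inv b \<otimes> g) x"
          using phi_inv'[OF phi_P[OF xP bg(1)] a(2)] by metis
        also have "\<dots> = \<phi> (inv b) w" using phi_mult[OF xP Ai[OF b(2)] T_A[OF g]] T_x[OF g] by simp
        finally have ay: "\<phi> a y = \<phi> (inv b) w" .
        have wP: "w \<in> P" and zP: "z \<in> P" using b XP by auto
        have "(\<phi> b (\<phi> a y), \<phi> b z) \<in> r" using phi_mono[OF b(2)] a by simp
        then have "(w, \<phi> b z) \<in> r" unfolding ay using phi_inv'[OF wP b(2)] by simp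
        then have "\<phi> b z = w" using b(4) po(2) by (meson antisymD)
        then have "inv b \<otimes> g \<in> T z" using T_translate_inv[OF b(2) zP _ g] by blast
        then show False using n by simp
      qed
    qed
    then show ?thesis unfolding e decode_encode[OF AG[OF bg(1)]] by simp
  qed
  then show "Map (induced M Q) (Cmp C (z, b, w) (y, a, z')) s
    = Map (induced M Q) (z, b, w) (Map (induced M Q) (y, a, z') s)"
    by (simp add: Map_induced cong: if_cong)
qed

lemma induced_supported: "supported (induced M Q)"
  using induced_off_Orb by (auto simp: supported_def)

lemma induced_OC: "is_module OC (induced M Q)" using C_OC induced_module .

lemma Q_T: "q \<in> Q \<Longrightarrow> q \<in> T x" using Q T_S by blast

lemma unit_map_eq: "unit_map M Q v = encode (\<lambda>g. if g \<in> T x then (if g \<in> Q then Map M (x, inv g, x) v else 0) else 0)"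
  unfolding unit_map_def by (rule encode_cong) (use Q_T in auto)

lemma decode_unit_map: "g \<in> carrier G \<Longrightarrow> decode (unit_map M Q v) g = (if g \<in> Q then Map M (x, inv g, x) v else 0)"
  by (simp add: unit_map_def decode_encode)

lemma Q_mult_iff: "g \<in> carrier G \<Longrightarrow> q \<in> Q \<Longrightarrow> g \<otimes> q \<in> Q \<longleftrightarrow> g \<in> Q"
proof
  assume g: "g \<in> carrier G" "q \<in> Q" "g \<otimes> q \<in> Q"
  then have "g \<otimes> q \<otimes> inv q \<in> Q" using subgroup.m_closed[OF Q(1)] Qi by blast
  then show "g \<in> Q" using g QG by simp
qed (use subgroup.m_closed[OF Q(1)] in blast)

lemma unit_map_in:
  assumes v: "v \<in> Spc M x" shows "unit_map M Q v \<in> Spc (induced M Q) x"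
  unfolding unit_map_eq
proof (rule induced_memI)
  fix g q assume g: "g \<in> T x"
  show "(if g \<in> Q then Map M (x, inv g, x) v else 0) \<in> Spc M x" using Map_Q_closed Qi v V0 by simp
  assume q: "q \<in> Q"
  show "(if g \<otimes> q \<in> Q then Map M (x, inv (g \<otimes> q), x) v else 0) =
    Map M (x, inv q, x) (if g \<in> Q then Map M (x, inv g, x) v else 0)"
    using Q_mult_iff[OF T_G[OF g] q] q v QG Qi by (simp add: Map_Q Map_Q0 inv_mult_group)
qed

lemma unit_map_lin: "lin_map (Spc M x) (Spc (induced M Q) x) (unit_map M Q)"
  unfolding lin_map_def
proof (intro conjI ballI allI)
  show "v \<in> Spc M x \<Longrightarrow> unit_map M Q v \<in> Spc (induced M Q) x" for v by (rule unit_map_in)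
  show "u \<in> Spc M x \<Longrightarrow> v \<in> Spc M x \<Longrightarrow> unit_map M Q (u + v) = unit_map M Q u + unit_map M Q v" for u v
    unfolding unit_map_def encode_add[symmetric] by (rule encode_cong) (simp add: Map_Q_add Qi)
  show "v \<in> Spc M x \<Longrightarrow> unit_map M Q (seq_scale c v) = seq_scale c (unit_map M Q v)" for c v
    unfolding unit_map_def encode_scale[symmetric] by (rule encode_cong) (simp add: Map_Q_scale Qi)
qed

lemma unit_map_equivariant:
  assumes b: "b \<in> Q" and v: "v \<in> Spc M x"
  shows "unit_map M Q (Map M (x, b, x) v) = Map (induced M Q) (x, b, x) (unit_map M Q v)"
  unfolding unit_map_eq[of "Map M (x, b, x) v"] Map_induced
proof (rule encode_cong)
  fix g assume g: "g \<in> carrier G"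
  have "inv b \<otimes> g \<in> Q \<longleftrightarrow> g \<in> Q"
  proof
    assume "inv b \<otimes> g \<in> Q"
    then have "b \<otimes> (inv b \<otimes> g) \<in> Q" using b subgroup.m_closed[OF Q(1)] by blast
    then show "g \<in> Q" using g QG[OF b] by simp
  qed (use b Qi subgroup.m_closed[OF Q(1)] in blast)
  then show "(if g \<in> T x then if g \<in> Q then Map M (x, inv g, x) (Map M (x, b, x) v) else 0 else 0)
    = (if g \<in> T x then decode (unit_map M Q v) (inv b \<otimes> g) else 0)"
    using b v g QG Qi by (simp add: decode_unit_map Map_Q inv_mult_group)
qed

lemma unit_map_hom: "mod_hom (pt Q) M (induced M Q) (\<lambda>_. unit_map M Q)"
  unfolding pt_hom_iff[OF FQ] using unit_map_lin unit_map_equivariant by blast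

text \<open>
Every element of the induced module is the sum of translates of its values, embedded by the unit; thus
homomorphisms out of the induced module are determined on the image of the unit.
\<close>

lemma induced_expansion:
  assumes s: "s \<in> Spc (induced M Q) y" and y: "y \<in> Orb"
  shows "s = coset_sum (T y) Q (\<lambda>g. Map (induced M Q) (x, g, y) (unit_map M Q (decode s g)))"
proof -
  note cc = T_coset_closed[OF Q, of y] and sp = induced_subspace[of y]
  have mem: "Map (induced M Q) (x, g, y) (unit_map M Q (decode s g)) \<in> Spc (induced M Q) y" if g: "g \<in> T y" for g
    using Map_closed[OF induced_OC x_Orb T_A[OF g] T_x[OF g] unit_map_in[OF induced_memD(1)[OF s g]]] .
  show ?thesis
  proof (rule induced_eqI[OF s])
    show "coset_sum (T y) Q (\<lambda>g. Map (induced M Q) (x, g, y) (unit_map M Q (decode s g))) \<in> Spc (induced M Q) y"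
      by (rule coset_sum_mem[OF cc]) (use mem seqs.subspace_0[OF sp] seqs.subspace_add[OF sp] in auto)
    fix h assume h: "h \<in> T y"
    define E where "E g = (if inv g \<otimes> h \<in> Q then Map M (x, inv (inv g \<otimes> h), x) (decode s g) else 0)" for g
    have "decode (coset_sum (T y) Q (\<lambda>g. Map (induced M Q) (x, g, y) (unit_map M Q (decode s g)))) h
      = coset_sum (T y) Q (\<lambda>g. decode (Map (induced M Q) (x, g, y) (unit_map M Q (decode s g))) h)"
      by (rule coset_sum_additive[of "\<lambda>s. decode s h"]) (rule decode_zero, rule decode_add)
    also have "\<dots> = coset_sum (T y) Q E"
      by (rule coset_sum_cong[OF cc]) (use h T_G in \<open>simp add: decode_Map_induced decode_unit_map E_def\<close>)
    also have "\<dots> = E h"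
    proof (rule coset_sum_single[OF cc h])
      fix q assume q: "q \<in> Q"
      have "inv (h \<otimes> q) \<otimes> h = inv q" using T_G[OF h] QG[OF q] by (simp add: inv_mult_group m_assoc)
      then have "E (h \<otimes> q) = Map M (x, q, x) (Map M (x, inv q, x) (decode s h))"
        using q Qi QG induced_memD(2)[OF s h q] by (simp add: E_def)
      also have "\<dots> = decode s h" using q Qi QG induced_memD(1)[OF s h] by (simp add: Map_Q Map_Q1)
      also have "\<dots> = E h" using T_G[OF h] Q1 induced_memD(1)[OF s h] by (simp add: E_def Map_Q1)
      finally show "E (h \<otimes> q) = E h" .
    next
      fix g assume g: "g \<in> T y" "inv h \<otimes> g \<notin> Q"
      have "inv g \<otimes> h \<notin> Q"
      proof
        assume "inv g \<otimes> h \<in> Q"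
        then have "inv (inv g \<otimes> h) \<in> Q" by (rule Qi)
        then show False using g T_G[OF h] T_G[OF g(1)] by (simp add: inv_mult_group)
      qed
      then show "E g = 0" by (simp add: E_def)
    qed
    also have "\<dots> = decode s h" using T_G[OF h] Q1 induced_memD(1)[OF s h] by (simp add: E_def Map_Q1)
    finally show "decode s h = decode (coset_sum (T y) Q (\<lambda>g. Map (induced M Q) (x, g, y) (unit_map M Q (decode s g)))) h" ..
  qed
qed

context
  fixes N :: "('x, 'x \<times> 'a \<times> 'x, 'k) kmod" and \<theta>
  assumes N: "is_module OC N" and \<theta>: "mod_hom (pt Q) M N \<theta>"
begin

lemma theta_lin: "lin_map (Spc M x) (Spc N x) (\<theta> x)"
  and theta_eq: "b \<in> Q \<Longrightarrow> v \<in> Spc M x \<Longrightarrow> \<theta> x (Map M (x, b, x) v) = Map N (x, b, x) (\<theta> x v)"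
  using \<theta> pt_hom_iff[OF FQ] by blast+

lemma kan_lift_summand_in:
  assumes "s \<in> Spc (induced M Q) y" "g \<in> T y"
  shows "Map N (x, g, y) (\<theta> x (decode s g)) \<in> Spc N y" "\<theta> x (decode s g) \<in> Spc N x"
proof -
  show 1: "\<theta> x (decode s g) \<in> Spc N x"
    using theta_lin induced_memD(1)[OF assms] by (simp add: lin_map_def)
  show "Map N (x, g, y) (\<theta> x (decode s g)) \<in> Spc N y"
    using Map_closed[OF N x_Orb T_A[OF assms(2)] T_x[OF assms(2)] 1] .
qed

lemma kan_lift_summand_invariant:
  assumes s: "s \<in> Spc (induced M Q) y" and g: "g \<in> T y" and q: "q \<in> Q"
  shows "Map N (x, g \<otimes> q, y) (\<theta> x (decode s (g \<otimes> q))) = Map N (x, g, y) (\<theta> x (decode s g))"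
proof -
  note w = kan_lift_summand_in(2)[OF s g]
  have w': "Map N (x, inv q, x) (\<theta> x (decode s g)) \<in> Spc N x"
    using Map_closed[OF N x_Orb Ai[OF QA(1)[OF q]] _ w] QA(2)[OF Qi[OF q]] by blast
  have "Map N (x, g \<otimes> q, y) (\<theta> x (decode s (g \<otimes> q)))
    = Map N (x, g \<otimes> q, y) (Map N (x, inv q, x) (\<theta> x (decode s g)))"
    using induced_memD[OF s] g q Qi theta_eq by simp
  also have "\<dots> = Map N (x, g, y) (Map N (x, q, x) (Map N (x, inv q, x) (\<theta> x (decode s g))))"
    using Map_Map[OF N x_Orb QA(1)[OF q] T_A[OF g] QA(2)[OF q] T_x[OF g] w'] by simp
  also have "Map N (x, q, x) (Map N (x, inv q, x) (\<theta> x (decode s g))) = \<theta> x (decode s g)"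
    using Map_inv'[OF N x_Orb QA(1)[OF q] QA(2)[OF q] w] .
  finally show ?thesis .
qed

lemma kan_lift_lin:
  assumes y: "y \<in> Orb"
  shows "lin_map (Spc (induced M Q) y) (Spc N y) (kan_lift N Q (\<theta> x) y)"
proof -
  note cc = T_coset_closed[OF Q, of y] and sp = subspace_Orb[OF N y]
  have l: "lin_map (Spc M x) (Spc N y) (\<lambda>v. Map N (x, g, y) (\<theta> x v))" if "g \<in> T y" for g
    using lin_map_comp[OF theta_lin lin_map_Orb[OF N x_Orb T_A[OF that] T_x[OF that]]] .
  show ?thesis unfolding lin_map_def kan_lift_def
  proof (intro conjI ballI allI)
    fix s assume s: "s \<in> Spc (induced M Q) y"
    show "coset_sum (T y) Q (\<lambda>g. Map N (x, g, y) (\<theta> x (decode s g))) \<in> Spc N y"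
      by (rule coset_sum_mem[OF cc])
        (use kan_lift_summand_in[OF s] seqs.subspace_0[OF sp] seqs.subspace_add[OF sp] in auto)
    fix c
    have "seq_scale c (coset_sum (T y) Q (\<lambda>g. Map N (x, g, y) (\<theta> x (decode s g))))
      = coset_sum (T y) Q (\<lambda>g. seq_scale c (Map N (x, g, y) (\<theta> x (decode s g))))"
      by (rule coset_sum_additive[of "seq_scale c"]) (rule seqs.scale_zero_right, rule seqs.scale_right_distrib)
    also have "\<dots> = coset_sum (T y) Q (\<lambda>g. Map N (x, g, y) (\<theta> x (decode (seq_scale c s) g)))"
      by (rule coset_sum_cong[OF cc]) (use l induced_memD(1)[OF s] in \<open>simp add: decode_scale lin_map_def\<close>)
    finally show "coset_sum (T y) Q (\<lambda>g. Map N (x, g, y) (\<theta> x (decode (seq_scale c s) g)))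
      = seq_scale c (coset_sum (T y) Q (\<lambda>g. Map N (x, g, y) (\<theta> x (decode s g))))" ..
    fix t assume t: "t \<in> Spc (induced M Q) y"
    show "coset_sum (T y) Q (\<lambda>g. Map N (x, g, y) (\<theta> x (decode (s + t) g)))
      = coset_sum (T y) Q (\<lambda>g. Map N (x, g, y) (\<theta> x (decode s g))) + coset_sum (T y) Q (\<lambda>g. Map N (x, g, y) (\<theta> x (decode t g)))"
      unfolding coset_sum_add[symmetric]
      by (rule coset_sum_cong[OF cc])
        (use l induced_memD(1)[OF s] induced_memD(1)[OF t] in \<open>simp add: decode_add lin_map_def\<close>)
  qed
qed

lemma kan_lift_natural:
  assumes y: "y \<in> Orb" and a: "a \<in> A" and z: "z = \<phi> a y" and s: "s \<in> Spc (induced M Q) y"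
  shows "kan_lift N Q (\<theta> x) z (Map (induced M Q) (y, a, z) s) = Map N (y, a, z) (kan_lift N Q (\<theta> x) y s)"
proof -
  note yP = Orb_P[OF y]
  have zO: "z \<in> Orb" using z y a Orb_phi by simp
  note cc = T_coset_closed[OF Q, of y] and cz = T_coset_closed[OF Q, of z] and sp = subspace_Orb[OF N y]
  have s': "Map (induced M Q) (y, a, z) s \<in> Spc (induced M Q) z"
    using Map_closed[OF induced_OC y a z[symmetric] s] .
  have at: "a \<otimes> g \<in> T z" if "g \<in> T y" for g using T_translate[OF a yP z[symmetric]] that by blast
  define E where "E g = Map N (x, g, z) (\<theta> x (decode (Map (induced M Q) (y, a, z) s) g))" for g
  have "coset_sum (T z) Q E = coset_sum ((\<lambda>g. a \<otimes> g) ` T y) Q E"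
    using T_translate[OF a yP z[symmetric]] by simp
  also have "\<dots> = coset_sum (T y) Q (\<lambda>g. E (a \<otimes> g))"
  proof (rule coset_sum_translate[OF cc AG[OF a]])
    fix g q assume g: "g \<in> T y" and q: "q \<in> Q"
    have "E (a \<otimes> g \<otimes> q) = E (a \<otimes> g)"
      unfolding E_def using kan_lift_summand_invariant[OF s' at[OF g] q] .
    then show "E (a \<otimes> (g \<otimes> q)) = E (a \<otimes> g)" using AG[OF a] T_G[OF g] QG[OF q] by (simp add: m_assoc)
  qed
  also have "\<dots> = coset_sum (T y) Q (\<lambda>g. Map N (y, a, z) (Map N (x, g, y) (\<theta> x (decode s g))))"
  proof (rule coset_sum_cong[OF cc])
    fix g assume g: "g \<in> T y"
    have "E (a \<otimes> g) = Map N (x, a \<otimes> g, z) (\<theta> x (decode s g))"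
      unfolding E_def decode_Map_induced[OF at[OF g]] using AG[OF a] T_G[OF g] by simp
    also have "\<dots> = Map N (y, a, z) (Map N (x, g, y) (\<theta> x (decode s g)))"
      using Map_Map[OF N x_Orb T_A[OF g] a T_x[OF g] z[symmetric] kan_lift_summand_in(2)[OF s g]] by simp
    finally show "E (a \<otimes> g) = Map N (y, a, z) (Map N (x, g, y) (\<theta> x (decode s g)))" .
  qed
  also have "\<dots> = Map N (y, a, z) (coset_sum (T y) Q (\<lambda>g. Map N (x, g, y) (\<theta> x (decode s g))))"
    by (rule coset_sum_additive_on[where h = "Map N (y, a, z)", OF cc seqs.subspace_0[OF sp]
          seqs.subspace_add[OF sp] kan_lift_summand_in(1)[OF s] Map_zero[OF N y a z[symmetric]], symmetric])
      (use lin_map_Orb[OF N y a z[symmetric]] in \<open>simp_all add: lin_map_def\<close>)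
  finally show ?thesis unfolding kan_lift_def E_def .
qed

lemma kan_lift_hom: "mod_hom OC (induced M Q) N (kan_lift N Q (\<theta> x))"
proof -
  have "\<theta>' (Cod OC b) (Map (induced M Q) b v) = Map N b (\<theta>' (Dom OC b) v)"
    if "b \<in> Arr OC" "v \<in> Spc (induced M Q) (Dom OC b)" "\<theta>' = kan_lift N Q (\<theta> x)" for b v \<theta>'
  proof -
    obtain y a z where b: "b = (y, a, z)" by (cases b)
    then have "y \<in> Orb" "a \<in> A" "z = \<phi> a y" using that OC_arr_iff by blast+
    then show ?thesis using that kan_lift_natural[of y a z v] by (simp add: b)
  qed
  then show ?thesis unfolding mod_hom_def using kan_lift_lin by simp
qed

lemma kan_lift_unit_map:
  assumes v: "v \<in> Spc M x" shows "kan_lift N Q (\<theta> x) x (unit_map M Q v) = \<theta> x v"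
proof -
  note cc = T_coset_closed[OF Q, of x] and s = unit_map_in[OF v]
  have 1: "\<one> \<in> T x" using T_S fixing_S subgroup.one_closed by (auto simp: fixing_def)
  define E where "E g = Map N (x, g, x) (\<theta> x (decode (unit_map M Q v) g))" for g
  have "coset_sum (T x) Q E = E \<one>"
  proof (rule coset_sum_single[OF cc 1])
    fix q assume q: "q \<in> Q"
    show "E (\<one> \<otimes> q) = E \<one>" unfolding E_def using kan_lift_summand_invariant[OF s 1 q] .
  next
    fix h assume h: "h \<in> T x" "inv \<one> \<otimes> h \<notin> Q"
    then have "decode (unit_map M Q v) h = 0" using T_G by (simp add: decode_unit_map)
    then have "E h = Map N (x, h, x) 0"
      unfolding E_def using lin_map_zero[OF theta_lin subspace_pt[OF FQ M]] by simp
    then show "E h = 0" using Map_zero[OF N x_Orb T_A[OF h(1)] T_x[OF h(1)]] by simp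
  qed
  also have "\<dots> = \<theta> x v"
    using v Q1 Map_one[OF N x_Orb, of "\<theta> x v"] theta_lin
    by (simp add: E_def decode_unit_map Map_Q1 lin_map_def)
  finally show ?thesis unfolding kan_lift_def E_def .
qed

lemma kan_lift_unique:
  assumes \<xi>: "mod_hom OC (induced M Q) N \<xi>" and u: "\<And>v. v \<in> Spc M x \<Longrightarrow> \<xi> x (unit_map M Q v) = \<theta> x v"
    and y: "y \<in> Orb" and s: "s \<in> Spc (induced M Q) y"
  shows "\<xi> y s = kan_lift N Q (\<theta> x) y s"
proof -
  note cc = T_coset_closed[OF Q, of y] and sp = induced_subspace[of y]
  have lin: "lin_map (Spc (induced M Q) y) (Spc N y) (\<xi> y)" using \<xi> y by (simp add: mod_hom_def)
  have nat: "\<xi> y (Map (induced M Q) (x, g, y) w) = Map N (x, g, y) (\<xi> x w)"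
    if "g \<in> T y" "w \<in> Spc (induced M Q) x" for g w
  proof -
    have "(x, g, y) \<in> Arr OC" using that T_A T_x x_Orb OC_arr_iff by blast
    moreover have "\<forall>a\<in>Arr OC. \<forall>v\<in>Spc (induced M Q) (Dom OC a).
        \<xi> (Cod OC a) (Map (induced M Q) a v) = Map N a (\<xi> (Dom OC a) v)"
      using \<xi> by (simp add: mod_hom_def)
    ultimately have "\<forall>v\<in>Spc (induced M Q) (Dom OC (x, g, y)).
        \<xi> (Cod OC (x, g, y)) (Map (induced M Q) (x, g, y) v) = Map N (x, g, y) (\<xi> (Dom OC (x, g, y)) v)"
      by blast
    then show ?thesis using that(2) by simp
  qed
  have mem: "Map (induced M Q) (x, g, y) (unit_map M Q (decode s g)) \<in> Spc (induced M Q) y" if g: "g \<in> T y" for g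
    using Map_closed[OF induced_OC x_Orb T_A[OF g] T_x[OF g] unit_map_in[OF induced_memD(1)[OF s g]]] .
  have "\<xi> y s = \<xi> y (coset_sum (T y) Q (\<lambda>g. Map (induced M Q) (x, g, y) (unit_map M Q (decode s g))))"
    using induced_expansion[OF s y] by simp
  also have "\<dots> = coset_sum (T y) Q (\<lambda>g. \<xi> y (Map (induced M Q) (x, g, y) (unit_map M Q (decode s g))))"
    by (rule coset_sum_additive_on[where h = "\<xi> y", OF cc seqs.subspace_0[OF sp] seqs.subspace_add[OF sp] mem
          lin_map_zero[OF lin sp]])
      (use lin in \<open>simp_all add: lin_map_def\<close>)
  also have "\<dots> = kan_lift N Q (\<theta> x) y s" unfolding kan_lift_def
    by (rule coset_sum_cong[OF cc]) (use nat unit_map_in induced_memD(1)[OF s] u in simp)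
  finally show ?thesis .
qed

end

theorem induced_left_kan_ext: "left_kan_ext OC (pt Q) M (induced M Q) (\<lambda>_. unit_map M Q)"
  unfolding left_kan_ext_def
proof (intro conjI allI impI)
  show "is_module OC (induced M Q)" by (rule induced_OC)
  show "mod_hom (pt Q) M (induced M Q) (\<lambda>_. unit_map M Q)" by (rule unit_map_hom)
  fix N and \<theta> :: "'x \<Rightarrow> (nat \<Rightarrow> 'k) \<Rightarrow> nat \<Rightarrow> 'k" assume a: "is_module OC N \<and> mod_hom (pt Q) M N \<theta>"
  then have N: "is_module OC N" and \<theta>: "mod_hom (pt Q) M N \<theta>" by auto
  show "\<exists>\<xi>. mod_hom OC (induced M Q) N \<xi> \<and> (\<forall>x'\<in>Obj (pt Q). \<forall>v\<in>Spc M x'. \<xi> x' (unit_map M Q v) = \<theta> x' v) \<and>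
    (\<forall>\<xi>'. mod_hom OC (induced M Q) N \<xi>' \<and> (\<forall>x'\<in>Obj (pt Q). \<forall>v\<in>Spc M x'. \<xi>' x' (unit_map M Q v) = \<theta> x' v)
      \<longrightarrow> (\<forall>x'\<in>Obj OC. \<forall>v\<in>Spc (induced M Q) x'. \<xi>' x' v = \<xi> x' v))"
  proof (intro exI[of _ "kan_lift N Q (\<theta> x)"] conjI ballI allI impI)
    show "mod_hom OC (induced M Q) N (kan_lift N Q (\<theta> x))" by (rule kan_lift_hom[OF N \<theta>])
    fix x' v
    show "x' \<in> Obj (pt Q) \<Longrightarrow> v \<in> Spc M x' \<Longrightarrow> kan_lift N Q (\<theta> x) x' (unit_map M Q v) = \<theta> x' v"
      using kan_lift_unit_map[OF N \<theta>] by auto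
    fix \<xi>' assume "mod_hom OC (induced M Q) N \<xi>' \<and>
      (\<forall>x'\<in>Obj (pt Q). \<forall>v\<in>Spc M x'. \<xi>' x' (unit_map M Q v) = \<theta> x' v)"
    then have h: "mod_hom OC (induced M Q) N \<xi>'" "\<And>v. v \<in> Spc M x \<Longrightarrow> \<xi>' x (unit_map M Q v) = \<theta> x v"
      by simp_all
    show "x' \<in> Obj OC \<Longrightarrow> v \<in> Spc (induced M Q) x' \<Longrightarrow> \<xi>' x' v = kan_lift N Q (\<theta> x) x' v"
      using kan_lift_unique[OF N \<theta> h] by simp
  qed
qed

end

end

section \<open>Isomorphism classes of modules\<close>

lemma mod_hom_comp:
  assumes f: "mod_hom C M N f" and g: "mod_hom C N N' g"
    and C: "\<And>a. a \<in> Arr C \<Longrightarrow> Dom C a \<in> Obj C \<and> Cod C a \<in> Obj C"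
  shows "mod_hom C M N' (\<lambda>y v. g y (f y v))"
proof -
  have "f (Dom C a) v \<in> Spc N (Dom C a)" if "a \<in> Arr C" "v \<in> Spc M (Dom C a)" for a v
    using f C[OF that(1)] that(2) by (auto simp: mod_hom_def lin_map_def)
  then show ?thesis using assms lin_map_comp unfolding mod_hom_def by fastforce
qed

lemma mod_hom_id: "mod_hom C M M (\<lambda>_ v. v)"
  if "\<And>a. a \<in> Arr C \<Longrightarrow> Dom C a \<in> Obj C \<and> Cod C a \<in> Obj C"
  by (simp add: mod_hom_def lin_map_def)

lemma transporter_closed:
  "a \<in> Arr (transporter G r \<phi> Q H) \<Longrightarrow>
    Dom (transporter G r \<phi> Q H) a \<in> Obj (transporter G r \<phi> Q H) \<and>
    Cod (transporter G r \<phi> Q H) a \<in> Obj (transporter G r \<phi> Q H)"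
  by (cases a) simp

lemma mod_iso_rel_refl:
  "is_module C M \<Longrightarrow> (\<And>a. a \<in> Arr C \<Longrightarrow> Dom C a \<in> Obj C \<and> Cod C a \<in> Obj C) \<Longrightarrow> (M, M) \<in> mod_iso_rel C"
  unfolding mod_iso_rel_def mod_iso_def using mod_hom_id by fastforce

lemma mod_iso_rel_sym: "(M, N) \<in> mod_iso_rel C \<Longrightarrow> (N, M) \<in> mod_iso_rel C"
  unfolding mod_iso_rel_def mod_iso_def by blast

lemma mod_iso_rel_trans:
  assumes "(M, N) \<in> mod_iso_rel C" "(N, N') \<in> mod_iso_rel C"
    and C: "\<And>a. a \<in> Arr C \<Longrightarrow> Dom C a \<in> Obj C \<and> Cod C a \<in> Obj C"
  shows "(M, N') \<in> mod_iso_rel C"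
proof -
  obtain f g where f: "mod_hom C M N f" "mod_hom C N M g"
    "\<And>x v. x \<in> Obj C \<Longrightarrow> v \<in> Spc M x \<Longrightarrow> g x (f x v) = v" "\<And>x v. x \<in> Obj C \<Longrightarrow> v \<in> Spc N x \<Longrightarrow> f x (g x v) = v"
    using assms(1) by (auto simp: mod_iso_rel_def mod_iso_def)
  obtain h k where h: "mod_hom C N N' h" "mod_hom C N' N k"
    "\<And>x v. x \<in> Obj C \<Longrightarrow> v \<in> Spc N x \<Longrightarrow> k x (h x v) = v" "\<And>x v. x \<in> Obj C \<Longrightarrow> v \<in> Spc N' x \<Longrightarrow> h x (k x v) = v"
    using assms(2) by (auto simp: mod_iso_rel_def mod_iso_def)
  have cl: "f x v \<in> Spc N x" if "x \<in> Obj C" "v \<in> Spc M x" for x v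
    using f(1) that by (auto simp: mod_hom_def lin_map_def)
  have cl': "k x v \<in> Spc N x" if "x \<in> Obj C" "v \<in> Spc N' x" for x v
    using h(2) that by (auto simp: mod_hom_def lin_map_def)
  have "mod_iso C M N'" unfolding mod_iso_def
  proof (intro exI conjI ballI)
    show "mod_hom C M N' (\<lambda>y v. h y (f y v))" using mod_hom_comp[OF f(1) h(1) C] .
    show "mod_hom C N' M (\<lambda>y v. g y (k y v))" using mod_hom_comp[OF h(2) f(2) C] .
  qed (use f h cl cl' in simp_all)
  then show ?thesis using assms by (simp add: mod_iso_rel_def)
qed

lemma quotient_bijection:
  assumes r: "sym r" "trans r" "\<And>a. a \<in> A \<Longrightarrow> (a, a) \<in> r"
    and s: "sym s" "trans s" "\<And>b. b \<in> B \<Longrightarrow> (b, b) \<in> s"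
    and AB: "\<And>a. a \<in> A \<Longrightarrow> \<exists>b\<in>B. R a b" and BA: "\<And>b. b \<in> B \<Longrightarrow> \<exists>a\<in>A. R a b"
    and iff: "\<And>a a' b b'. a \<in> A \<Longrightarrow> a' \<in> A \<Longrightarrow> b \<in> B \<Longrightarrow> b' \<in> B \<Longrightarrow> R a b \<Longrightarrow> R a' b' \<Longrightarrow>
      (a, a') \<in> r \<longleftrightarrow> (b, b') \<in> s"
  shows "\<exists>f. bij_betw f (A // r) (B // s)"
proof -
  define g where "g a = (SOME b. b \<in> B \<and> R a b)" for a
  have g: "g a \<in> B" "R a (g a)" if "a \<in> A" for a
    using someI_ex[of "\<lambda>b. b \<in> B \<and> R a b"] AB[OF that] unfolding g_def by blast+
  define c where "c X = (SOME a. a \<in> A \<and> X = r `` {a})" for X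
  have c: "c X \<in> A" "X = r `` {c X}" if "X \<in> A // r" for X
    using someI_ex[of "\<lambda>a. a \<in> A \<and> X = r `` {a}"] that unfolding c_def quotient_def by blast+
  have req: "r `` {a} = r `` {a'} \<longleftrightarrow> (a, a') \<in> r" if "a \<in> A" "a' \<in> A" for a a'
  proof
    assume "r `` {a} = r `` {a'}"
    then show "(a, a') \<in> r" using r(3)[OF that(2)] by blast
  next
    assume "(a, a') \<in> r"
    then show "r `` {a} = r `` {a'}" using r(1,2) unfolding sym_def trans_def by blast
  qed
  have seq: "s `` {a} = s `` {a'} \<longleftrightarrow> (a, a') \<in> s" if "a \<in> B" "a' \<in> B" for a a'
  proof
    assume "s `` {a} = s `` {a'}"
    then show "(a, a') \<in> s" using s(3)[OF that(2)] by blast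
  next
    assume "(a, a') \<in> s"
    then show "s `` {a} = s `` {a'}" using s(1,2) unfolding sym_def trans_def by blast
  qed
  have "bij_betw (\<lambda>X. s `` {g (c X)}) (A // r) (B // s)"
  proof (rule bij_betw_imageI)
    show "inj_on (\<lambda>X. s `` {g (c X)}) (A // r)"
    proof (rule inj_onI)
      fix X Y assume XY: "X \<in> A // r" "Y \<in> A // r" "s `` {g (c X)} = s `` {g (c Y)}"
      note cX = c[OF XY(1)] and cY = c[OF XY(2)]
      have "(g (c X), g (c Y)) \<in> s" using XY(3) seq[OF g(1)[OF cX(1)] g(1)[OF cY(1)]] by simp
      then have "(c X, c Y) \<in> r"
        using iff[OF cX(1) cY(1) g(1)[OF cX(1)] g(1)[OF cY(1)] g(2)[OF cX(1)] g(2)[OF cY(1)]] by simp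
      then show "X = Y" using req[OF cX(1) cY(1)] cX(2) cY(2) by simp
    qed
    show "(\<lambda>X. s `` {g (c X)}) ` (A // r) = B // s"
    proof
      show "(\<lambda>X. s `` {g (c X)}) ` (A // r) \<subseteq> B // s"
      proof
        fix Y assume "Y \<in> (\<lambda>X. s `` {g (c X)}) ` (A // r)"
        then obtain X where "X \<in> A // r" "Y = s `` {g (c X)}" by blast
        then show "Y \<in> B // s" using quotientI[OF g(1)[OF c(1)]] by simp
      qed
      show "B // s \<subseteq> (\<lambda>X. s `` {g (c X)}) ` (A // r)"
      proof
        fix Y assume "Y \<in> B // s"
        then obtain b where b: "b \<in> B" "Y = s `` {b}" by (auto simp: quotient_def)
        obtain a where a: "a \<in> A" "R a b" using BA b by blast
        have X: "r `` {a} \<in> A // r" using a by (simp add: quotientI)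
        note cX = c[OF X]
        have "(a, c (r `` {a})) \<in> r" using cX(2) req[OF a(1) cX(1)] by simp
        then have "(b, g (c (r `` {a}))) \<in> s"
          using iff[OF a(1) cX(1) b(1) g(1)[OF cX(1)] a(2) g(2)[OF cX(1)]] by simp
        then have "Y = s `` {g (c (r `` {a}))}" using b(2) seq[OF b(1) g(1)[OF cX(1)]] by simp
        then show "Y \<in> (\<lambda>X. s `` {g (c X)}) ` (A // r)" using X by blast
      qed
    qed
  qed
  then show ?thesis by blast
qed

section \<open>Relative projectivity over an orbit\<close>

context orbit_cat
begin

lemma convex_obs_Orb: "convex_obs C Orb"
  unfolding convex_obs_def ball_Arr_transporter
proof (intro conjI ballI impI)
  show "Orb \<subseteq> Obj C" using Orb_X by simp
  fix z g w y h z'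
  assume g: "z \<in> X" "g \<in> A" "w \<in> X" "(\<phi> g z, w) \<in> r" and h: "y \<in> X" "h \<in> A" "z' \<in> X" "(\<phi> h y, z') \<in> r"
    and "Dom C (z, g, w) = Cod C (y, h, z') \<and> Dom C (y, h, z') \<in> Orb \<and> Cod C (z, g, w) \<in> Orb"
  then have [simp]: "z' = z" and y: "y \<in> Orb" and w: "w \<in> Orb" by simp_all
  have zP: "z \<in> P" using g XP by blast
  have 1: "(\<phi> g (\<phi> h y), \<phi> g z) \<in> r" using phi_mono[OF g(2)] h by simp
  then have "(\<phi> g (\<phi> h y), w) \<in> r" using g po(3) by (meson transD)
  then have "\<phi> g (\<phi> h y) = w" using Orb_antichain[OF Orb_phi[OF y h(2)] w g(2)] by blast
  then have "\<phi> g z = w" using 1 g po(2) by (metis antisymD)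
  then have "z = \<phi> (inv g) w" using phi_inv[OF zP g(2)] by simp
  then show "Dom C (z, g, w) \<in> Orb" using Orb_phi[OF w Ai[OF g(2)]] by simp
qed

lemma full_subcat_Orb: "full_subcat C Orb = OC"
  using Orb_X by (auto simp: full_subcat_def transporter_def)

lemma convex_supp_eq:
  assumes "supp_obs C M = Orb" shows "convex_supp C M = OC"
proof -
  have "\<Inter> {Y. convex_obs C Y \<and> supp_obs C M \<subseteq> Y} = Orb" using convex_obs_Orb assms by auto
  then show ?thesis unfolding convex_supp_def by (simp add: full_subcat_Orb)
qed

lemma supp_iff: "supp C M = OC \<longleftrightarrow> supp_obs C M = Orb"
proof
  assume "supp C M = OC"
  then have "Obj (supp C M) = Obj OC" by simp
  then show "supp_obs C M = Orb" by (simp add: supp_def full_subcat_def)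
qed (simp add: supp_def full_subcat_Orb)

lemma subcat_pt: "Q \<subseteq> S \<Longrightarrow> subcat (pt Q) OC"
  unfolding subcat_def using x_Orb by (auto simp: transporter_def S_def)

text \<open>
If the counit splits, compare the given Kan extension with the explicit one and evaluate the
splitting at \<open>\<one>\<close>: this is an endomorphism over \<open>Q\<close> with trace the identity. Conversely, an
endomorphism \<open>f\<close> over \<open>Q\<close> with trace the identity gives the splitting that sends \<open>m\<close> to the function
\<open>g \<mapsto> f(g\<inverse> m)\<close>.
\<close>

theorem higman:
  assumes M: "is_module C M" and supp: "supp_obs C M = Orb" and Q: "subgroup Q G" "Q \<subseteq> S"
  shows "rel_projective C M (pt Q) \<longleftrightarrow> rel_proj S Q (mrep M x)"
proof
  note m = C_OC[OF M] and ms = OC_pt[OF C_OC[OF M]] and FQ = fixing_sub[OF Q]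
  have mq: "is_module (pt Q) M" using pt_module_mono[OF ms fixing_S FQ Q(2)] .
  note kan = induced_left_kan_ext[OF Q mq]
  have idQ: "mod_hom (pt Q) M M (\<lambda>_ v. v)" using mod_hom_id transporter_closed by metis
  define \<epsilon>0 where "\<epsilon>0 = kan_lift M Q (\<lambda>v. v)"
  have e0: "mod_hom OC (induced M Q) M \<epsilon>0" unfolding \<epsilon>0_def using kan_lift_hom[OF Q mq m idQ] .
  have e0u: "\<epsilon>0 x (unit_map M Q v) = v" if "v \<in> Spc M x" for v
    unfolding \<epsilon>0_def using kan_lift_unit_map[OF Q mq m idQ that] .
  have STx: "T x = S" by (rule T_S)
  have SQ: "coset_closed S Q" using T_coset_closed[OF Q, of x] T_S by simp
  have sV: "seqs.subspace (Spc M x)" using subspace_pt[OF fixing_S ms] .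
  {
    assume "rel_projective C M (pt Q)"
    then obtain N \<epsilon> \<eta> \<sigma> where kN: "left_kan_ext OC (pt Q) M N \<eta>" and \<epsilon>: "mod_hom OC N M \<epsilon>"
      and \<epsilon>\<eta>: "\<And>v. v \<in> Spc M x \<Longrightarrow> \<epsilon> x (\<eta> x v) = v"
      and \<sigma>: "mod_hom OC M N \<sigma>" and \<epsilon>\<sigma>: "\<And>y v. y \<in> Orb \<Longrightarrow> v \<in> Spc M y \<Longrightarrow> \<epsilon> y (\<sigma> y v) = v"
      unfolding rel_projective_def is_counit_def split_surj_def convex_supp_eq[OF supp] by auto
    have N: "is_module OC N" using kN by (simp add: left_kan_ext_def)
    have universal: "\<exists>\<xi>. mod_hom OC N N' \<xi> \<and> (\<forall>v\<in>Spc M x. \<xi> x (\<eta> x v) = \<theta> x v) \<and>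
        (\<forall>\<xi>'. mod_hom OC N N' \<xi>' \<and> (\<forall>v\<in>Spc M x. \<xi>' x (\<eta> x v) = \<theta> x v)
          \<longrightarrow> (\<forall>y\<in>Orb. \<forall>v\<in>Spc N y. \<xi>' y v = \<xi> y v))"
      if "is_module OC N'" "mod_hom (pt Q) M N' \<theta>" for N' \<theta>
    proof -
      have "\<exists>\<xi>. mod_hom OC N N' \<xi> \<and> (\<forall>y\<in>Obj (pt Q). \<forall>v\<in>Spc M y. \<xi> y (\<eta> y v) = \<theta> y v) \<and>
        (\<forall>\<xi>'. mod_hom OC N N' \<xi>' \<and> (\<forall>y\<in>Obj (pt Q). \<forall>v\<in>Spc M y. \<xi>' y (\<eta> y v) = \<theta> y v)
          \<longrightarrow> (\<forall>y\<in>Obj OC. \<forall>v\<in>Spc N y. \<xi>' y v = \<xi> y v))"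
        using kN that unfolding left_kan_ext_def by blast
      then show ?thesis by simp
    qed
    obtain \<xi> where \<xi>: "mod_hom OC N (induced M Q) \<xi>"
      "\<And>v. v \<in> Spc M x \<Longrightarrow> \<xi> x (\<eta> x v) = unit_map M Q v"
      using universal[OF induced_OC[OF Q mq] unit_map_hom[OF Q mq]] by blast
    have c: "mod_hom OC N M (\<lambda>y v. \<epsilon>0 y (\<xi> y v))"
      using mod_hom_comp[OF \<xi>(1) e0] transporter_closed by metis
    have same: "\<epsilon> y v = \<epsilon>0 y (\<xi> y v)" if "y \<in> Orb" "v \<in> Spc N y" for y v
    proof -
      obtain \<zeta> where \<zeta>: "\<And>\<xi>'. mod_hom OC N M \<xi>' \<Longrightarrow> (\<forall>v\<in>Spc M x. \<xi>' x (\<eta> x v) = v)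
          \<Longrightarrow> (\<forall>y\<in>Orb. \<forall>v\<in>Spc N y. \<xi>' y v = \<zeta> y v)"
        using universal[OF m idQ] by blast
      have "\<epsilon> y v = \<zeta> y v" using \<zeta>[OF \<epsilon>] \<epsilon>\<eta> that by blast
      moreover have "\<epsilon>0 y (\<xi> y v) = \<zeta> y v" using \<zeta>[OF c] \<xi>(2) e0u that by simp
      ultimately show ?thesis by simp
    qed
    define \<tau> where "\<tau> y v = \<xi> y (\<sigma> y v)" for y v
    have \<tau>: "mod_hom OC M (induced M Q) \<tau>"
      unfolding \<tau>_def using mod_hom_comp[OF \<sigma> \<xi>(1)] transporter_closed by metis
    have \<tau>lin: "lin_map (Spc M x) (Spc (induced M Q) x) (\<tau> x)" using \<tau> x_Orb by (simp add: mod_hom_def)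
    have \<tau>nat: "\<tau> x (Map M (x, g, x) v) = Map (induced M Q) (x, g, x) (\<tau> x v)" if "g \<in> S" "v \<in> Spc M x" for g v
    proof -
      have "(x, g, x) \<in> Arr OC" using that(1) x_Orb refl_x by (simp add: S_def)
      then have "\<forall>v\<in>Spc M (Dom OC (x, g, x)). \<tau> (Cod OC (x, g, x)) (Map M (x, g, x) v) =
          Map (induced M Q) (x, g, x) (\<tau> (Dom OC (x, g, x)) v)"
        using \<tau> unfolding mod_hom_def by blast
      then show ?thesis using that(2) by simp
    qed
    have one: "\<one> \<in> S" using fixing_S subgroup.one_closed by (auto simp: fixing_def)
    have Si: "inv g \<in> S" if "g \<in> S" for g using that fixing_S subgroup.m_inv_closed by (auto simp: fixing_def)
    have SG: "g \<in> carrier G" if "g \<in> S" for g using that AG by (simp add: S_def)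
    have \<tau>in: "\<tau> x v \<in> Spc (induced M Q) x" if "v \<in> Spc M x" for v using \<tau>lin that by (simp add: lin_map_def)
    define f where "f v = decode (\<tau> x v) \<one>" for v
    have shift: "f (Map M (x, g, x) v) = decode (\<tau> x v) (inv g)" if "g \<in> S" "v \<in> Spc M x" for g v
      unfolding f_def \<tau>nat[OF that] using one STx SG[OF Si[OF that(1)]] by (simp add: decode_Map_induced)
    have flin: "lin_map (Spc M x) (Spc M x) f"
      using \<tau>lin induced_memD(1)[OF Q mq \<tau>in] one STx unfolding f_def lin_map_def
      by (simp add: decode_add decode_scale)
    have feq: "f (Map M (x, q, x) v) = Map M (x, q, x) (f v)" if "q \<in> Q" "v \<in> Spc M x" for q v
    proof -
      have q: "q \<in> S" "inv q \<in> Q" using that Q subgroup.m_inv_closed by auto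
      have "f (Map M (x, q, x) v) = decode (\<tau> x v) (\<one> \<otimes> inv q)"
        using shift[OF q(1) that(2)] SG[OF Si[OF q(1)]] by simp
      also have "\<dots> = Map M (x, q, x) (f v)"
        using induced_memD(2)[OF Q mq \<tau>in[OF that(2)], of \<one> "inv q"] one STx q SG[OF q(1)] by (simp add: f_def)
      finally show ?thesis .
    qed
    have F: "as_endo (Spc M x) f \<in> Hom Q (mrep M x) (mrep M x)"
      using as_endo_in_Hom[OF FQ mq mq flin] feq by blast
    have hin: "rel_trace S Q (mrep M x) (mrep M x) (as_endo (Spc M x) f) \<in> Hom S (mrep M x) (mrep M x)"
      using rel_trace_in_Hom[OF rep_mrep[OF fixing_S ms] rep_mrep[OF fixing_S ms] Q F] .
    have "rel_trace S Q (mrep M x) (mrep M x) (as_endo (Spc M x) f) = mrep M x \<one>"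
    proof (rule Hom_eqI[OF fixing_S ms ms hin Hom_id[OF rep_mrep[OF fixing_S ms]]])
      fix v assume v: "v \<in> Spc M x"
      have "app (rel_trace S Q (mrep M x) (mrep M x) (as_endo (Spc M x) f)) v
        = coset_sum S Q (\<lambda>g. Map M (x, g, x) (app (as_endo (Spc M x) f) (Map M (x, inv g, x) v)))"
        using app_rel_trace[OF fixing_S FQ Q(2) ms F v] .
      also have "\<dots> = coset_sum S Q (\<lambda>g. Map M (x, g, x) (decode (\<tau> x v) g))"
      proof (rule coset_sum_cong[OF SQ])
        fix g assume g: "g \<in> S"
        have "app (as_endo (Spc M x) f) (Map M (x, inv g, x) v) = decode (\<tau> x v) (inv (inv g))"
          using app_as_endo_on[OF sV flin Map_pt_closed[OF fixing_S ms Si[OF g] v]] shift[OF Si[OF g] v] by simp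
        then show "Map M (x, g, x) (app (as_endo (Spc M x) f) (Map M (x, inv g, x) v)) = Map M (x, g, x) (decode (\<tau> x v) g)"
          using SG[OF g] by simp
      qed
      also have "\<dots> = \<epsilon>0 x (\<xi> x (\<sigma> x v))" by (simp add: \<epsilon>0_def kan_lift_def STx \<tau>_def)
      also have "\<dots> = v"
      proof -
        have "\<sigma> x v \<in> Spc N x" using \<sigma> v x_Orb by (simp add: mod_hom_def lin_map_def)
        then show ?thesis using same[OF x_Orb] \<epsilon>\<sigma>[OF x_Orb v] by simp
      qed
      also have "\<dots> = app (mrep M x \<one>) v" using mrep_one[OF fixing_S ms] proj_onto(2)[OF sV v] by simp
      finally show "app (rel_trace S Q (mrep M x) (mrep M x) (as_endo (Spc M x) f)) v = app (mrep M x \<one>) v" .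
    qed
    then show "rel_proj S Q (mrep M x)" using F by (auto simp: rel_proj_def)
  next
    assume "rel_proj S Q (mrep M x)"
    then obtain f where f: "f \<in> Hom Q (mrep M x) (mrep M x)" "rel_trace S Q (mrep M x) (mrep M x) f = mrep M x \<one>"
      by (auto simp: rel_proj_def)
    note fa = Hom_app[OF FQ mq mq f(1)]
    define \<sigma> where "\<sigma> y m = encode (\<lambda>g. if g \<in> T y then app f (Map M (y, inv g, x) m) else 0)" for y m
    have SG: "g \<in> carrier G" if "g \<in> S" for g using that AG by (simp add: S_def)
    have toV: "Map M (y, inv g, x) m \<in> Spc M x" if "g \<in> T y" "m \<in> Spc M y" for y g m
      using Map_closed[OF m T_Orb[OF that(1)] Ai[OF T_A[OF that(1)]] T_inv[OF that(1)] that(2)] .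
    have \<sigma>in: "\<sigma> y m \<in> Spc (induced M Q) y" if mm: "m \<in> Spc M y" for y m
      unfolding \<sigma>_def
    proof (rule induced_memI[OF Q mq])
      fix g q assume g: "g \<in> T y"
      show "app f (Map M (y, inv g, x) m) \<in> Spc M x" using fa(2) toV[OF g mm] .
      assume q: "q \<in> Q"
      have qi: "inv q \<in> Q" "inv q \<in> S" "inv q \<in> A" "\<phi> (inv q) x = x"
        using subgroup.m_inv_closed[OF Q(1) q] Q(2) by (auto simp: S_def)
      have "Map M (y, inv (g \<otimes> q), x) m = Map M (x, inv q, x) (Map M (y, inv g, x) m)"
        using Map_Map[OF m T_Orb[OF g] Ai[OF T_A[OF g]] qi(3) T_inv[OF g] qi(4) mm]
          T_G[OF g] subgroup.mem_carrier[OF Q(1) q] by (simp add: inv_mult_group)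
      then show "app f (Map M (y, inv (g \<otimes> q), x) m) = Map M (x, inv q, x) (app f (Map M (y, inv g, x) m))"
        using fa(3)[OF qi(1) toV[OF g mm]] by simp
    qed
    have \<sigma>lin: "lin_map (Spc M y) (Spc (induced M Q) y) (\<sigma> y)" if y: "y \<in> Orb" for y
      unfolding lin_map_def
    proof (intro conjI ballI allI)
      show "v \<in> Spc M y \<Longrightarrow> \<sigma> y v \<in> Spc (induced M Q) y" for v by (rule \<sigma>in)
      have l: "lin_map (Spc M y) (Spc M x) (Map M (y, inv g, x))" if "g \<in> T y" for g
        using lin_map_Orb[OF m y Ai[OF T_A[OF that]] T_inv[OF that]] .
      show "\<sigma> y (u + v) = \<sigma> y u + \<sigma> y v" if "u \<in> Spc M y" "v \<in> Spc M y" for u v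
        unfolding \<sigma>_def encode_add[symmetric] by (rule encode_cong) (use l that in \<open>simp add: lin_map_def\<close>)
      show "\<sigma> y (seq_scale c v) = seq_scale c (\<sigma> y v)" if "v \<in> Spc M y" for c v
        unfolding \<sigma>_def encode_scale[symmetric]
        by (rule encode_cong) (use l that in \<open>simp add: lin_map_def app_scale\<close>)
    qed
    have \<sigma>nat: "\<sigma> (\<phi> a y) (Map M (y, a, \<phi> a y) v) = Map (induced M Q) (y, a, \<phi> a y) (\<sigma> y v)"
      if y: "y \<in> Orb" and a: "a \<in> A" and v: "v \<in> Spc M y" for y a v
      unfolding Map_induced \<sigma>_def[of "\<phi> a y"]
    proof (rule encode_cong)
      fix g assume "g \<in> carrier G"
      show "(if g \<in> T (\<phi> a y) then app f (Map M (\<phi> a y, inv g, x) (Map M (y, a, \<phi> a y) v)) else 0)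
        = (if g \<in> T (\<phi> a y) then decode (\<sigma> y v) (inv a \<otimes> g) else 0)"
      proof (cases "g \<in> T (\<phi> a y)")
        case True
        have i: "inv a \<otimes> g \<in> T y" using T_translate_inv[OF a Orb_P[OF y] refl True] .
        have "Map M (\<phi> a y, inv g, x) (Map M (y, a, \<phi> a y) v) = Map M (y, inv g \<otimes> a, x) v"
          using Map_Map[OF m y a Ai[OF T_A[OF True]] refl T_inv[OF True] v] .
        moreover have "inv (inv a \<otimes> g) = inv g \<otimes> a"
          using AG[OF a] T_G[OF True] by (simp add: inv_mult_group)
        ultimately show ?thesis using i T_G[OF i] by (simp add: \<sigma>_def decode_encode)
      qed simp
    qed
    have \<sigma>: "mod_hom OC M (induced M Q) \<sigma>"
    proof -
      have "\<sigma> (Cod OC b) (Map M b v) = Map (induced M Q) b (\<sigma> (Dom OC b) v)"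
        if "b \<in> Arr OC" "v \<in> Spc M (Dom OC b)" for b v
      proof -
        obtain y a z where b: "b = (y, a, z)" by (cases b)
        then have "y \<in> Orb" "a \<in> A" "z = \<phi> a y" using that OC_arr_iff by blast+
        then show ?thesis using that \<sigma>nat[of y a v] by (simp add: b)
      qed
      then show ?thesis unfolding mod_hom_def using \<sigma>lin by simp
    qed
    have \<epsilon>\<sigma>: "\<epsilon>0 y (\<sigma> y v) = v" if y: "y \<in> Orb" and v: "v \<in> Spc M y" for y v
    proof -
      obtain t where t: "t \<in> T y" using y OrbE by blast
      note tA = T_A[OF t] and tx = T_x[OF t]
      have Tt: "(\<lambda>g. t \<otimes> g) ` S = T y" using T_translate[OF tA xP tx] T_S by simp
      have ts: "t \<otimes> s \<in> T y" if "s \<in> S" for s using Tt that by blast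
      define w where "w = Map M (y, inv t, x) v"
      have w: "w \<in> Spc M x" unfolding w_def using toV[OF t v] .
      define E where "E g = Map M (x, g, y) (decode (\<sigma> y v) g)" for g
      have "\<epsilon>0 y (\<sigma> y v) = coset_sum ((\<lambda>g. t \<otimes> g) ` S) Q E"
        unfolding \<epsilon>0_def kan_lift_def Tt E_def ..
      also have "\<dots> = coset_sum S Q (\<lambda>s. E (t \<otimes> s))"
      proof (rule coset_sum_translate[OF SQ AG[OF tA]])
        fix s q assume s: "s \<in> S" and q: "q \<in> Q"
        have "E (t \<otimes> s \<otimes> q) = E (t \<otimes> s)"
          unfolding E_def using kan_lift_summand_invariant[OF Q mq m idQ \<sigma>in[OF v] ts[OF s] q] .
        then show "E (t \<otimes> (s \<otimes> q)) = E (t \<otimes> s)"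
          using AG[OF tA] SG[OF s] subgroup.mem_carrier[OF Q(1) q] by (simp add: m_assoc)
      qed
      also have "\<dots> = coset_sum S Q (\<lambda>s. Map M (x, t, y) (Map M (x, s, x) (app f (Map M (x, inv s, x) w))))"
      proof (rule coset_sum_cong[OF SQ])
        fix s assume s: "s \<in> S"
        have "inv s \<in> S" using s fixing_S subgroup.m_inv_closed by (auto simp: fixing_def)
        then have sA: "s \<in> A" "\<phi> s x = x" "inv s \<in> S" using s by (simp_all add: S_def)
        then have sx: "\<phi> (inv s) x = x" by (simp add: S_def)
        have "decode (\<sigma> y v) (t \<otimes> s) = app f (Map M (y, inv (t \<otimes> s), x) v)"
          using ts[OF s] T_G[OF ts[OF s]] by (simp add: \<sigma>_def decode_encode)
        also have "Map M (y, inv (t \<otimes> s), x) v = Map M (x, inv s, x) w" unfolding w_def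
          using Map_Map[OF m y Ai[OF tA] Ai[OF sA(1)] T_inv[OF t] sx v] AG[OF tA] SG[OF s]
          by (simp add: inv_mult_group)
        finally have d: "decode (\<sigma> y v) (t \<otimes> s) = app f (Map M (x, inv s, x) w)" .
        have "app f (Map M (x, inv s, x) w) \<in> Spc M x"
          using fa(2) Map_pt_closed[OF fixing_S ms sA(3) w] .
        then show "E (t \<otimes> s) = Map M (x, t, y) (Map M (x, s, x) (app f (Map M (x, inv s, x) w)))"
          unfolding E_def d using Map_Map[OF m x_Orb sA(1) tA sA(2) tx] by simp
      qed
      also have "\<dots> = Map M (x, t, y) (coset_sum S Q (\<lambda>s. Map M (x, s, x) (app f (Map M (x, inv s, x) w))))"
      proof (rule coset_sum_additive_on[where h = "Map M (x, t, y)", OF SQ seqs.subspace_0[OF sV]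
            seqs.subspace_add[OF sV] _ Map_zero[OF m x_Orb tA tx], symmetric])
        fix s assume s: "s \<in> S"
        then have "inv s \<in> S" using fixing_S subgroup.m_inv_closed by (auto simp: fixing_def)
        then show "Map M (x, s, x) (app f (Map M (x, inv s, x) w)) \<in> Spc M x"
          using Map_pt_closed[OF fixing_S ms] fa(2) w s by blast
      qed (use lin_map_Orb[OF m x_Orb tA tx] in \<open>simp_all add: lin_map_def\<close>)
      also have "coset_sum S Q (\<lambda>s. Map M (x, s, x) (app f (Map M (x, inv s, x) w))) = w"
        using app_rel_trace[OF fixing_S FQ Q(2) ms f(1) w] f(2) mrep_one[OF fixing_S ms] proj_onto(2)[OF sV w] by simp
      also have "Map M (x, t, y) w = v" unfolding w_def using Map_inv'[OF m x_Orb tA tx v] .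
      finally show ?thesis .
    qed
    show "rel_projective C M (pt Q)"
      unfolding rel_projective_def convex_supp_eq[OF supp]
    proof (intro conjI exI)
      show "subcat (pt Q) OC" by (rule subcat_pt[OF Q(2)])
      show "is_counit OC (pt Q) M (induced M Q) \<epsilon>0"
        unfolding is_counit_def using kan e0 e0u by (intro exI[of _ "\<lambda>_. unit_map M Q"]) simp
      show "split_surj OC (induced M Q) M \<epsilon>0"
        unfolding split_surj_def using \<sigma> \<epsilon>\<sigma> by (intro exI[of _ \<sigma>]) simp
    qed
  }
qed

text \<open>
The empty subcategory competes in the definition of a vertex. Its left Kan extension is zero,
because the identity and the zero map both extend the empty homomorphism.
\<close>

lemma not_rel_projective_empty:
  assumes M: "is_module C M" and supp: "supp_obs C M = Orb"
  shows "\<not> rel_projective C M (transporter G r \<phi> {} B)"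
proof
  assume "rel_projective C M (transporter G r \<phi> {} B)"
  then obtain N \<epsilon> \<eta> \<sigma> where kN: "left_kan_ext OC (transporter G r \<phi> {} B) M N \<eta>" and \<epsilon>: "mod_hom OC N M \<epsilon>"
    and \<sigma>: "mod_hom OC M N \<sigma>" and \<epsilon>\<sigma>: "\<And>y v. y \<in> Orb \<Longrightarrow> v \<in> Spc M y \<Longrightarrow> \<epsilon> y (\<sigma> y v) = v"
    unfolding rel_projective_def is_counit_def split_surj_def convex_supp_eq[OF supp] by auto
  have N: "is_module OC N" using kN by (simp add: left_kan_ext_def)
  have "mod_hom (transporter G r \<phi> {} B) M N (\<lambda>_ _. 0)" by (simp add: mod_hom_def ball_Arr_transporter)
  then obtain \<xi> where \<xi>: "\<And>\<xi>'. mod_hom OC N N \<xi>' \<Longrightarrow> (\<forall>y\<in>Orb. \<forall>v\<in>Spc N y. \<xi>' y v = \<xi> y v)"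
    using kN N unfolding left_kan_ext_def by simp blast
  have "mod_hom OC N N (\<lambda>_ v. v)" using mod_hom_id transporter_closed by metis
  moreover have "mod_hom OC N N (\<lambda>_ _. 0)"
  proof -
    have "Map N b 0 = 0" if b: "b \<in> Arr OC" for b
    proof -
      obtain y a z where "b = (y, a, z)" by (cases b)
      then show ?thesis using b OC_arr_iff[of y a z] Map_zero[OF N, of y a z] by simp
    qed
    moreover have "lin_map (Spc N y) (Spc N y) (\<lambda>_. 0)" if "y \<in> Orb" for y
      using seqs.subspace_0[OF subspace_Orb[OF N that]] by (simp add: lin_map_def)
    ultimately show ?thesis unfolding mod_hom_def by simp
  qed
  ultimately have N0: "v = 0" if "y \<in> Orb" "v \<in> Spc N y" for y v using \<xi> that by metis
  have "v = 0" if v: "v \<in> Spc M x" for v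
  proof -
    have "\<sigma> x v \<in> Spc N x" using \<sigma> v x_Orb by (simp add: mod_hom_def lin_map_def)
    then have "\<sigma> x v = 0" using N0 x_Orb by blast
    moreover have "lin_map (Spc N x) (Spc M x) (\<epsilon> x)" using \<epsilon> x_Orb by (simp add: mod_hom_def)
    then have "\<epsilon> x 0 = 0" using lin_map_zero subspace_Orb[OF N x_Orb] by blast
    ultimately show ?thesis using \<epsilon>\<sigma>[OF x_Orb v] by simp
  qed
  moreover have "0 \<in> Spc M x" using seqs.subspace_0[OF subspace_Orb[OF C_OC[OF M] x_Orb]] .
  ultimately have "Spc M x = {0}" by blast
  then show False using supp supp_obs_iff[OF M] by simp
qed

lemma weakly_convex_pt: "subgroup Q G \<Longrightarrow> Q \<subseteq> S \<Longrightarrow> weakly_convex_tsub G r \<phi> X A (pt Q)"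
proof -
  assume Q: "subgroup Q G" "Q \<subseteq> S"
  have "convex_subposet X r {x}"
    unfolding convex_subposet_def using xX po(2) by (auto dest: antisymD)
  then show ?thesis unfolding weakly_convex_tsub_def
    by (intro exI[of _ "{x}"] exI[of _ Q]) (use Q in \<open>auto simp: S_def\<close>)
qed

lemma subcat_pt_pt:
  assumes "\<And>q. q \<in> Q \<Longrightarrow> \<phi> q x = x" shows "subcat (pt Q) (pt B) \<longleftrightarrow> Q \<subseteq> B"
proof
  assume s: "subcat (pt Q) (pt B)"
  show "Q \<subseteq> B"
  proof
    fix q assume "q \<in> Q"
    then have "(x, q, x) \<in> Arr (pt Q)" using assms refl_x by simp
    then have "(x, q, x) \<in> Arr (pt B)" using s unfolding subcat_def by blast
    then show "q \<in> B" by simp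
  qed
qed (auto simp: subcat_def transporter_def)

text \<open>
The weakly convex transporter subcategories of \<open>{x} \<times> H\<close> are the \<open>{x} \<times> Q\<close> with \<open>Q \<le> H\<close> and the empty
one, and a nonzero module is not projective relative to the latter.
\<close>

theorem is_vertex_iff:
  assumes M: "is_module C M" and supp: "supp_obs C M = Orb" and H: "subgroup H G" "H \<subseteq> S"
  shows "is_vertex G r \<phi> X A M (pt H) \<longleftrightarrow> has_vertex S H (mrep M x)"
proof
  have fx: "\<And>q. q \<in> S \<Longrightarrow> \<phi> q x = x" by (simp add: S_def)
  {
    assume v: "is_vertex G r \<phi> X A M (pt H)"
    have "Q = H" if Q: "subgroup Q G" "Q \<subseteq> H" "rel_proj S Q (mrep M x)" for Q
    proof -
      have QS: "Q \<subseteq> S" using Q H by auto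
      have "rel_projective C M (pt Q)" using higman[OF M supp Q(1) QS] Q by simp
      moreover have "subcat (pt Q) (pt H)" using subcat_pt_pt[of Q H] fx QS Q by blast
      ultimately have "pt Q = pt H" using v weakly_convex_pt[OF Q(1) QS] unfolding is_vertex_def by blast
      then have "subcat (pt H) (pt Q)" by (simp add: subcat_def)
      then show ?thesis using subcat_pt_pt[of H Q] fx H Q by blast
    qed
    moreover have "rel_proj S H (mrep M x)" using v higman[OF M supp H] by (simp add: is_vertex_def)
    ultimately show "has_vertex S H (mrep M x)" using H by (simp add: has_vertex_def)
  next
    assume v: "has_vertex S H (mrep M x)"
    have "D' = pt H" if D': "weakly_convex_tsub G r \<phi> X A D'" "rel_projective C M D'" "subcat D' (pt H)" for D'
    proof -
      obtain V Q where VQ: "D' = transporter G r \<phi> V Q" "subgroup Q G" "Q \<subseteq> A" "\<And>h v. h \<in> Q \<Longrightarrow> v \<in> V \<Longrightarrow> \<phi> h v \<in> V"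
        using D'(1) by (auto simp: weakly_convex_tsub_def)
      have "V \<subseteq> {x}" using D'(3) by (simp add: VQ subcat_def)
      moreover have "V \<noteq> {}" using not_rel_projective_empty[OF M supp] D'(2) VQ by blast
      ultimately have V: "V = {x}" by blast
      have fQ: "\<phi> q x = x" if "q \<in> Q" for q using VQ(4)[OF that] V by simp
      then have QS: "Q \<subseteq> S" using VQ(3) by (auto simp: S_def)
      have "Q \<subseteq> H" using D'(3) subcat_pt_pt[of Q H] fQ unfolding VQ(1) V by blast
      moreover have "rel_proj S Q (mrep M x)"
        using higman[OF M supp VQ(2) QS] D'(2) unfolding VQ(1) V by blast
      ultimately have "Q = H" using v VQ(2) by (simp add: has_vertex_def)
      then show ?thesis using VQ V by simp
    qed
    moreover have "rel_projective C M (pt H)" using v higman[OF M supp H] by (simp add: has_vertex_def)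
    ultimately show "is_vertex G r \<phi> X A M (pt H)"
      unfolding is_vertex_def using weakly_convex_pt[OF H] by blast
  }
qed

lemma indec_mods_iff:
  assumes H: "subgroup H G" "H \<subseteq> S"
  shows "M \<in> indec_mods G r \<phi> X A (pt H) OC \<longleftrightarrow>
    indecomposable C M \<and> supp_obs C M = Orb \<and> has_vertex S H (mrep M x)"
  unfolding indec_mods_def mem_Collect_eq supp_iff
  using is_vertex_iff[OF _ _ H] by (auto simp: indecomposable_def)

lemma supp_obs_supported:
  assumes "indecomposable C M" "supported M" shows "supp_obs C M = Orb"
proof -
  have M: "is_module C M" using assms by (simp add: indecomposable_def)
  show ?thesis using supp_obs_iff[OF M] indecomposable_local(2)[OF M assms(2,1)] assms(2) by blast
qed

lemma rep_iso_of_mod_iso: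
  assumes "(M, N) \<in> mod_iso_rel C" shows "rep_iso S (mrep M x) (mrep N x)"
proof -
  have M: "is_module (pt S) M" and N: "is_module (pt S) N"
    using assms OC_pt C_OC by (auto simp: mod_iso_rel_def)
  note F = fixing_S
  obtain f g where f: "mod_hom C M N f" and g: "mod_hom C N M g"
    and gf: "\<And>v. v \<in> Spc M x \<Longrightarrow> g x (f x v) = v" and fg: "\<And>v. v \<in> Spc N x \<Longrightarrow> f x (g x v) = v"
    using assms xX by (auto simp: mod_iso_rel_def mod_iso_def)
  have h: "mod_hom (pt S) M' N' k" if "mod_hom C M' N' k" for M' N' :: "('x, 'x \<times> 'a \<times> 'x, 'c) kmod" and k
    using that xX unfolding mod_hom_def ball_Arr_transporter by (auto simp: S_def)
  note f' = h[OF f, unfolded pt_hom_iff[OF F]] and g' = h[OF g, unfolded pt_hom_iff[OF F]]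
  have e: "as_endo (Spc M x) (f x) \<in> Hom S (mrep M x) (mrep N x)" "as_endo (Spc N x) (g x) \<in> Hom S (mrep N x) (mrep M x)"
    using as_endo_in_Hom[OF F M N] as_endo_in_Hom[OF F N M] f' g' by blast+
  note sM = subspace_pt[OF F M] and sN = subspace_pt[OF F N]
  note af = app_as_endo_on[OF sM conjunct1[OF f']] and ag = app_as_endo_on[OF sN conjunct1[OF g']]
  have "as_endo (Spc N x) (g x) * as_endo (Spc M x) (f x) = mrep M x \<one>"
  proof (rule Hom_eqI[OF F M M Hom_mult[OF e(2,1)] Hom_id[OF rep_mrep[OF F M]]])
    fix v assume v: "v \<in> Spc M x"
    then have "f x v \<in> Spc N x" using f' by (simp add: lin_map_def)
    then show "app (as_endo (Spc N x) (g x) * as_endo (Spc M x) (f x)) v = app (mrep M x \<one>) v"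
      using v af ag gf mrep_one[OF F M] proj_onto(2)[OF sM] by simp
  qed
  moreover have "as_endo (Spc M x) (f x) * as_endo (Spc N x) (g x) = mrep N x \<one>"
  proof (rule Hom_eqI[OF F N N Hom_mult[OF e(1,2)] Hom_id[OF rep_mrep[OF F N]]])
    fix v assume v: "v \<in> Spc N x"
    then have "g x v \<in> Spc M x" using g' by (simp add: lin_map_def)
    then show "app (as_endo (Spc M x) (f x) * as_endo (Spc N x) (g x)) v = app (mrep N x \<one>) v"
      using v af ag fg mrep_one[OF F N] proj_onto(2)[OF sN] by simp
  qed
  ultimately show ?thesis unfolding rep_iso_def using e by blast
qed

lemma direct_sum_pt: "direct_sum C M U W \<Longrightarrow> direct_sum (pt S) M U W"
proof -
  assume d: "direct_sum C M U W"
  have "is_submodule (pt S) M Z" if Z: "is_submodule C M Z" for Z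
    using Z xX unfolding is_submodule_def ball_Arr_transporter by (simp add: S_def refl_x)
  then show ?thesis using d xX by (simp add: direct_sum_def)
qed

end

section \<open>Direct summands of restricted and induced modules\<close>

context fixed_point
begin

lemma direct_sum_maps:
  assumes B: "fixing B" and N: "is_module (pt B) N" and d: "direct_sum (pt B) N U W"
  obtains i p where "i \<in> Hom B (mrep (N\<lparr>Spc := U\<rparr>) x) (mrep N x)"
    "p \<in> Hom B (mrep N x) (mrep (N\<lparr>Spc := U\<rparr>) x)"
    "p * i = mrep (N\<lparr>Spc := U\<rparr>) x \<one>"
    "\<And>u w. u \<in> U x \<Longrightarrow> w \<in> W x \<Longrightarrow> app (i * p) (u + w) = u"
proof -
  have sub: "is_submodule (pt B) N U" "is_submodule (pt B) N W" using d by (auto simp: direct_sum_def)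
  have NU: "is_module (pt B) (N\<lparr>Spc := U\<rparr>)"
    using submodule_is_module[OF N sub(1)] transporter_closed by metis
  have U: "seqs.subspace (U x)" "U x \<subseteq> Spc N x" and W: "seqs.subspace (W x)" "W x \<subseteq> Spc N x"
    using sub by (auto simp: is_submodule_def)
  have sV: "seqs.subspace (Spc N x)" using subspace_pt[OF B N] .
  have sum: "Spc N x = {u + w | u w. u \<in> U x \<and> w \<in> W x}" and int: "U x \<inter> W x = {0}"
    using d by (simp_all add: direct_sum_def)
  have stU: "Map N (x, b, x) u \<in> U x" if "b \<in> B" "u \<in> U x" for b u
    using sub(1) that B refl_x unfolding is_submodule_def ball_Arr_transporter by (simp add: fixing_def)
  have stW: "Map N (x, b, x) u \<in> W x" if "b \<in> B" "u \<in> W x" for b u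
    using sub(2) that B refl_x unfolding is_submodule_def ball_Arr_transporter by (simp add: fixing_def)
  define \<pi> where "\<pi> v = (THE u. u \<in> U x \<and> v - u \<in> W x)" for v
  have \<pi>: "\<pi> (u + w) = u" if uw: "u \<in> U x" "w \<in> W x" for u w
    unfolding \<pi>_def
  proof (rule the_equality)
    show "u \<in> U x \<and> u + w - u \<in> W x" using uw by simp
    fix u' assume u': "u' \<in> U x \<and> u + w - u' \<in> W x"
    then have "u - u' \<in> U x" using uw seqs.subspace_diff[OF U(1)] by blast
    moreover have "(u + w - u') - w \<in> W x" using u' uw seqs.subspace_diff[OF W(1)] by blast
    then have "u - u' \<in> W x" by (simp add: algebra_simps)
    ultimately have "u - u' = 0" using int by blast
    then show "u' = u" by simp
  qed
  have decomp: "\<exists>u w. v = u + w \<and> u \<in> U x \<and> w \<in> W x" if "v \<in> Spc N x" for v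
    using that unfolding sum by blast
  have lin: "lin_map (Spc N x) (U x) \<pi>" unfolding lin_map_def
  proof (intro conjI ballI allI)
    fix v c assume "v \<in> Spc N x"
    then obtain u w where v: "v = u + w" "u \<in> U x" "w \<in> W x" using decomp by blast
    show "\<pi> v \<in> U x" using v \<pi> by simp
    have "seq_scale c v = seq_scale c u + seq_scale c w" using v by (simp add: seqs.scale_right_distrib)
    then show "\<pi> (seq_scale c v) = seq_scale c (\<pi> v)"
      using v \<pi> seqs.subspace_scale[OF U(1)] seqs.subspace_scale[OF W(1)] by metis
    fix v' assume "v' \<in> Spc N x"
    then obtain u' w' where v': "v' = u' + w'" "u' \<in> U x" "w' \<in> W x" using decomp by blast
    have "v + v' = (u + u') + (w + w')" using v v' by (simp add: algebra_simps)
    then show "\<pi> (v + v') = \<pi> v + \<pi> v'"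
      using v v' \<pi> seqs.subspace_add[OF U(1)] seqs.subspace_add[OF W(1)] by metis
  qed
  have eq: "\<pi> (Map N (x, b, x) v) = Map N (x, b, x) (\<pi> v)" if b: "b \<in> B" and "v \<in> Spc N x" for b v
  proof -
    obtain u w where v: "v = u + w" "u \<in> U x" "w \<in> W x" using decomp \<open>v \<in> _\<close> by blast
    have "u \<in> Spc N x" "w \<in> Spc N x" using v U W by auto
    then have "Map N (x, b, x) v = Map N (x, b, x) u + Map N (x, b, x) w"
      using lin_map_pt[OF B N b] v by (simp add: lin_map_def)
    then show ?thesis using v \<pi> stU[OF b] stW[OF b] by metis
  qed
  define i where "i = as_endo (U x) (\<lambda>v. v)"
  define p where "p = as_endo (Spc N x) \<pi>"
  have ilin: "lin_map (U x) (Spc N x) (\<lambda>v. v)" using U by (auto simp: lin_map_def)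
  have i: "i \<in> Hom B (mrep (N\<lparr>Spc := U\<rparr>) x) (mrep N x)"
    using as_endo_in_Hom[OF B NU N, of "\<lambda>v. v"] ilin by (simp add: i_def)
  have p: "p \<in> Hom B (mrep N x) (mrep (N\<lparr>Spc := U\<rparr>) x)"
    using as_endo_in_Hom[OF B N NU, of \<pi>] lin eq by (simp add: p_def)
  have ai: "app i u = u" if "u \<in> U x" for u unfolding i_def using app_as_endo_on[OF U(1) ilin that] .
  have ap: "app p v = \<pi> v" if "v \<in> Spc N x" for v unfolding p_def using app_as_endo_on[OF sV lin that] .
  have \<pi>U: "\<pi> u = u" if "u \<in> U x" for u
    using \<pi>[OF that seqs.subspace_0[OF W(1)]] by simp
  have "p * i = mrep (N\<lparr>Spc := U\<rparr>) x \<one>"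
  proof (rule Hom_eqI[OF B NU NU Hom_mult[OF p i] Hom_id[OF rep_mrep[OF B NU]]])
    fix u assume "u \<in> Spc (N\<lparr>Spc := U\<rparr>) x"
    then have u: "u \<in> U x" by simp
    then have "u \<in> Spc N x" using U by blast
    then show "app (p * i) u = app (mrep (N\<lparr>Spc := U\<rparr>) x \<one>) u"
      using u ai ap \<pi>U mrep_one[OF B NU] proj_onto(2)[OF U(1) u] by simp
  qed
  moreover have "app (i * p) (u + w) = u" if "u \<in> U x" "w \<in> W x" for u w
  proof -
    have "u + w \<in> Spc N x" using that U W seqs.subspace_add[OF sV] by blast
    then have "app p (u + w) = u" using ap \<pi>[OF that] by metis
    then show ?thesis using ai[OF that(1)] by (simp del: app_add)
  qed
  ultimately show ?thesis using that i p by blast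
qed

text \<open>
A decomposition of a module into submodules is turned into orthogonal idempotents of the
endomorphism ring.
\<close>

lemma direct_sum_split:
  assumes B: "fixing B" and N: "is_module (pt B) N" and d: "direct_sum (pt B) N U W"
  obtains i p j q where "i \<in> Hom B (mrep (N\<lparr>Spc := U\<rparr>) x) (mrep N x)"
    "p \<in> Hom B (mrep N x) (mrep (N\<lparr>Spc := U\<rparr>) x)" "p * i = mrep (N\<lparr>Spc := U\<rparr>) x \<one>"
    "j \<in> Hom B (mrep (N\<lparr>Spc := W\<rparr>) x) (mrep N x)"
    "q \<in> Hom B (mrep N x) (mrep (N\<lparr>Spc := W\<rparr>) x)" "q * j = mrep (N\<lparr>Spc := W\<rparr>) x \<one>"
    "i * p + j * q = mrep N x \<one>"
proof -
  obtain i p where ip: "i \<in> Hom B (mrep (N\<lparr>Spc := U\<rparr>) x) (mrep N x)"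
    "p \<in> Hom B (mrep N x) (mrep (N\<lparr>Spc := U\<rparr>) x)" "p * i = mrep (N\<lparr>Spc := U\<rparr>) x \<one>"
    "\<And>u w. u \<in> U x \<Longrightarrow> w \<in> W x \<Longrightarrow> app (i * p) (u + w) = u"
    using direct_sum_maps[OF B N d] by metis
  obtain j q where jq: "j \<in> Hom B (mrep (N\<lparr>Spc := W\<rparr>) x) (mrep N x)"
    "q \<in> Hom B (mrep N x) (mrep (N\<lparr>Spc := W\<rparr>) x)" "q * j = mrep (N\<lparr>Spc := W\<rparr>) x \<one>"
    "\<And>w u. w \<in> W x \<Longrightarrow> u \<in> U x \<Longrightarrow> app (j * q) (w + u) = w"
    using direct_sum_maps[OF B N direct_sum_commute[OF d]] by metis
  have "i * p + j * q = mrep N x \<one>"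
  proof (rule Hom_eqI[OF B N N _ Hom_id[OF rep_mrep[OF B N]]])
    show "i * p + j * q \<in> Hom B (mrep N x) (mrep N x)"
      using Hom_add[OF Hom_mult[OF ip(1,2)] Hom_mult[OF jq(1,2)]] .
    fix v assume v: "v \<in> Spc N x"
    then obtain u w where uw: "v = u + w" "u \<in> U x" "w \<in> W x" using d by (auto simp: direct_sum_def)
    have "app (i * p) v = u" "app (j * q) v = w"
      using ip(4)[OF uw(2,3)] jq(4)[OF uw(3,2)] uw(1) by (simp_all add: add.commute)
    then show "app (i * p + j * q) v = app (mrep N x \<one>) v"
      unfolding app_plus_endo mrep_one[OF B N] proj_onto(2)[OF subspace_pt[OF B N] v] using uw(1) by metis
  qed
  then show ?thesis using that ip jq by blast
qed

end

context finite_group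
begin

lemma rel_proj_retract:
  assumes A: "subgroup A G" "subgroup Q G" "Q \<subseteq> A" and pr: "rel_proj A Q \<mu>"
    and i: "i \<in> Hom A \<nu> \<mu>" and p: "p \<in> Hom A \<mu> \<nu>" and pi: "p * i = \<nu> \<one>"
  shows "rel_proj A Q \<nu>"
proof -
  obtain f where f: "f \<in> Hom Q \<mu> \<mu>" "rel_trace A Q \<mu> \<mu> f = \<mu> \<one>" using pr by (auto simp: rel_proj_def)
  have "p * f * i \<in> Hom Q \<nu> \<nu>"
    using Hom_mult[OF Hom_mult[OF Hom_mono[OF p A(3)] f(1)] Hom_mono[OF i A(3)]] .
  moreover have "rel_trace A Q \<nu> \<nu> (p * f * i) = p * rel_trace A Q \<mu> \<mu> f * i"
    using rel_trace_mult_right[OF A i] rel_trace_mult_left[OF A p] by simp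
  moreover have "p * \<mu> \<one> * i = \<nu> \<one>" using Hom_idr[OF p] pi by simp
  ultimately show ?thesis using f by (auto simp: rel_proj_def)
qed

lemma retract_split:
  assumes loc: "local_rep A \<nu>" and e: "i * p + j * q = \<mu> \<one>"
    and i: "i \<in> Hom A \<alpha> \<mu>" "p \<in> Hom A \<mu> \<alpha>" and j: "j \<in> Hom A \<beta> \<mu>" "q \<in> Hom A \<mu> \<beta>"
    and r: "retract A \<nu> \<mu>"
  shows "retract A \<nu> \<alpha> \<or> retract A \<nu> \<beta>"
proof -
  have \<nu>: "rep A \<nu>" using loc by (simp add: local_rep_def)
  obtain a b where ab: "a \<in> Hom A \<nu> \<mu>" "b \<in> Hom A \<mu> \<nu>" "b * a = \<nu> \<one>" using r by (auto simp: retract_def)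
  have "\<nu> \<one> = b * \<mu> \<one> * a" using ab Hom_idr[OF ab(2)] by simp
  also have "\<dots> = (b * i) * (p * a) + (b * j) * (q * a)"
    unfolding e[symmetric] by (simp add: distrib_left distrib_right mult.assoc)
  finally have sum: "\<nu> \<one> = (b * i) * (p * a) + (b * j) * (q * a)" .
  have m: "b * i \<in> Hom A \<alpha> \<nu>" "p * a \<in> Hom A \<nu> \<alpha>" "b * j \<in> Hom A \<beta> \<nu>" "q * a \<in> Hom A \<nu> \<beta>"
    using Hom_mult ab i j by blast+
  have fin: "retract A \<nu> \<gamma>" if s: "s \<in> Hom A \<gamma> \<nu>" and t: "t \<in> Hom A \<nu> \<gamma>" and u: "unit_endo A \<nu> (s * t)" for s t \<gamma>
  proof -
    obtain w where w: "w \<in> Hom A \<nu> \<nu>" "w * (s * t) = \<nu> \<one>" using u by (auto simp: unit_endo_def)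
    then have "(w * s) * t = \<nu> \<one>" by (simp add: mult.assoc)
    then show ?thesis unfolding retract_def using t Hom_mult[OF w(1) s] by blast
  qed
  have "unit_endo A \<nu> (\<nu> \<one>)" using Hom_id[OF \<nu>] Hom_idl[OF Hom_id[OF \<nu>]] by (auto simp: unit_endo_def)
  then have "unit_endo A \<nu> ((b * i) * (p * a)) \<or> unit_endo A \<nu> ((b * j) * (q * a))"
    using local_unit_sum[OF loc Hom_mult[OF m(1,2)] Hom_mult[OF m(3,4)]] sum by simp
  then show ?thesis using fin[OF m(1,2)] fin[OF m(3,4)] by blast
qed

lemma retract_rep_iso:
  assumes K: "K \<subseteq> L" and r: "retract K \<nu> \<mu>" and iso: "rep_iso L \<mu> \<mu>'"
  shows "retract K \<nu> \<mu>'"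
proof -
  obtain a b where ab: "a \<in> Hom K \<nu> \<mu>" "b \<in> Hom K \<mu> \<nu>" "b * a = \<nu> \<one>" using r by (auto simp: retract_def)
  obtain c d where cd: "c \<in> Hom L \<mu> \<mu>'" "d \<in> Hom L \<mu>' \<mu>" "d * c = \<mu> \<one>" using iso by (auto simp: rep_iso_def)
  have "(b * d) * (c * a) = b * (d * c) * a" by (simp add: mult.assoc)
  also have "\<dots> = \<nu> \<one>" unfolding cd using Hom_idr[OF ab(2)] ab by simp
  finally show ?thesis unfolding retract_def
    using Hom_mult[OF Hom_mono[OF cd(1) K] ab(1)] Hom_mult[OF ab(2) Hom_mono[OF cd(2) K]] by blast
qed

lemma retract_rep_iso_left:
  assumes r: "retract K \<nu> \<mu>" and iso: "rep_iso K \<nu> \<nu>'"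
  shows "retract K \<nu>' \<mu>"
proof -
  obtain a b where ab: "a \<in> Hom K \<nu> \<mu>" "b \<in> Hom K \<mu> \<nu>" "b * a = \<nu> \<one>" using r by (auto simp: retract_def)
  obtain c d where cd: "c \<in> Hom K \<nu> \<nu>'" "d \<in> Hom K \<nu>' \<nu>" "c * d = \<nu>' \<one>"
    using iso by (auto simp: rep_iso_def)
  have "(c * b) * (a * d) = c * (b * a) * d" by (simp add: mult.assoc)
  also have "\<dots> = \<nu>' \<one>" unfolding ab using Hom_idr[OF cd(1)] cd by simp
  finally show ?thesis unfolding retract_def
    using Hom_mult[OF ab(1) cd(2)] Hom_mult[OF cd(1) ab(2)] by blast
qed

end

context orbit_cat
begin

text \<open>
Over the stabilizer the induced module contains \<open>N\<close> as a summand by the unit and evaluation at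
\<open>\<one>\<close>, and the trace of this idempotent is the identity.
\<close>

lemma induced_retract:
  assumes Q: "subgroup Q G" "Q \<subseteq> S" and N: "is_module (pt Q) N"
  obtains i p where "i \<in> Hom Q (mrep N x) (mrep (induced N Q) x)" "p \<in> Hom Q (mrep (induced N Q) x) (mrep N x)"
    "p * i = mrep N x \<one>"
    "rel_trace S Q (mrep (induced N Q) x) (mrep (induced N Q) x) (i * p) = mrep (induced N Q) x \<one>"
proof -
  note F = fixing_S and FQ = fixing_sub[OF Q]
  have IS: "is_module (pt S) (induced N Q)" using OC_pt[OF induced_OC[OF Q N]] .
  have IQ: "is_module (pt Q) (induced N Q)" using pt_module_mono[OF IS F FQ Q(2)] .
  note sN = subspace_pt[OF FQ N] and sI = subspace_pt[OF F IS]
  have one: "\<one> \<in> S" "\<one> \<in> Q" using F FQ subgroup.one_closed by (auto simp: fixing_def)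
  have SG: "g \<in> carrier G" if "g \<in> S" for g using that AG by (simp add: S_def)
  have Si: "inv g \<in> S" if "g \<in> S" for g using that F subgroup.m_inv_closed by (auto simp: fixing_def)
  have oT: "\<one> \<in> T x" using one T_S by simp
  define p where "p = as_endo (Spc (induced N Q) x) (\<lambda>s. decode s \<one>)"
  define i where "i = as_endo (Spc N x) (unit_map N Q)"
  have plin: "lin_map (Spc (induced N Q) x) (Spc N x) (\<lambda>s. decode s \<one>)"
    using induced_memD(1)[OF Q N _ oT] by (simp add: lin_map_def decode_add decode_scale)
  have peq: "decode (Map (induced N Q) (x, q, x) s) \<one> = Map N (x, q, x) (decode s \<one>)"
    if "q \<in> Q" "s \<in> Spc (induced N Q) x" for q s
  proof -
    have q: "inv q \<in> Q" "q \<in> carrier G" using that Q SG subgroup.m_inv_closed by auto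
    have "decode (Map (induced N Q) (x, q, x) s) \<one> = decode s (\<one> \<otimes> inv q)"
      using q by (simp add: decode_Map_induced[OF oT])
    also have "\<dots> = Map N (x, q, x) (decode s \<one>)"
      using induced_memD(2)[OF Q N that(2) oT q(1)] q by simp
    finally show ?thesis .
  qed
  have p: "p \<in> Hom Q (mrep (induced N Q) x) (mrep N x)"
    unfolding p_def using as_endo_in_Hom[OF FQ IQ N plin] peq by blast
  have i: "i \<in> Hom Q (mrep N x) (mrep (induced N Q) x)"
    unfolding i_def using as_endo_in_Hom[OF FQ N IQ unit_map_lin[OF Q N]] unit_map_equivariant[OF Q N] by blast
  have ap: "app p s = decode s \<one>" if "s \<in> Spc (induced N Q) x" for s
    unfolding p_def using app_as_endo_on[OF sI plin that] .
  have ai: "app i v = unit_map N Q v" if "v \<in> Spc N x" for v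
    unfolding i_def using app_as_endo_on[OF sN unit_map_lin[OF Q N] that] .
  have "p * i = mrep N x \<one>"
  proof (rule Hom_eqI[OF FQ N N Hom_mult[OF p i] Hom_id[OF rep_mrep[OF FQ N]]])
    fix v assume v: "v \<in> Spc N x"
    have "app (p * i) v = decode (unit_map N Q v) \<one>" using ai[OF v] ap unit_map_in[OF Q N v] by simp
    also have "\<dots> = v" using one v by (simp add: decode_unit_map[OF Q N] Map_Q1[OF Q N])
    finally show "app (p * i) v = app (mrep N x \<one>) v" using mrep_one[OF FQ N] proj_onto(2)[OF sN v] by simp
  qed
  moreover have "rel_trace S Q (mrep (induced N Q) x) (mrep (induced N Q) x) (i * p) = mrep (induced N Q) x \<one>"
  proof (rule Hom_eqI[OF F IS IS _ Hom_id[OF rep_mrep[OF F IS]]])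
    have ip: "i * p \<in> Hom Q (mrep (induced N Q) x) (mrep (induced N Q) x)" using Hom_mult[OF i p] .
    show "rel_trace S Q (mrep (induced N Q) x) (mrep (induced N Q) x) (i * p) \<in> Hom S (mrep (induced N Q) x) (mrep (induced N Q) x)"
      using rel_trace_in_Hom[OF rep_mrep[OF F IS] rep_mrep[OF F IS] Q ip] .
    fix s assume s: "s \<in> Spc (induced N Q) x"
    have "app (rel_trace S Q (mrep (induced N Q) x) (mrep (induced N Q) x) (i * p)) s
      = coset_sum S Q (\<lambda>g. Map (induced N Q) (x, g, x) (app (i * p) (Map (induced N Q) (x, inv g, x) s)))"
      using app_rel_trace[OF F FQ Q(2) IS ip s] .
    also have "\<dots> = coset_sum S Q (\<lambda>g. Map (induced N Q) (x, g, x) (unit_map N Q (decode s g)))"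
    proof (rule coset_sum_cong)
      show "coset_closed S Q" using T_coset_closed[OF Q, of x] T_S by simp
      fix g assume g: "g \<in> S"
      have m: "Map (induced N Q) (x, inv g, x) s \<in> Spc (induced N Q) x"
        using Map_pt_closed[OF F IS Si[OF g] s] .
      have "decode (Map (induced N Q) (x, inv g, x) s) \<one> = decode s g"
        using SG[OF g] by (simp add: decode_Map_induced[OF oT])
      moreover have "decode s g \<in> Spc N x" using induced_memD(1)[OF Q N s] g T_S by simp
      ultimately show "Map (induced N Q) (x, g, x) (app (i * p) (Map (induced N Q) (x, inv g, x) s))
        = Map (induced N Q) (x, g, x) (unit_map N Q (decode s g))" using ap[OF m] ai by simp
    qed
    also have "\<dots> = s" using induced_expansion[OF Q N s x_Orb] T_S by simp
    finally show "app (rel_trace S Q (mrep (induced N Q) x) (mrep (induced N Q) x) (i * p)) s = app (mrep (induced N Q) x \<one>) s"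
      using mrep_one[OF F IS] proj_onto(2)[OF sI s] by simp
  qed
  ultimately show ?thesis using that i p by blast
qed

lemma mrep_nonzero:
  assumes "is_module OC M" "mrep M x \<one> \<noteq> 0" shows "\<exists>y\<in>Obj C. Spc M y \<noteq> {0}"
proof (rule ccontr)
  assume "\<not> ?thesis"
  then have 0: "Spc M x = {0}" using xX by auto
  note ms = OC_pt[OF assms(1)]
  have "mrep M x \<one> = proj_onto {0}" using mrep_one[OF fixing_S ms] 0 by simp
  moreover have "proj_onto {0} = (0 :: 'c endo)"
    using proj_onto(1)[OF seqs.subspace_single_0] by (intro endo_eqI) simp
  ultimately show False using assms by simp
qed

lemma supported_submodule:
  assumes "supported M" "is_submodule C M U" shows "supported (M\<lparr>Spc := U\<rparr>)"
  unfolding supported_def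
proof
  fix y assume y: "y \<in> X - Orb"
  then have "U y \<subseteq> {0}" "seqs.subspace (U y)" using assms by (auto simp: supported_def is_submodule_def)
  then show "Spc (M\<lparr>Spc := U\<rparr>) y = {0}" using seqs.subspace_0[of "U y"] by auto
qed

end

lemma (in group) normalizer_eq_conj_subgroup:
  assumes fin: "finite (carrier G)" and L: "subgroup L G" and H: "H \<subseteq> L" and g: "g \<in> L"
    and eq: "finite_group.conj_subgroup G g H = H"
  shows "g \<in> normalizer (G\<lparr>carrier := L\<rparr>) H"
proof -
  interpret finite_group G by unfold_locales (rule fin)
  have "inv\<^bsub>G\<lparr>carrier := L\<rparr>\<^esub> g = inv g" using m_inv_consistent[OF L g] .
  then have "g <#\<^bsub>G\<lparr>carrier := L\<rparr>\<^esub> H #>\<^bsub>G\<lparr>carrier := L\<rparr>\<^esub> inv\<^bsub>G\<lparr>carrier := L\<rparr>\<^esub> g = conj_subgroup g H"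
    unfolding l_coset_def r_coset_def conj_subgroup_def by auto
  then show ?thesis using H g eq by (simp add: normalizer_def stabilizer_def)
qed

section \<open>The correspondence\<close>

theorem corollary4p27:
  fixes G :: "('g, 'm) monoid_scheme"
    and P :: "'x set" and r :: "('x \<times> 'x) set" and \<phi> :: "'g \<Rightarrow> 'x \<Rightarrow> 'x"
    and x :: 'x and H K :: "'g set" and p :: nat
  assumes "group G" and "finite (carrier G)"
    and "finite P" and "gposet G P r \<phi>"
    and "prime p" and "CHAR('k::field) = p" and "p dvd order G"
    and "x \<in> P"
    and "subgroup H G" and "H \<subseteq> stabilizer G \<phi> x" and "\<exists>n. card H = p ^ n"
    and "subgroup K G" and "K \<subseteq> stabilizer G \<phi> x"
    and "normalizer (G\<lparr>carrier := stabilizer G \<phi> x\<rparr>) H \<subseteq> K"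
  shows "\<exists>f. bij_betw f
    (indec_classes G r \<phi> P (carrier G)
       (transporter G r \<phi> {x} H) (transporter G r \<phi> (orbit G \<phi> x) (carrier G))
     :: ('x, 'x \<times> 'g \<times> 'x, 'k) kmod set set)
    (indec_classes G r \<phi> {x} K
       (transporter G r \<phi> {x} H) (transporter G r \<phi> {x} K)
     :: ('x, 'x \<times> 'g \<times> 'x, 'k) kmod set set)"
proof -
  interpret fg: finite_group G
    using assms(1,2) by (simp add: finite_group_def finite_group_axioms_def)
  interpret pa: group_action G P \<phi> using assms(4) by (simp add: gposet_def)
  interpret c: orbit_cat G P r \<phi> "carrier G" P x
  proof unfold_locales
    show "\<phi> a y \<in> P" if "a \<in> carrier G" "y \<in> P" for a y
      using pa.element_image[OF that refl] .
  qed (use assms(3,4,8) fg.subgroup_self in simp_all)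
  have Kx: "\<phi> k x = x" if "k \<in> K" for k using assms(13) that by (auto simp: stabilizer_def)
  interpret k: orbit_cat G P r \<phi> K "{x}" x
    by (intro orbit_cat.intro orbit_cat_axioms.intro fg.finite_group_axioms assms(3,4,12))
      (use assms(8) Kx in simp_all)
  have cS: "c.S = stabilizer G \<phi> x" by (simp add: c.S_def stabilizer_def)
  have cOrb: "c.Orb = orbit G \<phi> x" by (auto simp: c.Orb_def orbit_def)
  have kS: "k.S = K" using Kx by (auto simp: k.S_def)
  have kOrb: "k.Orb = {x}" using Kx k.x_Orb by (auto simp: k.Orb_def)
  have SG: "subgroup c.S G" using c.fixing_S by (simp add: c.fixing_def)
  have HL: "H \<subseteq> c.S" and KL: "K \<subseteq> c.S" using assms(10,13) cS by auto
  have norm: "g \<in> K" if "g \<in> c.S" "fg.conj_subgroup g H = H" for g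
    using fg.normalizer_eq_conj_subgroup[OF assms(2) SG HL that] assms(14) cS by auto
  have HK: "H \<subseteq> K"
  proof
    fix h assume h: "h \<in> H"
    interpret H: subgroup H G by fact
    have "fg.conj_subgroup h H = H"
    proof
      show "fg.conj_subgroup h H \<subseteq> H" unfolding fg.conj_subgroup_def using h by auto
      show "H \<subseteq> fg.conj_subgroup h H"
      proof
        fix g assume g: "g \<in> H"
        then have "g = h \<otimes>\<^bsub>G\<^esub> (inv\<^bsub>G\<^esub> h \<otimes>\<^bsub>G\<^esub> g \<otimes>\<^bsub>G\<^esub> h) \<otimes>\<^bsub>G\<^esub> inv\<^bsub>G\<^esub> h"
          using h by (simp add: fg.m_assoc)
        then show "g \<in> fg.conj_subgroup h H" unfolding fg.conj_subgroup_def using g h by blast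
      qed
    qed
    then show "h \<in> K" using norm HL h by blast
  qed
  interpret gr: green G c.S K H
    by (intro green.intro green_axioms.intro fg.finite_group_axioms SG assms(9,12) KL HK norm)
  have fixK: "c.fixing K" using c.fixing_sub[OF assms(12) KL] .
  have HkS: "H \<subseteq> k.S" using HK kS by simp
  define \<A> where "\<A> = (indec_mods G r \<phi> P (carrier G) (c.pt H) c.OC :: ('x, 'x \<times> 'g \<times> 'x, 'k) kmod set)"
  define \<B> where "\<B> = (indec_mods G r \<phi> {x} K (c.pt H) (c.pt K) :: ('x, 'x \<times> 'g \<times> 'x, 'k) kmod set)"
  define R where "R M N \<longleftrightarrow> fg.retract K (mrep N x) (mrep M x)" for M N :: "('x, 'x \<times> 'g \<times> 'x, 'k) kmod"
  have A: "M \<in> \<A> \<longleftrightarrow> indecomposable c.C M \<and> supp_obs c.C M = c.Orb \<and> fg.has_vertex c.S H (mrep M x)" for M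
    unfolding \<A>_def by (rule c.indec_mods_iff[OF assms(9) HL])
  have B: "N \<in> \<B> \<longleftrightarrow> indecomposable (c.pt K) N \<and> supp_obs (c.pt K) N = {x} \<and> fg.has_vertex K H (mrep N x)" for N
    unfolding \<B>_def using k.indec_mods_iff[OF assms(9) HkS, of N] by (simp add: kS kOrb)
  have ksupp: "k.supported N" for N :: "('x, 'x \<times> 'g \<times> 'x, 'k) kmod"
    by (simp add: k.supported_def kOrb)
  have Amod: "is_module c.C M" "c.supported M" "fg.local_rep c.S (mrep M x)" "fg.has_vertex c.S H (mrep M x)"
    if M: "M \<in> \<A>" for M
  proof -
    show m: "is_module c.C M" using M A by (simp add: indecomposable_def)
    show s: "c.supported M" using c.supp_obs_iff[OF m] M A by blast
    show "fg.local_rep c.S (mrep M x)" "fg.has_vertex c.S H (mrep M x)"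
      using c.indecomposable_local(1)[OF m s] M A by blast+
  qed
  have kloc: "fg.local_rep K (mrep N x)" if N: "indecomposable (c.pt K) N"
    for N :: "('x, 'x \<times> 'g \<times> 'x, 'k) kmod"
    using k.indecomposable_local(1)[OF _ ksupp N] N by (simp add: kS indecomposable_def)
  have Bmod: "is_module (c.pt K) N" "fg.local_rep K (mrep N x)" "fg.has_vertex K H (mrep N x)"
    if N: "N \<in> \<B>" for N
    using kloc N B by (auto simp: indecomposable_def)
  have MK: "is_module (c.pt K) M" if "M \<in> \<A>" for M
    using c.pt_module_mono[OF c.OC_pt[OF c.C_OC[OF Amod(1)[OF that]]] c.fixing_S fixK KL] .
  \<comment> \<open>The relation \<open>R\<close> is functional in both directions up to isomorphism.\<close>
  have unique_N: "(N, N') \<in> mod_iso_rel (c.pt K)"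
    if "M \<in> \<A>" "N \<in> \<B>" "N' \<in> \<B>" "R M N" "R M N'" for M N N'
  proof -
    have "fg.rep_iso K (mrep N x) (mrep N' x)"
      using gr.restriction_summand_unique[OF Amod(3)[OF that(1)] Bmod(2,3)[OF that(3)] Bmod(2,3)[OF that(2)]]
        that by (simp add: R_def)
    then show ?thesis
      using k.mod_iso_of_rep_iso[OF Bmod(1)[OF that(2)] ksupp Bmod(1)[OF that(3)] ksupp] Bmod(1) that
      by (simp add: mod_iso_rel_def kS)
  qed
  have unique_M: "(M, M') \<in> mod_iso_rel c.C"
    if "M \<in> \<A>" "M' \<in> \<A>" "N \<in> \<B>" "R M N" "R M' N" for M M' N
  proof -
    have "fg.rep_iso c.S (mrep M x) (mrep M' x)"
      using gr.induction_summand_unique[OF Amod(3)[OF that(1)] Amod(3)[OF that(2)] Bmod(2,3)[OF that(3)]]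
        that by (simp add: R_def)
    then show ?thesis
      using c.mod_iso_of_rep_iso[OF Amod(1,2)[OF that(1)] Amod(1,2)[OF that(2)]] Amod(1) that
      by (simp add: mod_iso_rel_def)
  qed
  have R_iso_M: "R M' N" if "R M N" "(M, M') \<in> mod_iso_rel c.C" for M M' N
    using fg.retract_rep_iso[OF KL _ c.rep_iso_of_mod_iso[OF that(2)]] that(1) by (simp add: R_def)
  have R_iso_N: "R M N'" if "R M N" "(N, N') \<in> mod_iso_rel (c.pt K)" for M N N'
    using fg.retract_rep_iso_left[OF _ k.rep_iso_of_mod_iso[OF that(2), unfolded kS]] that(1) by (simp add: R_def)
  have exists_N: "\<exists>N\<in>\<B>. R M N" if M: "M \<in> \<A>" for M
  proof -
    note loc = Amod(3)[OF M] and v = Amod(4)[OF M]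
    obtain f where f: "f \<in> fg.Hom H (mrep M x) (mrep M x)"
      and start: "fg.unit_endo c.S (mrep M x) (fg.rel_trace c.S K (mrep M x) (mrep M x)
        (fg.rel_trace K H (mrep M x) (mrep M x) f * (mrep M x \<one>\<^bsub>G\<^esub> * mrep M x \<one>\<^bsub>G\<^esub>)))"
      using gr.start_restriction[OF loc v] .
    \<comment> \<open>The condition under which a summand inherits the vertex of M, see \<open>vertex_of_restriction_summand\<close>.\<close>
    define U where "U e = fg.unit_endo c.S (mrep M x) (fg.rel_trace c.S K (mrep M x) (mrep M x)
        (fg.rel_trace K H (mrep M x) (mrep M x) f * e))" for e
    define \<Phi> where "\<Phi> N \<longleftrightarrow> (\<exists>i\<in>fg.Hom K (mrep N x) (mrep M x). \<exists>p\<in>fg.Hom K (mrep M x) (mrep N x).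
        p * i = mrep N x \<one>\<^bsub>G\<^esub> \<and> U (i * p))" for N :: "('x, 'x \<times> 'g \<times> 'x, 'k) kmod"
    have one: "mrep M x \<one>\<^bsub>G\<^esub> \<in> fg.Hom K (mrep M x) (mrep M x)"
      using fg.Hom_id[OF c.rep_mrep[OF fixK MK[OF M]]] .
    have "\<Phi> M" unfolding \<Phi>_def U_def
      by (intro bexI[OF _ one] conjI start) (rule fg.Hom_idl[OF one])
    have nz: "\<exists>y\<in>Obj (c.pt K). Spc N y \<noteq> {0}" if N: "is_module (c.pt K) N" "\<Phi> N" for N
    proof (rule k.mrep_nonzero)
      show "is_module k.OC N" using N(1) kOrb by simp
      show "mrep N x \<one>\<^bsub>G\<^esub> \<noteq> 0"
      proof
        assume 0: "mrep N x \<one>\<^bsub>G\<^esub> = 0"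
        obtain i p where ip: "i \<in> fg.Hom K (mrep N x) (mrep M x)" "U (i * p)"
          using N(2) by (auto simp: \<Phi>_def)
        have "i = 0" using fg.Hom_idr[OF ip(1)] 0 by simp
        then have "fg.unit_endo c.S (mrep M x) 0" using ip(2) by (simp add: U_def fg.rel_trace_zero)
        then show False using loc by (auto simp: fg.unit_endo_def fg.local_rep_def)
      qed
    qed
    have split: "\<Phi> (N\<lparr>Spc := V\<rparr>) \<or> \<Phi> (N\<lparr>Spc := W\<rparr>)"
      if N: "is_module (c.pt K) N" "\<Phi> N" and d: "direct_sum (c.pt K) N V W" for N V W
    proof -
      obtain a b where ab: "a \<in> fg.Hom K (mrep N x) (mrep M x)" "b \<in> fg.Hom K (mrep M x) (mrep N x)"
        "b * a = mrep N x \<one>\<^bsub>G\<^esub>" "U (a * b)" using N(2) by (auto simp: \<Phi>_def)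
      obtain i p j q where ip: "i \<in> fg.Hom K (mrep (N\<lparr>Spc := V\<rparr>) x) (mrep N x)"
        "p \<in> fg.Hom K (mrep N x) (mrep (N\<lparr>Spc := V\<rparr>) x)" "p * i = mrep (N\<lparr>Spc := V\<rparr>) x \<one>\<^bsub>G\<^esub>"
        and jq: "j \<in> fg.Hom K (mrep (N\<lparr>Spc := W\<rparr>) x) (mrep N x)"
        "q \<in> fg.Hom K (mrep N x) (mrep (N\<lparr>Spc := W\<rparr>) x)" "q * j = mrep (N\<lparr>Spc := W\<rparr>) x \<one>\<^bsub>G\<^esub>"
        and e: "i * p + j * q = mrep N x \<one>\<^bsub>G\<^esub>"
        using c.direct_sum_split[OF fixK N(1) d] by metis
      have m: "a * i \<in> fg.Hom K (mrep (N\<lparr>Spc := V\<rparr>) x) (mrep M x)"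
        "p * b \<in> fg.Hom K (mrep M x) (mrep (N\<lparr>Spc := V\<rparr>) x)"
        "a * j \<in> fg.Hom K (mrep (N\<lparr>Spc := W\<rparr>) x) (mrep M x)"
        "q * b \<in> fg.Hom K (mrep M x) (mrep (N\<lparr>Spc := W\<rparr>) x)"
        using fg.Hom_mult ab ip jq by blast+
      have id: "(p * b) * (a * i) = mrep (N\<lparr>Spc := V\<rparr>) x \<one>\<^bsub>G\<^esub>"
        "(q * b) * (a * j) = mrep (N\<lparr>Spc := W\<rparr>) x \<one>\<^bsub>G\<^esub>"
      proof -
        have "(p * b) * (a * i) = p * (b * a) * i" by (simp add: mult.assoc)
        then show "(p * b) * (a * i) = mrep (N\<lparr>Spc := V\<rparr>) x \<one>\<^bsub>G\<^esub>"
          unfolding ab(3) fg.Hom_idr[OF ip(2)] ip(3) .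
        have "(q * b) * (a * j) = q * (b * a) * j" by (simp add: mult.assoc)
        then show "(q * b) * (a * j) = mrep (N\<lparr>Spc := W\<rparr>) x \<one>\<^bsub>G\<^esub>"
          unfolding ab(3) fg.Hom_idr[OF jq(2)] jq(3) .
      qed
      have "a * b = a * mrep N x \<one>\<^bsub>G\<^esub> * b" using fg.Hom_idr[OF ab(1)] by simp
      also have "\<dots> = (a * i) * (p * b) + (a * j) * (q * b)"
        unfolding e[symmetric] by (simp add: distrib_left distrib_right mult.assoc)
      finally have "U ((a * i) * (p * b) + (a * j) * (q * b))" using ab(4) by simp
      then have "U ((a * i) * (p * b)) \<or> U ((a * j) * (q * b))"
        unfolding U_def using gr.split_restriction[OF loc f fg.Hom_mult[OF m(1,2)] fg.Hom_mult[OF m(3,4)]] by blast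
      then show ?thesis unfolding \<Phi>_def using m id by blast
    qed
    obtain N where N: "indecomposable (c.pt K) N" "\<Phi> N"
      by (rule exists_indecomposable[of "c.pt K" M \<Phi>])
        (use transporter_closed MK[OF M] \<open>\<Phi> M\<close> nz split in auto)
    obtain i p where ip: "i \<in> fg.Hom K (mrep N x) (mrep M x)" "p \<in> fg.Hom K (mrep M x) (mrep N x)"
      "p * i = mrep N x \<one>\<^bsub>G\<^esub>" "U (i * p)" using N(2) by (auto simp: \<Phi>_def)
    have "fg.has_vertex K H (mrep N x)"
      using gr.vertex_of_restriction_summand[OF loc v kloc[OF N(1)] f ip(1,2,3)] ip(4) by (simp add: U_def)
    moreover have "supp_obs (c.pt K) N = {x}"
      using k.supp_obs_supported[OF N(1) ksupp] kOrb by simp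
    moreover have "R M N" unfolding R_def fg.retract_def using ip by blast
    ultimately show ?thesis using B N(1) by blast
  qed
  have exists_M: "\<exists>M\<in>\<A>. R M N" if N: "N \<in> \<B>" for N
  proof -
    note Nm = Bmod(1)[OF N] and loc = Bmod(2)[OF N] and v = Bmod(3)[OF N]
    \<comment> \<open>The induced module has this property, and one of two complementary summands inherits it.\<close>
    define \<Phi> where "\<Phi> M \<longleftrightarrow> c.supported M \<and> fg.rel_proj c.S H (mrep M x) \<and> R M N"
      for M :: "('x, 'x \<times> 'g \<times> 'x, 'k) kmod"
    define I where "I = c.induced N K"
    have I: "is_module c.C I" unfolding I_def using c.induced_module[OF assms(12) KL Nm] .
    have IS: "is_module (c.pt c.S) I" using c.OC_pt[OF c.C_OC[OF I]] .
    obtain i p where ip: "i \<in> fg.Hom K (mrep N x) (mrep I x)" "p \<in> fg.Hom K (mrep I x) (mrep N x)"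
      "p * i = mrep N x \<one>\<^bsub>G\<^esub>" "fg.rel_trace c.S K (mrep I x) (mrep I x) (i * p) = mrep I x \<one>\<^bsub>G\<^esub>"
      unfolding I_def using c.induced_retract[OF assms(12) KL Nm] by metis
    have "fg.rel_proj c.S H (mrep I x)"
    proof -
      obtain a where a: "a \<in> fg.Hom H (mrep N x) (mrep N x)" "fg.rel_trace K H (mrep N x) (mrep N x) a = mrep N x \<one>\<^bsub>G\<^esub>"
        using v by (auto simp: fg.has_vertex_def fg.rel_proj_def)
      have iap: "i * a * p \<in> fg.Hom H (mrep I x) (mrep I x)"
        using fg.Hom_mult[OF fg.Hom_mult[OF fg.Hom_mono[OF ip(1) HK] a(1)] fg.Hom_mono[OF ip(2) HK]] .
      have "fg.rel_trace K H (mrep I x) (mrep I x) (i * a * p) = i * fg.rel_trace K H (mrep N x) (mrep N x) a * p"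
        using fg.rel_trace_mult_right[OF assms(12,9) HK ip(2)] fg.rel_trace_mult_left[OF assms(12,9) HK ip(1)] by simp
      also have "\<dots> = i * p" unfolding a fg.Hom_idr[OF ip(1)] ..
      finally have "fg.rel_trace c.S H (mrep I x) (mrep I x) (i * a * p) = mrep I x \<one>\<^bsub>G\<^esub>"
        using fg.rel_trace_trans[OF c.rep_mrep[OF c.fixing_S IS] c.rep_mrep[OF c.fixing_S IS] assms(12) KL assms(9) HK iap]
          ip(4) by simp
      then show ?thesis using iap by (auto simp: fg.rel_proj_def)
    qed
    moreover have "c.supported I" unfolding I_def using c.induced_supported[OF assms(12) KL Nm] .
    moreover have "R I N" unfolding R_def fg.retract_def using ip by blast
    ultimately have "\<Phi> I" by (simp add: \<Phi>_def)
    have nz: "\<exists>y\<in>Obj c.C. Spc M y \<noteq> {0}" if M: "is_module c.C M" "\<Phi> M" for M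
    proof (rule c.mrep_nonzero[OF c.C_OC[OF M(1)]])
      obtain a b where ab: "a \<in> fg.Hom K (mrep N x) (mrep M x)" "b * a = mrep N x \<one>\<^bsub>G\<^esub>"
        using M(2) by (auto simp: \<Phi>_def R_def fg.retract_def)
      show "mrep M x \<one>\<^bsub>G\<^esub> \<noteq> 0"
      proof
        assume "mrep M x \<one>\<^bsub>G\<^esub> = 0"
        then have "a = 0" using fg.Hom_idl[OF ab(1)] by simp
        then show False using ab loc by (simp add: fg.local_rep_def)
      qed
    qed
    have split: "\<Phi> (M\<lparr>Spc := V\<rparr>) \<or> \<Phi> (M\<lparr>Spc := W\<rparr>)"
      if M: "is_module c.C M" "\<Phi> M" and d: "direct_sum c.C M V W" for M V W
    proof -
      have MS: "is_module (c.pt c.S) M" using c.OC_pt[OF c.C_OC[OF M(1)]] .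
      obtain i p j q where ip: "i \<in> fg.Hom c.S (mrep (M\<lparr>Spc := V\<rparr>) x) (mrep M x)"
        "p \<in> fg.Hom c.S (mrep M x) (mrep (M\<lparr>Spc := V\<rparr>) x)" "p * i = mrep (M\<lparr>Spc := V\<rparr>) x \<one>\<^bsub>G\<^esub>"
        and jq: "j \<in> fg.Hom c.S (mrep (M\<lparr>Spc := W\<rparr>) x) (mrep M x)"
        "q \<in> fg.Hom c.S (mrep M x) (mrep (M\<lparr>Spc := W\<rparr>) x)" "q * j = mrep (M\<lparr>Spc := W\<rparr>) x \<one>\<^bsub>G\<^esub>"
        and e: "i * p + j * q = mrep M x \<one>\<^bsub>G\<^esub>"
        using c.direct_sum_split[OF c.fixing_S MS c.direct_sum_pt[OF d]] by metis
      have pr: "fg.rel_proj c.S H (mrep (M\<lparr>Spc := V\<rparr>) x)" "fg.rel_proj c.S H (mrep (M\<lparr>Spc := W\<rparr>) x)"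
        using fg.rel_proj_retract[OF SG assms(9) HL _ ip] fg.rel_proj_retract[OF SG assms(9) HL _ jq] M(2)
        by (auto simp: \<Phi>_def)
      have "fg.retract K (mrep N x) (mrep M x)" using M(2) by (simp add: \<Phi>_def R_def)
      then have "R (M\<lparr>Spc := V\<rparr>) N \<or> R (M\<lparr>Spc := W\<rparr>) N"
        unfolding R_def using fg.retract_split[OF loc e fg.Hom_mono[OF ip(1) KL] fg.Hom_mono[OF ip(2) KL]
            fg.Hom_mono[OF jq(1) KL] fg.Hom_mono[OF jq(2) KL]] by blast
      moreover have "c.supported (M\<lparr>Spc := V\<rparr>)" "c.supported (M\<lparr>Spc := W\<rparr>)"
        using c.supported_submodule M(2) d by (auto simp: \<Phi>_def direct_sum_def)
      ultimately show ?thesis using pr by (auto simp: \<Phi>_def)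
    qed
    obtain M where M: "indecomposable c.C M" "\<Phi> M"
      by (rule exists_indecomposable[of c.C I \<Phi>])
        (use transporter_closed assms(3) I \<open>\<Phi> I\<close> nz split in auto)
    have Mm: "is_module c.C M" using M(1) by (simp add: indecomposable_def)
    have s: "c.supported M" "fg.rel_proj c.S H (mrep M x)" "R M N" using M(2) by (auto simp: \<Phi>_def)
    have "fg.has_vertex c.S H (mrep M x)"
      using gr.vertex_of_induction_summand[OF c.indecomposable_local(1)[OF Mm s(1) M(1)] s(2) loc v] s(3)
      by (simp add: R_def)
    then show ?thesis using A M(1) s c.supp_obs_supported[OF M(1) s(1)] by blast
  qed
  have "\<exists>f. bij_betw f (\<A> // mod_iso_rel c.C) (\<B> // mod_iso_rel (c.pt K))"
  proof (rule quotient_bijection[where R = R])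
    show "sym (mod_iso_rel c.C)" "sym (mod_iso_rel (c.pt K))"
      by (auto intro: symI mod_iso_rel_sym)
    show "trans (mod_iso_rel c.C)" "trans (mod_iso_rel (c.pt K))"
      using mod_iso_rel_trans transporter_closed by (metis transI)+
    show "(M, M) \<in> mod_iso_rel c.C" if "M \<in> \<A>" for M
      using mod_iso_rel_refl[OF Amod(1)[OF that]] transporter_closed by metis
    show "(N, N) \<in> mod_iso_rel (c.pt K)" if "N \<in> \<B>" for N
      using mod_iso_rel_refl[OF Bmod(1)[OF that]] transporter_closed by metis
    show "\<exists>N\<in>\<B>. R M N" if "M \<in> \<A>" for M using exists_N that .
    show "\<exists>M\<in>\<A>. R M N" if "N \<in> \<B>" for N using exists_M that .
    show "(M, M') \<in> mod_iso_rel c.C \<longleftrightarrow> (N, N') \<in> mod_iso_rel (c.pt K)"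
      if "M \<in> \<A>" "M' \<in> \<A>" "N \<in> \<B>" "N' \<in> \<B>" "R M N" "R M' N'" for M M' N N'
      using that unique_N[OF that(2,3,4)] unique_M[OF that(1,2,4)] R_iso_M R_iso_N by blast
  qed
  then show ?thesis unfolding indec_classes_def \<A>_def \<B>_def cOrb .
qed

end
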